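(* The K process is Markovian: for every initial state $y\in\bar{\mathbb S}$, the process $X=X^y$ is a time-homogeneous Markov process with transition semigroup $(\Psi_t)_{t\ge 0}$, i.e. for all $m\ge 1$, all times $0\le t_1<t_2<\dots<t_{m+1}$ and all bounded continuous functions $f_1,\dots,f_{m+1}:\bar{\mathbb S}\to\mathbb R$, $$\mathbb E\left[f_1(X(t_1))\cdots f_m(X(t_m))\,f_{m+1}(X(t_{m+1}))\right]=\mathbb E\left[f_1(X(t_1))\cdots f_m(X(t_m))\,\Psi_{t_{m+1}-t_m}f_{m+1}(X(t_m))\right].$$
   Context: Let $\mathbb S$ be a countably infinite set, $\infty$ a symbol not in $\mathbb S$, and $\bar{\mathbb S}=\mathbb S\cup\{\infty\}$. The parameters are strictly positive reals $\{\gamma_x,\lambda_x:x\in\mathbb S\}$ and a constant $c\ge 0$, with $\sum_{x\in\mathbb S}\lambda_x=\infty$ and $\sum_{x\in\mathbb S}\lambda_x\gamma_x<\infty$; set $\gamma_\infty=0$. On a probability space $(\Omega,\mathcal F,\mathbb P)$ let the following be independent: a family $\{N_x:x\in\mathbb S\}$ of independent Poisson processes on $\mathbb R^+$, $N_x$ of rate $\lambda_x$ with marks $0<\sigma^x_1<\sigma^x_2<\cdots$ ($N_x(t)$ is the number of marks in $[0,t]$), and a family $\{T_0\}\cup\{T^x_n:n\ge 1,x\in\mathbb S\}$ of i.i.d. exponential random variables of rate $1$. Clock process: for $y\in\bar{\mathbb S}$, $t\ge 0$, $\Gamma^y(t)=\gamma_yT_0+\sum_{z\in\mathbb S}\sum_{i=1}^{N_z(t)}\gamma_zT^z_i+ct$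 (empty sums are $0$), and $\Gamma^y(s-)$ denotes its left limit at $s$. K process with initial state $y\in\bar{\mathbb S}$: $X^y(t)=y$ if $t<\gamma_yT_0$; $X^y(t)=x$ (with $x\in\mathbb S$) if $t\in\bigcup_{i\ge 1}[\Gamma^y(\sigma^x_i-),\Gamma^y(\sigma^x_i))$; $X^y(t)=\infty$ otherwise. Metric on $\bar{\mathbb S}$: $d(x,y)=(\gamma_x+\gamma_y)$ if $x\ne y$ and $d(x,x)=0$; continuity of functions on $\bar{\mathbb S}$ is with respect to $d$. Semigroup: $\Psi_tf(x)=\mathbb E[f(X^x(t))]$. *)

theory Defs
  imports "HOL-Probability.Probability"
begin

text \<open>
  The extended space \<open>S \<union> {\<infinity>}\<close> is the type \<open>'s option\<close>, with \<open>None\<close> for \<open>\<infinity>\<close>.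
  Marks and clocks are indexed by \<open>n \<ge> 1\<close>; index \<open>0\<close> is never used.
\<close>

definition ext_gamma :: "('s \<Rightarrow> real) \<Rightarrow> 's option \<Rightarrow> real" where
  "ext_gamma \<gamma> y = (case y of None \<Rightarrow> 0 | Some x \<Rightarrow> \<gamma> x)"

definition K_dist :: "('s \<Rightarrow> real) \<Rightarrow> 's option \<Rightarrow> 's option \<Rightarrow> real" where
  "K_dist \<gamma> x y = (if x = y then 0 else ext_gamma \<gamma> x + ext_gamma \<gamma> y)"

lemma Metric_space_K_dist:
  assumes "\<And>x. 0 < \<gamma> x"
  shows "Metric_space UNIV (K_dist \<gamma>)"
proof -
  have nn: "0 \<le> ext_gamma \<gamma> y" for y
    using assms by (auto simp: ext_gamma_def less_imp_le split: option.split)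
  have pos: "0 < ext_gamma \<gamma> x + ext_gamma \<gamma> y" if "x \<noteq> y" for x y
    using that assms by (cases x; cases y) (auto simp: ext_gamma_def add_pos_pos)
  have tri: "K_dist \<gamma> x z \<le> K_dist \<gamma> x y + K_dist \<gamma> y z" for x y z
    using nn[of x] nn[of y] nn[of z] by (auto simp: K_dist_def)
  show ?thesis
  proof
    show "0 \<le> K_dist \<gamma> x y" for x y
      using nn[of x] nn[of y] by (simp add: K_dist_def)
    show "K_dist \<gamma> x y = K_dist \<gamma> y x" for x y
      by (simp add: K_dist_def)
    show "K_dist \<gamma> x y = 0 \<longleftrightarrow> x = y" for x y
      using pos[of x y] by (auto simp: K_dist_def)
  qed (use tri in auto)
qed

text \<open>\<open>N(t)\<close>, the number of marks in \<open>[0,t]\<close>.\<close>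

definition num_marks :: "(nat \<Rightarrow> 'w \<Rightarrow> real) \<Rightarrow> real \<Rightarrow> 'w \<Rightarrow> nat" where
  "num_marks \<sigma> t \<omega> = card {i. 1 \<le> i \<and> \<sigma> i \<omega> \<in> {0..t}}"

text \<open>
  A Poisson process given by its marks. They are strictly increasing with finitely many of
  them in bounded intervals, so that \<^term>\<open>num_marks\<close> is the associated counting process.
\<close>

definition poisson_process :: "'w measure \<Rightarrow> real \<Rightarrow> (nat \<Rightarrow> 'w \<Rightarrow> real) \<Rightarrow> bool" where
  "poisson_process M rate \<sigma> \<longleftrightarrow>
     (\<forall>i\<ge>1. \<sigma> i \<in> borel_measurable M) \<and>
     (\<forall>\<omega>\<in>space M. 0 < \<sigma> 1 \<omega> \<and> (\<forall>i\<ge>1. \<sigma> i \<omega> < \<sigma> (Suc i) \<omega>) \<and>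
        (\<forall>t. finite {i. 1 \<le> i \<and> \<sigma> i \<omega> \<le> t})) \<and>
     (\<forall>s t. 0 \<le> s \<and> s < t \<longrightarrow>
        distr M (count_space UNIV) (\<lambda>\<omega>. num_marks \<sigma> t \<omega> - num_marks \<sigma> s \<omega>)
          = measure_pmf (poisson_pmf (rate * (t - s)))) \<and>
     (\<forall>n t. 0 \<le> t 0 \<and> (\<forall>k<n. t k < t (Suc k)) \<longrightarrow>
        prob_space.indep_vars M (\<lambda>_. count_space UNIV)
          (\<lambda>k \<omega>. num_marks \<sigma> (t (Suc k)) \<omega> - num_marks \<sigma> (t k) \<omega>) {..<n})"

text \<open>The clocks \<open>{T\<^sub>0} \<union> {T\<^sup>x\<^sub>n}\<close> as a single family; \<open>None\<close> is the index of \<open>T\<^sub>0\<close>.\<close>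

definition clock_family ::
  "('w \<Rightarrow> real) \<Rightarrow> ('s \<Rightarrow> nat \<Rightarrow> 'w \<Rightarrow> real) \<Rightarrow> ('s \<times> nat) option \<Rightarrow> 'w \<Rightarrow> real" where
  "clock_family T0 T j = (case j of None \<Rightarrow> T0 | Some (x, n) \<Rightarrow> T x n)"

definition clock_index :: "('s \<times> nat) option set" where
  "clock_index = insert None (Some ` (UNIV \<times> {1..}))"

text \<open>
  The clock process takes values in \<open>[0,\<infinity>]\<close>, so that the infinite sum and the left limits
  always exist; outside a null set it is finite. The cast \<^const>\<open>ennreal\<close> truncates only
  negative values of the exponential variables, which also occur only on a null set.
\<close>

definition clock_process ::
  "('s \<Rightarrow> real) \<Rightarrow> real \<Rightarrow> ('s \<Rightarrow> nat \<Rightarrow> 'w \<Rightarrow> real) \<Rightarrow> ('w \<Rightarrow> real) \<Rightarrow>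
   ('s \<Rightarrow> nat \<Rightarrow> 'w \<Rightarrow> real) \<Rightarrow> 's option \<Rightarrow> real \<Rightarrow> 'w \<Rightarrow> ennreal" where
  "clock_process \<gamma> c \<sigma> T0 T y t \<omega> =
     ennreal (ext_gamma \<gamma> y * T0 \<omega>) +
     (\<Sum>\<^sub>\<infinity>z. \<Sum>i = 1..num_marks (\<sigma> z) t \<omega>. ennreal (\<gamma> z * T z i \<omega>)) +
     ennreal (c * t)"

definition sojourn_set ::
  "('s \<Rightarrow> real) \<Rightarrow> real \<Rightarrow> ('s \<Rightarrow> nat \<Rightarrow> 'w \<Rightarrow> real) \<Rightarrow> ('w \<Rightarrow> real) \<Rightarrow>
   ('s \<Rightarrow> nat \<Rightarrow> 'w \<Rightarrow> real) \<Rightarrow> 's option \<Rightarrow> 's \<Rightarrow> 'w \<Rightarrow> ennreal set" where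
  "sojourn_set \<gamma> c \<sigma> T0 T y x \<omega> =
     (\<Union>i\<in>{1..}. {Lim (at_left (\<sigma> x i \<omega>)) (\<lambda>s. clock_process \<gamma> c \<sigma> T0 T y s \<omega>)
                 ..< clock_process \<gamma> c \<sigma> T0 T y (\<sigma> x i \<omega>) \<omega>})"

text \<open>
  Sojourn sets of distinct sites overlap only if marks of two of the Poisson processes
  coincide. On this null event the site is ambiguous, and the value is set to \<open>\<infinity>\<close>.
\<close>

definition K_process ::
  "('s \<Rightarrow> real) \<Rightarrow> real \<Rightarrow> ('s \<Rightarrow> nat \<Rightarrow> 'w \<Rightarrow> real) \<Rightarrow> ('w \<Rightarrow> real) \<Rightarrow>
   ('s \<Rightarrow> nat \<Rightarrow> 'w \<Rightarrow> real) \<Rightarrow> 's option \<Rightarrow> real \<Rightarrow> 'w \<Rightarrow> 's option" where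
  "K_process \<gamma> c \<sigma> T0 T y t \<omega> =
     (if t < ext_gamma \<gamma> y * T0 \<omega> then y
      else if \<exists>!x. ennreal t \<in> sojourn_set \<gamma> c \<sigma> T0 T y x \<omega>
      then Some (THE x. ennreal t \<in> sojourn_set \<gamma> c \<sigma> T0 T y x \<omega>)
      else None)"

definition K_semigroup ::
  "'w measure \<Rightarrow> ('s \<Rightarrow> real) \<Rightarrow> real \<Rightarrow> ('s \<Rightarrow> nat \<Rightarrow> 'w \<Rightarrow> real) \<Rightarrow> ('w \<Rightarrow> real) \<Rightarrow>
   ('s \<Rightarrow> nat \<Rightarrow> 'w \<Rightarrow> real) \<Rightarrow> real \<Rightarrow> ('s option \<Rightarrow> real) \<Rightarrow> 's option \<Rightarrow> real" where
  "K_semigroup M \<gamma> c \<sigma> T0 T t f x = (\<integral>\<omega>. f (K_process \<gamma> c \<sigma> T0 T x t \<omega>) \<partial>M)"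

end

theory Submission
  imports Defs
begin

text \<open>
  The K process started from \<open>\<infinity>\<close> is a deterministic functional of the positions of the Poisson
  marks and of the exponential clocks attached to them. Its Markov property at a time \<open>r\<close> comes
  from two facts: the marks and clocks after a fixed \<^emph>\<open>mark time\<close> \<open>u\<close> form an independent copy of
  the whole family, and the exponential clocks are memoryless.

  The first fact is stated as an invariance (\<open>glue_P\<close>): if the marks and clocks up to \<open>u\<close> are
  followed by an independent copy started at \<open>u\<close>, the joint law does not change. The clock
  process turns mark time into real time, and path by path the glued process agrees with the old
  one before the clock value at \<open>u\<close> and with the copy afterwards (\<open>state_glue_before\<close>,
  \<open>state_glue_after\<close>).

  The real time \<open>r\<close> corresponds to a random mark time, so it is approached from above by grids.
  For mesh \<open>h\<close>, let \<open>V\<^sub>h\<close> be the value of the clock at the first grid point where it exceeds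
  \<open>r\<close>. Summing the invariance over the possible grid points shows that the
  future after \<open>V\<^sub>h\<close> is that of a fresh process started from \<open>\<infinity>\<close> (\<open>regeneration_on_grid\<close>).
  As \<open>h \<rightarrow> 0\<close>, \<open>V\<^sub>h\<close> tends to the end of the sojourn that contains \<open>r\<close>, or to \<open>r\<close> itself
  if the state at time \<open>r\<close> is \<open>\<infinity>\<close> (\<open>clk_first_above_tendsto\<close>). The limit can be taken in
  the expectations because the process has no fixed discontinuity: a sojourn starts or ends at a
  given positive time with probability zero, since its end points depend additively on independent
  exponential clocks or, in the absence of those, on the position of a single mark
  (\<open>AE_clk_neq\<close>). Here the continuity of the test function enters: near a time spent at \<open>\<infinity>\<close>
  the process visits only sites with small \<open>\<gamma>\<close>.

  The process at time \<open>r + s\<close> is thus determined by its past up to \<open>r\<close>, by the remaining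
  sojourn at \<open>r\<close>, and by a fresh process started from \<open>\<infinity>\<close>. Given the past and the current
  site \<open>x\<close>, the remaining sojourn is again \<open>\<gamma> x\<close> times a standard exponential variable, as one
  sees by resampling the single clock that runs at time \<open>r\<close> (\<open>residual_memoryless\<close>). This is the
  definition of the semigroup at \<open>x\<close>. An arbitrary initial state only delays the process started
  from \<open>\<infinity>\<close> by one more exponential sojourn (\<open>delayed_markov\<close>), and the transfer to the given
  probability space rests on the joint law of marks and clocks (\<open>joint_law\<close>).
\<close>

section \<open>Configurations of marks and clocks\<close>

text \<open>
  The pair \<open>(x, i)\<close> stands for the mark with number \<open>i + 1\<close> of the site \<open>x\<close>, so that every index
  is used. The clock with index \<open>None\<close> is the initial one.
\<close>
type_synonym 's marks = "'s \<times> nat \<Rightarrow> real"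

type_synonym 's clocks = "('s \<times> nat) option \<Rightarrow> real"

text \<open>
  Local finiteness is expressed by unboundedness along the integers, which makes regularity a
  measurable property.
\<close>
definition regular :: "'s marks \<Rightarrow> bool" where
  "regular p \<longleftrightarrow> (\<forall>x. 0 < p (x, 0) \<and> (\<forall>i. p (x, i) < p (x, Suc i)) \<and> (\<forall>k::nat. \<exists>i. real k < p (x, i)))"

definition cnt :: "'s marks \<Rightarrow> 's \<Rightarrow> real \<Rightarrow> nat" where
  "cnt p x u = card {i. p (x, i) \<le> u}"

definition glue_pos :: "real \<Rightarrow> 's marks \<Rightarrow> 's marks \<Rightarrow> 's \<times> nat \<Rightarrow> real" where
  "glue_pos u p p' m = (case m of (x, i) \<Rightarrow>
     if i < cnt p x u then p (x, i) else u + p' (x, i - cnt p x u))"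

text \<open>
  A mark keeps its clock when marks are glued: \<open>n x\<close> is the number of marks of \<open>x\<close> that are taken
  from the first family. The initial clock belongs to the past and is taken from the first family.
\<close>
definition glue_src :: "('s \<Rightarrow> nat) \<Rightarrow> ('s \<times> nat) option \<Rightarrow> ('s \<times> nat) option + ('s \<times> nat) option" where
  "glue_src n j = (case j of None \<Rightarrow> Inl None
     | Some (x, i) \<Rightarrow> if i < n x then Inl (Some (x, i)) else Inr (Some (x, i - n x)))"

text \<open>
  Gluing the clocks and gluing the increments of the counting processes both amount to reading every
  coordinate from one of two independent families. This operation isolates what they share.
\<close>
definition select :: "('i \<Rightarrow> 'j + 'k) \<Rightarrow> ('j \<Rightarrow> 'a) \<Rightarrow> ('k \<Rightarrow> 'a) \<Rightarrow> 'i \<Rightarrow> 'a" where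
  "select e a b i = case_sum a b (e i)"

lemma regular_mono:
  assumes "regular p" "i \<le> j" shows "p (x, i) \<le> p (x, j)"
proof -
  have "mono (\<lambda>i. p (x, i))"
    using assms(1) by (intro incseq_SucI) (auto simp: regular_def less_imp_le)
  then show ?thesis using assms(2) by (auto dest: monoD)
qed

lemma regular_pos:
  assumes "regular p" shows "0 < p m"
proof -
  obtain x i where m: "m = (x, i)" by (cases m)
  have "0 < p (x, 0)" using assms by (auto simp: regular_def)
  also have "\<dots> \<le> p (x, i)" by (rule regular_mono[OF assms]) simp
  finally show ?thesis by (simp add: m)
qed

lemma regular_bound:
  assumes "regular p" obtains n where "\<And>i. p (x, i) \<le> u \<Longrightarrow> i < n"
proof -
  obtain n where n: "real (nat \<lceil>u\<rceil>) < p (x, n)" using assms unfolding regular_def by blast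
  have "u < p (x, n)" using n by linarith
  then have "i < n" if "p (x, i) \<le> u" for i
    using that regular_mono[OF assms, of n i x] by (cases "i < n") auto
  then show ?thesis using that by blast
qed

lemma less_cnt_iff:
  assumes "regular p"
  shows "i < cnt p x u \<longleftrightarrow> p (x, i) \<le> u"
proof -
  obtain n where n: "\<And>i. p (x, i) \<le> u \<Longrightarrow> i < n" using regular_bound[OF assms] by metis
  define k where "k = (LEAST k. u < p (x, k))"
  have ex: "u < p (x, n)" using n[of n] by (auto simp: not_le[symmetric])
  have k: "u < p (x, k)" unfolding k_def using ex by (rule LeastI[where P = "\<lambda>k. u < p (x, k)"])
  have "{i. p (x, i) \<le> u} = {..<k}"
  proof safe
    fix i assume "p (x, i) \<le> u"
    then show "i < k" using k regular_mono[OF assms, of k i x] by (cases "i < k") auto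
  next
    fix i assume "i < k"
    then show "p (x, i) \<le> u" using not_less_Least[of i "\<lambda>k. u < p (x, k)"] by (auto simp: k_def)
  qed
  then show ?thesis by (auto simp: cnt_def)
qed

lemma cnt_eqI: "regular p \<Longrightarrow> (\<And>i. p (x, i) \<le> u \<longleftrightarrow> i < n) \<Longrightarrow> cnt p x u = n"
  by (auto simp: cnt_def lessThan_def[symmetric])

lemma cnt_nonpos: "regular p \<Longrightarrow> u \<le> 0 \<Longrightarrow> cnt p x u = 0"
  using regular_pos[of p] by (intro cnt_eqI) (auto simp: not_le intro: le_less_trans)

lemma cnt_mono: "regular p \<Longrightarrow> u \<le> v \<Longrightarrow> cnt p x u \<le> cnt p x v"
  by (meson less_cnt_iff not_less order_trans order_refl)

text \<open>
  The counting processes of glued marks are additive. The two cases in the definition of the glued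
  marks are hidden in \<open>min u v\<close> and in the convention that nothing is counted before time zero.
\<close>
lemma cnt_glue_pos:
  assumes p: "regular p" and p': "regular p'"
  shows "cnt (glue_pos u p p') x v = cnt p x (min u v) + cnt p' x (v - u)"
proof -
  have "{i. glue_pos u p p' (x, i) \<le> v} = {..<cnt p x (min u v) + cnt p' x (v - u)}"
  proof (rule set_eqI)
    fix i
    show "i \<in> {i. glue_pos u p p' (x, i) \<le> v} \<longleftrightarrow> i \<in> {..<cnt p x (min u v) + cnt p' x (v - u)}"
    proof (cases "v \<le> u")
      case True
      have "glue_pos u p p' (x, i) \<le> v \<longleftrightarrow> p (x, i) \<le> v"
        using True less_cnt_iff[OF p, of i x u] regular_pos[OF p', of "(x, i - cnt p x u)"]
        by (auto simp: glue_pos_def)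
      then show ?thesis using True by (simp add: less_cnt_iff[OF p] cnt_nonpos[OF p'] min_def)
    next
      case False
      have "i - cnt p x u < cnt p' x (v - u) \<longleftrightarrow> i < cnt p x u + cnt p' x (v - u)" if "\<not> i < cnt p x u"
        using that by linarith
      then show ?thesis using False less_cnt_iff[OF p, of i x u] less_cnt_iff[OF p', of "i - cnt p x u" x "v - u"]
        by (auto simp: glue_pos_def min_def)
    qed
  qed
  then show ?thesis by (simp add: cnt_def)
qed

locale K_params =
  fixes \<gamma> :: "'s :: countable \<Rightarrow> real" and c :: real
  assumes \<gamma>_pos: "\<And>x. 0 < \<gamma> x" and c_nonneg: "0 \<le> c"
begin

definition jump :: "'s clocks \<Rightarrow> 's \<times> nat \<Rightarrow> ennreal" where
  "jump w m = ennreal (\<gamma> (fst m) * w (Some m))"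

text \<open>
  The total sojourn time of the marks located in \<open>B\<close>. Treating general sets \<open>B\<close> covers the clock
  and its left limits at once.
\<close>
definition mass :: "real set \<Rightarrow> 's marks \<Rightarrow> 's clocks \<Rightarrow> ennreal" where
  "mass B p w = (\<integral>\<^sup>+m. jump w m * indicator B (p m) \<partial>count_space UNIV)"

text \<open>
  The clock process without the initial clock, that is, for the initial state \<open>\<infinity>\<close>, and below it
  the left limits of its paths.
\<close>
definition clk :: "'s marks \<Rightarrow> 's clocks \<Rightarrow> real \<Rightarrow> ennreal" where
  "clk p w v = mass {..v} p w + ennreal (c * v)"

definition clk_pre :: "'s marks \<Rightarrow> 's clocks \<Rightarrow> real \<Rightarrow> ennreal" where
  "clk_pre p w v = mass {..<v} p w + ennreal (c * v)"

definition sojourn :: "'s marks \<Rightarrow> 's clocks \<Rightarrow> real \<Rightarrow> 's \<times> nat \<Rightarrow> bool" where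
  "sojourn p w q m \<longleftrightarrow> clk_pre p w (p m) \<le> ennreal q \<and> ennreal q < clk p w (p m)"

text \<open>The K process with initial state \<open>\<infinity>\<close> at time \<open>q\<close>.\<close>
definition state :: "real \<Rightarrow> 's marks \<Rightarrow> 's clocks \<Rightarrow> 's option" where
  "state q p w = (if \<exists>!x. \<exists>i. sojourn p w q (x, i) then Some (THE x. \<exists>i. sojourn p w q (x, i)) else None)"

abbreviation (input) "state_at q \<omega> \<equiv> state q (fst \<omega>) (snd \<omega>)"
abbreviation (input) "clk_at \<omega> \<equiv> clk (fst \<omega>) (snd \<omega>)"
abbreviation (input) "clk_pre_at \<omega> \<equiv> clk_pre (fst \<omega>) (snd \<omega>)"
abbreviation (input) "sojourn_at \<omega> \<equiv> sojourn (fst \<omega>) (snd \<omega>)"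

lemma mass_mono: "B \<subseteq> B' \<Longrightarrow> mass B p w \<le> mass B' p w"
  unfolding mass_def by (intro nn_integral_mono) (auto split: split_indicator)

lemma mass_cong: "(\<And>m. p m \<in> B \<longleftrightarrow> p m \<in> B') \<Longrightarrow> mass B p w = mass B' p w"
  unfolding mass_def by (intro nn_integral_cong) (auto split: split_indicator)

lemma clk_mono: "u \<le> v \<Longrightarrow> clk p w u \<le> clk p w v"
  unfolding clk_def by (intro add_mono mass_mono ennreal_leI mult_left_mono c_nonneg) auto

lemma clk_le_pre: "u < v \<Longrightarrow> clk p w u \<le> clk_pre p w v"
  unfolding clk_def clk_pre_def by (intro add_mono mass_mono ennreal_leI mult_left_mono c_nonneg) auto

lemma mass_empty: "(\<And>m. p m \<notin> B) \<Longrightarrow> mass B p w = 0"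
  unfolding mass_def by (simp add: indicator_def)

text \<open>
  Marks of the glued family with small index are old marks, exactly those located up to \<open>u\<close>. The
  map that raises the index by the number of old marks is a bijection onto the others.
\<close>
lemma mass_glue:
  fixes p p' :: "'s marks"
  assumes p: "regular p"
  shows "mass B (glue_pos u p p') (select (glue_src (\<lambda>x. cnt p x u)) w w') =
    mass (B \<inter> {..u}) p w + mass ((\<lambda>v. u + v) -` B) p' w'"
proof -
  define n where "n = (\<lambda>x. cnt p x u)"
  define g where "g = glue_pos u p p'"
  define v where "v = select (glue_src n) w w'"
  define A where "A = {m::'s \<times> nat. \<not> snd m < n (fst m)}"
  have n: "i < n x \<longleftrightarrow> p (x, i) \<le> u" for x i by (simp add: n_def less_cnt_iff[OF p])
  have nd: "cnt p x u = n x" for x by (simp add: n_def)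
  have bij: "bij_betw (\<lambda>m. (fst m, snd m + n (fst m))) UNIV A"
    unfolding A_def
    by (rule bij_betwI[where g = "\<lambda>m. (fst m, snd m - n (fst m))"]) auto
  have "mass B g v = (\<integral>\<^sup>+m. jump w m * indicator (B \<inter> {..u}) (p m) + (jump v m * indicator B (g m)) * indicator A m \<partial>count_space UNIV)"
    unfolding mass_def
  proof (intro nn_integral_cong, goal_cases)
    case (1 m)
    obtain x i where m: "m = (x, i)" by (cases m)
    show ?case
      using n[of i x]
      by (cases "i < n x") (auto simp: m A_def v_def select_def glue_src_def g_def glue_pos_def nd jump_def split: split_indicator)
  qed
  also have "\<dots> = mass (B \<inter> {..u}) p w + (\<integral>\<^sup>+m. (jump v m * indicator B (g m)) * indicator A m \<partial>count_space UNIV)"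
    by (simp add: nn_integral_add mass_def)
  also have "(\<integral>\<^sup>+m. (jump v m * indicator B (g m)) * indicator A m \<partial>count_space UNIV) = (\<integral>\<^sup>+m. (jump v m * indicator B (g m)) \<partial>count_space A)"
    by (simp add: nn_integral_count_space_indicator)
  also have "\<dots> = (\<integral>\<^sup>+m. jump v (fst m, snd m + n (fst m)) * indicator B (g (fst m, snd m + n (fst m))) \<partial>count_space UNIV)"
    by (subst nn_integral_bij_count_space[OF bij, symmetric]) simp
  also have "\<dots> = mass ((\<lambda>v. u + v) -` B) p' w'"
    unfolding mass_def
    by (intro nn_integral_cong) (auto simp: v_def select_def glue_src_def g_def glue_pos_def n_def jump_def split: split_indicator)
  finally show ?thesis by (simp add: g_def v_def n_def)
qed

context
  fixes p p' :: "'s marks" and w w' :: "'s clocks" and u g v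
  assumes p: "regular p" and p': "regular p'" and u: "0 \<le> u"
  defines "g \<equiv> glue_pos u p p'" and "v \<equiv> select (glue_src (\<lambda>x. cnt p x u)) w w'"
begin

lemma clk_glue_before: "b \<le> u \<Longrightarrow> clk g v b = clk p w b"
  unfolding clk_def g_def v_def mass_glue[OF p]
  using regular_pos[OF p'] by (subst (2) mass_empty) (auto simp: not_le intro!: mass_cong, smt (verit))

lemma clk_pre_glue_before: "b \<le> u \<Longrightarrow> clk_pre g v b = clk_pre p w b"
  unfolding clk_pre_def g_def v_def mass_glue[OF p]
  using regular_pos[OF p'] by (subst (2) mass_empty) (auto simp: not_less intro!: mass_cong, smt (verit))

lemma clk_glue_after: "0 \<le> b \<Longrightarrow> clk g v (u + b) = clk p w u + clk p' w' b"
proof -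
  assume "0 \<le> b"
  then have "{..u + b} \<inter> {..u} = {..u}" "(\<lambda>v. u + v) -` {..u + b} = {..b}" by auto
  then have "clk g v (u + b) = mass {..u} p w + mass {..b} p' w' + ennreal (c * u + c * b)"
    unfolding clk_def g_def v_def mass_glue[OF p] distrib_left by simp
  then show ?thesis using u \<open>0 \<le> b\<close> c_nonneg by (simp add: clk_def ac_simps)
qed

lemma clk_pre_glue_after: "0 < b \<Longrightarrow> clk_pre g v (u + b) = clk p w u + clk_pre p' w' b"
proof -
  assume "0 < b"
  then have "{..<u + b} \<inter> {..u} = {..u}" "(\<lambda>v. u + v) -` {..<u + b} = {..<b}" by auto
  then have "clk_pre g v (u + b) = mass {..u} p w + mass {..<b} p' w' + ennreal (c * u + c * b)"
    unfolding clk_pre_def g_def v_def mass_glue[OF p] distrib_left by simp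
  then show ?thesis using u \<open>0 < b\<close> c_nonneg by (simp add: clk_def clk_pre_def ac_simps)
qed

text \<open>
  A mark after \<open>u\<close> starts its sojourn no earlier than the clock value at \<open>u\<close>. Hence sojourns that
  contain an earlier time belong to marks up to \<open>u\<close>, which gluing leaves alone.
\<close>
lemma sojourn_glue_before:
  assumes q: "ennreal q < clk p w u"
  shows "sojourn g v q m \<longleftrightarrow> sojourn p w q m"
proof -
  obtain x i where m: "m = (x, i)" by (cases m)
  show ?thesis
  proof (cases "p m \<le> u")
    case True
    then have "g m = p m" by (auto simp: m g_def glue_pos_def less_cnt_iff[OF p])
    then show ?thesis using True by (simp add: sojourn_def clk_glue_before clk_pre_glue_before)
  next
    case False
    then have "u < g m" using regular_pos[OF p'] by (auto simp: m g_def glue_pos_def less_cnt_iff[OF p])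
    from clk_le_pre[OF this, of g v] have "\<not> sojourn g v q m"
      using q clk_glue_before[of u] by (auto simp: sojourn_def)
    moreover have "\<not> sojourn p w q m"
      using clk_le_pre[of u "p m" p w] False q by (auto simp: sojourn_def)
    ultimately show ?thesis by simp
  qed
qed

lemma state_glue_before: "ennreal q < clk p w u \<Longrightarrow> state q g v = state q p w"
  unfolding state_def by (simp add: sojourn_glue_before)

text \<open>
  From the clock value at \<open>u\<close> on, only the sojourns of new marks matter, and these are translated
  by that clock value.
\<close>
lemma state_glue_after:
  assumes q: "clk p w u \<le> ennreal q" "0 \<le> q"
  shows "state q g v = state (q - enn2real (clk p w u)) p' w'"
proof -
  define a where "a = enn2real (clk p w u)"
  have a: "clk p w u = ennreal a" "0 \<le> a"
    using q by (auto simp: a_def ennreal_enn2real_if top_unique)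
  have aq: "a \<le> q" using q a by simp
  have split: "ennreal a + y \<le> ennreal q \<longleftrightarrow> y \<le> ennreal (q - a)" "ennreal q < ennreal a + y \<longleftrightarrow> ennreal (q - a) < y" for y
  proof -
    have "ennreal q = ennreal a + ennreal (q - a)" using a aq by (simp flip: ennreal_plus)
    then show "ennreal a + y \<le> ennreal q \<longleftrightarrow> y \<le> ennreal (q - a)" "ennreal q < ennreal a + y \<longleftrightarrow> ennreal (q - a) < y"
      by (simp_all add: ennreal_add_left_cancel_le ennreal_add_left_cancel_less)
  qed
  have after: "sojourn g v q (x, i + cnt p x u) \<longleftrightarrow> sojourn p' w' (q - a) (x, i)" for x i
  proof -
    have "g (x, i + cnt p x u) = u + p' (x, i)" by (simp add: g_def glue_pos_def)
    then show ?thesis using regular_pos[OF p', of "(x, i)"]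
      by (simp add: sojourn_def clk_glue_after clk_pre_glue_after a split)
  qed
  have before: "\<not> sojourn g v q (x, i)" if "i < cnt p x u" for x i
  proof -
    have "p (x, i) \<le> u" "g (x, i) = p (x, i)" using that less_cnt_iff[OF p] by (auto simp: g_def glue_pos_def)
    then show ?thesis using q clk_mono[of "p (x, i)" u p w] by (auto simp: sojourn_def clk_glue_before)
  qed
  have "(\<exists>i. sojourn g v q (x, i)) \<longleftrightarrow> (\<exists>i. sojourn p' w' (q - a) (x, i))" for x
  proof
    assume "\<exists>i. sojourn g v q (x, i)"
    then obtain i where i: "sojourn g v q (x, i)" by auto
    then have "\<not> i < cnt p x u" using before by auto
    then have "sojourn g v q (x, (i - cnt p x u) + cnt p x u)" using i by simp
    then show "\<exists>i. sojourn p' w' (q - a) (x, i)" unfolding after by blast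
  qed (use after in blast)
  then show ?thesis by (simp add: state_def a_def)
qed

end

end

context K_params begin

text \<open>
  The properties of almost all configurations on which the path analysis relies. The last one
  makes \<open>\<infinity>\<close> approachable only through sites with small \<open>\<gamma>\<close>.
\<close>
definition good :: "'s marks \<Rightarrow> 's clocks \<Rightarrow> bool" where
  "good p w \<longleftrightarrow> regular p \<and> inj p \<and> (\<forall>v. clk p w v < \<infinity>) \<and> (\<forall>b::real. \<exists>v. ennreal b < clk p w v) \<and>
     (\<forall>e>0. \<forall>v. finite {m. e \<le> \<gamma> (fst m) \<and> p m \<le> v})"

lemma mass_fun_upd:
  assumes "inj p" "p m \<notin> B"
  shows "mass B p (w(Some m := v)) = mass B p w"
  unfolding mass_def jump_def using assms by (intro nn_integral_cong) (auto split: split_indicator)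

lemma clk_pre_fun_upd: "inj p \<Longrightarrow> clk_pre p (w(Some m := v)) (p m) = clk_pre p w (p m)"
  by (simp add: clk_pre_def mass_fun_upd)

lemma mass_split:
  assumes "inj p" "p m \<in> B"
  shows "mass B p w = mass (B - {p m}) p w + jump w m"
proof -
  have "mass B p w = (\<integral>\<^sup>+m'. jump w m' * indicator (B - {p m}) (p m') + jump w m * indicator {m} m' \<partial>count_space UNIV)"
    unfolding mass_def
    using assms by (intro nn_integral_cong) (auto split: split_indicator dest: injD)
  then show ?thesis
    by (simp add: nn_integral_add mass_def nn_integral_cmult_indicator)
qed

lemma clk_at_mark:
  assumes "inj p"
  shows "clk p w (p m) = clk_pre p w (p m) + jump w m"
proof -
  have "{..p m} - {p m} = {..<p m}" by auto
  then show ?thesis using mass_split[OF assms, of m "{..p m}" w] by (simp add: clk_def clk_pre_def ac_simps)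
qed

text \<open>Of two marks at different positions, the earlier ends its sojourn before the later starts.\<close>
lemma sojourn_unique:
  assumes "inj p" "sojourn p w q m" "sojourn p w q m'"
  shows "m = m'"
proof -
  have "\<not> p m < p m'" if "sojourn p w q m" "sojourn p w q m'" for m m'
    using clk_le_pre[of "p m" "p m'" p w] that by (auto simp: sojourn_def)
  then have "p m = p m'" using assms(2,3) by (meson linorder_neqE)
  then show ?thesis using assms(1) by (auto dest: injD)
qed

lemma state_sojourn:
  assumes "inj p" "sojourn p w q m"
  shows "state q p w = Some (fst m)"
proof -
  have *: "(\<exists>i. sojourn p w q (x, i)) \<longleftrightarrow> x = fst m" for x
    using assms sojourn_unique[of p w q] by (cases m) force
  show ?thesis by (simp add: state_def *)
qed

lemma state_Some:
  assumes "state q p w = Some x"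
  obtains i where "sojourn p w q (x, i)"
proof -
  from assms have *: "\<exists>!x. \<exists>i. sojourn p w q (x, i)" and x: "x = (THE x. \<exists>i. sojourn p w q (x, i))"
    by (auto simp: state_def split: if_splits)
  from theI'[OF *] that show ?thesis unfolding x by blast
qed

lemma state_None: "(\<And>m. \<not> sojourn p w q m) \<Longrightarrow> state q p w = None"
  by (meson not_Some_eq state_Some)

lemma clk_0: "regular p \<Longrightarrow> v \<le> 0 \<Longrightarrow> clk p w v = 0"
  unfolding clk_def
  using regular_pos[of p] c_nonneg by (subst mass_empty) (auto simp: not_le mult_nonneg_nonpos ennreal_neg intro: le_less_trans)

text \<open>Dominated convergence, with the finite mass up to a bound of the sequence as majorant.\<close>
lemma clk_right_cont:
  assumes fin: "\<And>v. clk p w v < \<infinity>" and T: "T \<longlonglongrightarrow> b" "\<And>n. b \<le> T n"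
  shows "(\<lambda>n. clk p w (T n)) \<longlonglongrightarrow> clk p w b"
proof -
  from T(1) have "Bseq T" by (rule convergentI[THEN convergent_imp_Bseq])
  then obtain C where C: "\<And>n. T n \<le> C" by (metis Bseq_def abs_le_D1 real_norm_def)
  have "(\<lambda>n. mass {..T n} p w) \<longlonglongrightarrow> mass {..b} p w"
    unfolding mass_def
  proof (rule nn_integral_dominated_convergence[where w = "\<lambda>m. jump w m * indicator {..C} (p m)"])
    have "mass {..C} p w \<le> clk p w C" by (simp add: clk_def)
    then show "(\<integral>\<^sup>+m. jump w m * indicator {..C} (p m) \<partial>count_space UNIV) < \<infinity>"
      using fin[of C] by (simp add: mass_def)
    show "AE m in count_space UNIV. jump w m * indicator {..T j} (p m) \<le> jump w m * indicator {..C} (p m)" for j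
      using C order_trans by (auto simp: AE_count_space split: split_indicator)
    show "AE m in count_space UNIV. (\<lambda>i. jump w m * indicator {..T i} (p m)) \<longlonglongrightarrow> jump w m * indicator {..b} (p m)"
    proof (simp add: AE_count_space, intro allI tendsto_eventually)
      fix x i
      show "\<forall>\<^sub>F j in sequentially. jump w (x, i) * indicator {..T j} (p (x, i)) = jump w (x, i) * indicator {..b} (p (x, i))"
      proof (cases "p (x, i) \<le> b")
        case True
        then show ?thesis using T(2) by (intro always_eventually allI) (metis atMost_iff indicator_simps(1) order_trans)
      next
        case False
        then have "\<forall>\<^sub>F j in sequentially. T j < p (x, i)" using T(1) by (intro order_tendstoD) auto
        then show ?thesis by eventually_elim (use False in auto)
      qed
    qed
  qed simp_all
  moreover have "(\<lambda>n. ennreal (c * T n)) \<longlonglongrightarrow> ennreal (c * b)" using T(1) by (intro tendsto_ennrealI tendsto_intros)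
  ultimately show ?thesis unfolding clk_def by (intro tendsto_add)
qed

text \<open>Monotone convergence; the value may be infinite.\<close>
lemma clk_left_limit:
  assumes T: "T \<longlonglongrightarrow> b" "\<And>n. T n < b" "incseq T"
  shows "(\<lambda>n. clk p w (T n)) \<longlonglongrightarrow> clk_pre p w b"
proof -
  have inc: "incseq (\<lambda>n m. jump w m * indicator {..T n} (p m))"
    using T(3) by (auto simp: incseq_def le_fun_def split: split_indicator intro: order_trans)
  have "(SUP n. mass {..T n} p w) = (\<integral>\<^sup>+m. (SUP n. jump w m * indicator {..T n} (p m)) \<partial>count_space UNIV)"
    unfolding mass_def by (rule nn_integral_monotone_convergence_SUP[OF inc, symmetric]) simp
  also have "\<dots> = mass {..<b} p w"
    unfolding mass_def
  proof (intro nn_integral_cong)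
    fix m
    show "(SUP n. jump w m * indicator {..T n} (p m)) = jump w m * indicator {..<b} (p m)"
    proof (cases "p m < b")
      case True
      then have "\<forall>\<^sub>F n in sequentially. p m < T n" using T(1) by (intro order_tendstoD)
      then obtain n where "p m < T n" by (auto simp: eventually_sequentially)
      then show ?thesis using True by (intro antisym SUP_least SUP_upper2[of n]) (auto split: split_indicator)
    next
      case False
      then have "\<not> p m \<le> T n" for n using T(2)[of n] by auto
      then show ?thesis using False by simp
    qed
  qed
  finally have "(SUP n. mass {..T n} p w) = mass {..<b} p w" .
  moreover have "incseq (\<lambda>n. mass {..T n} p w)"
    using T(3) by (auto simp: incseq_def intro!: mass_mono)
  ultimately have "(\<lambda>n. mass {..T n} p w) \<longlonglongrightarrow> mass {..<b} p w" using LIMSEQ_SUP by metis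
  moreover have "(\<lambda>n. ennreal (c * T n)) \<longlonglongrightarrow> ennreal (c * b)" using T(1) by (intro tendsto_ennrealI tendsto_intros)
  ultimately show ?thesis unfolding clk_def clk_pre_def by (intro tendsto_add)
qed

definition first_above :: "real \<Rightarrow> real \<Rightarrow> 's marks \<Rightarrow> 's clocks \<Rightarrow> nat" where
  "first_above h r p w = (LEAST k. ennreal r < clk p w (real k * h))"

text \<open>The mark whose sojourn contains the time \<open>r\<close>, if there is one.\<close>
definition occupied :: "real \<Rightarrow> 's marks \<Rightarrow> 's clocks \<Rightarrow> ('s \<times> nat) option" where
  "occupied r p w = (if \<exists>!m. sojourn p w r m then Some (THE m. sojourn p w r m) else None)"

text \<open>
  The end of the sojourn that contains \<open>r\<close>, or \<open>r\<close> itself while the process is at \<open>\<infinity>\<close>.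
\<close>
definition clk_after :: "real \<Rightarrow> 's marks \<Rightarrow> 's clocks \<Rightarrow> ennreal" where
  "clk_after r p w = (case occupied r p w of None \<Rightarrow> ennreal r | Some m \<Rightarrow> clk p w (p m))"

lemma occupied_eq_Some_iff:
  assumes inj: "inj p"
  shows "occupied r p w = Some m \<longleftrightarrow> sojourn p w r m"
proof
  assume "occupied r p w = Some m"
  then have "\<exists>!m. sojourn p w r m" "m = (THE m. sojourn p w r m)"
    by (auto simp: occupied_def split: if_splits)
  then show "sojourn p w r m" using theI'[of "sojourn p w r"] by blast
next
  assume m: "sojourn p w r m"
  then have uniq: "m' = m" if "sojourn p w r m'" for m' using sojourn_unique[OF inj that] by blast
  then have "(THE m. sojourn p w r m) = m" using m by (intro the_equality)
  moreover have "\<exists>!m. sojourn p w r m" using m uniq by (rule ex1I)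
  ultimately show "occupied r p w = Some m" unfolding occupied_def by simp
qed

lemma occupied_eq_None_iff: "inj p \<Longrightarrow> occupied r p w = None \<longleftrightarrow> (\<forall>m. \<not> sojourn p w r m)"
  by (metis not_Some_eq occupied_eq_Some_iff)

lemma clk_first_above:
  assumes "good p w" "0 < h"
  shows "ennreal r < clk p w (real (first_above h r p w) * h)"
proof -
  obtain v where v: "ennreal r < clk p w v" using assms unfolding good_def by blast
  obtain k where "v / h < real k" using reals_Archimedean2 by blast
  then have "v \<le> real k * h" using assms by (simp add: field_simps)
  then have "ennreal r < clk p w (real k * h)" using v clk_mono by (metis less_le_trans)
  then show ?thesis unfolding first_above_def by (rule LeastI)
qed

text \<open>
  The first grid points at which the clock exceeds \<open>r\<close> approach, from the right, the first mark
  time \<open>L\<close> after which the clock exceeds \<open>r\<close>; by right continuity the clock values converge to the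
  value at \<open>L\<close>. The left limit at \<open>L\<close> is at most \<open>r\<close>, so either \<open>L\<close> is the mark whose
  sojourn contains \<open>r\<close>, or the value at \<open>L\<close> is \<open>r\<close>.
\<close>
lemma clk_first_above_tendsto:
  assumes good: "good p w" and r: "0 \<le> r" and h: "\<And>n. 0 < h n" "h \<longlonglongrightarrow> 0"
  shows "(\<lambda>n. clk p w (real (first_above (h n) r p w) * h n)) \<longlonglongrightarrow> clk_after r p w"
proof -
  have reg: "regular p" and inj: "inj p" and fin: "\<And>v. clk p w v < \<infinity>"
    using good by (auto simp: good_def)
  define D where "D = {v. ennreal r < clk p w v}"
  define L where "L = Inf D"
  define T where "T = (\<lambda>n. real (first_above (h n) r p w) * h n)"
  have up: "v' \<in> D" if "v \<in> D" "v \<le> v'" for v v' using that clk_mono[of v v' p w] by (auto simp: D_def)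
  have T: "T n \<in> D" for n using clk_first_above[OF good h(1)] by (simp add: D_def T_def)
  have D0: "0 < v" if "v \<in> D" for v
    using that clk_0[OF reg, of v w] by (cases "v \<le> 0") (auto simp: D_def)
  have bdd: "bdd_below D" using D0 by (meson bdd_belowI less_imp_le)
  have LT: "L \<le> T n" for n unfolding L_def by (intro cInf_lower T bdd)
  have TL: "T n \<le> L + h n" for n
  proof -
    let ?k = "first_above (h n) r p w"
    have "0 < ?k" using D0[OF T[of n]] h(1)[of n] by (auto simp: T_def zero_less_mult_iff)
    then have "ennreal r \<ge> clk p w (real (?k - 1) * h n)"
      using not_less_Least[of "?k - 1" "\<lambda>k. ennreal r < clk p w (real k * h n)"]
      by (simp add: first_above_def not_less)
    then have "T n - h n \<notin> D" using \<open>0 < ?k\<close> by (simp add: D_def T_def of_nat_diff left_diff_distrib)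
    then have "\<And>v. v \<in> D \<Longrightarrow> T n - h n \<le> v" using up by (meson linear)
    then have "T n - h n \<le> L" unfolding L_def using T by (intro cInf_greatest) auto
    then show ?thesis by simp
  qed
  have lim: "T \<longlonglongrightarrow> L"
  proof (rule tendsto_sandwich)
    show "\<forall>\<^sub>F n in sequentially. L \<le> T n" "\<forall>\<^sub>F n in sequentially. T n \<le> L + h n"
      using LT TL by simp_all
    show "(\<lambda>n. L + h n) \<longlonglongrightarrow> L" using tendsto_add[OF tendsto_const h(2), of L] by simp
  qed simp
  have conv: "(\<lambda>n. clk p w (T n)) \<longlonglongrightarrow> clk p w L" by (intro clk_right_cont fin lim LT)
  have ge: "ennreal r \<le> clk p w L"
  proof (rule LIMSEQ_le_const[OF conv], intro exI allI impI)
    show "ennreal r \<le> clk p w (T n)" for n using T[of n] by (simp add: D_def)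
  qed
  have below: "clk p w v \<le> ennreal r" if "v < L" for v
  proof (rule ccontr)
    assume "\<not> clk p w v \<le> ennreal r"
    then have "L \<le> v" unfolding L_def by (intro cInf_lower bdd) (simp add: D_def)
    then show False using that by simp
  qed
  (* Before L the clock is at most r. *)
  have le: "clk_pre p w L \<le> ennreal r"
  proof (rule LIMSEQ_le_const2[OF clk_left_limit])
    show "(\<lambda>n. L - 1 / real (Suc n)) \<longlonglongrightarrow> L"
      using tendsto_diff[OF tendsto_const LIMSEQ_inverse_real_of_nat, of L] by (simp add: inverse_eq_divide)
    show "incseq (\<lambda>n. L - 1 / real (Suc n))" by (intro incseq_SucI diff_left_mono frac_le) simp_all
    show "L - 1 / real (Suc n) < L" for n by simp
    show "\<exists>N. \<forall>n\<ge>N. clk p w (L - 1 / real (Suc n)) \<le> ennreal r" by (intro exI allI impI below) simp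
  qed
  (* The clock exceeds r from the occupying mark on, but not before it. *)
  have mark: "p m = L" if m: "sojourn p w r m" for m
  proof (rule antisym)
    have "p m \<in> D" using m by (simp add: sojourn_def D_def)
    then show "L \<le> p m" unfolding L_def by (intro cInf_lower bdd)
    have "p m \<le> v" if "v \<in> D" for v
    proof (rule ccontr)
      assume "\<not> p m \<le> v"
      then have "clk p w v \<le> clk_pre p w (p m)" by (intro clk_le_pre) simp
      then show False using that m by (auto simp: D_def sojourn_def)
    qed
    then show "p m \<le> L" unfolding L_def using T by (intro cInf_greatest) auto
  qed
  have "clk_after r p w = clk p w L"
  proof (cases "\<exists>m. sojourn p w r m")
    case True
    then obtain m where "sojourn p w r m" by blast
    then show ?thesis using mark[of m] occupied_eq_Some_iff[OF inj, of r w m] by (simp add: clk_after_def)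
  next
    case False
    have "clk p w L \<le> ennreal r"
    proof (cases "\<exists>m. p m = L")
      case True
      then show ?thesis using False le by (auto simp: sojourn_def not_less)
    next
      case neq: False
      have "mass {..L} p w = mass {..<L} p w"
      proof (rule mass_cong)
        fix m show "p m \<in> {..L} \<longleftrightarrow> p m \<in> {..<L}" using neq by (metis atMost_iff lessThan_iff order_less_le)
      qed
      then show ?thesis using le by (simp add: clk_def clk_pre_def)
    qed
    then show ?thesis using ge False occupied_eq_None_iff[OF inj, of r w] by (simp add: clk_after_def)
  qed
  then show ?thesis using conv by (simp add: T_def)
qed

text \<open>
  Inside a sojourn the process is constant. If it is at \<open>\<infinity>\<close> at time \<open>q\<close>, only finitely many
  sojourns of sites with \<open>\<gamma> x \<ge> d\<close> come near \<open>q\<close>, and none of them has \<open>q\<close> in its closure;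
  so near \<open>q\<close> the process is at \<open>\<infinity>\<close> or at sites with \<open>\<gamma> x < d\<close>.
\<close>
lemma state_continuous_at:
  assumes good: "good p w"
    and q: "0 < q" "\<And>m. clk p w (p m) \<noteq> ennreal q" "\<And>m. clk_pre p w (p m) \<noteq> ennreal q"
    and f: "\<And>e. 0 < e \<Longrightarrow> \<exists>d>0. \<forall>x. \<gamma> x < d \<longrightarrow> \<bar>f (Some x) - f None\<bar> < e"
    and Q: "Q \<longlonglongrightarrow> q"
  shows "(\<lambda>n. f (state (Q n) p w) :: real) \<longlonglongrightarrow> f (state q p w)"
proof -
  have inj: "inj p" using good by (auto simp: good_def)
  have eQ: "(\<lambda>n. ennreal (Q n)) \<longlonglongrightarrow> ennreal q" using Q by (rule tendsto_ennrealI)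
  show ?thesis
  proof (cases "\<exists>m. sojourn p w q m")
    case True
    then obtain m where m: "sojourn p w q m" by auto
    then have "clk_pre p w (p m) < ennreal q" "ennreal q < clk p w (p m)"
      using q(3)[of m] unfolding sojourn_def by (metis order_less_le)+
    then have "\<forall>\<^sub>F n in sequentially. clk_pre p w (p m) < ennreal (Q n)"
      "\<forall>\<^sub>F n in sequentially. ennreal (Q n) < clk p w (p m)"
      using order_tendstoD[OF eQ] by auto
    then have "\<forall>\<^sub>F n in sequentially. f (state (Q n) p w) = f (state q p w)"
    proof eventually_elim
      case (elim n)
      then have "sojourn p w (Q n) m" by (simp add: sojourn_def)
      then show ?case using m inj by (simp add: state_sojourn)
    qed
    then show ?thesis by (rule tendsto_eventually)
  next
    case False
    then have None: "state q p w = None" by (intro state_None) auto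
    show ?thesis
    proof (rule tendstoI)
      fix e :: real assume "0 < e"
      then obtain d where d: "0 < d" "\<And>x. \<gamma> x < d \<Longrightarrow> \<bar>f (Some x) - f None\<bar> < e" using f by metis
      obtain v where v: "ennreal (q + 1) < clk p w v" using good unfolding good_def by blast
      define F where "F = {m. d \<le> \<gamma> (fst m) \<and> p m \<le> v}"
      have "finite F" using good d(1) by (simp add: F_def good_def)
      moreover have "\<forall>\<^sub>F n in sequentially. \<not> sojourn p w (Q n) m" for m
      proof -
        have "ennreal q < clk_pre p w (p m) \<or> clk p w (p m) < ennreal q"
          using False q(2)[of m] unfolding sojourn_def by (metis not_le order_less_le)
        then show ?thesis
        proof
          assume "ennreal q < clk_pre p w (p m)"
          from order_tendstoD(2)[OF eQ this] show ?thesis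
            by eventually_elim (auto simp: sojourn_def)
        next
          assume "clk p w (p m) < ennreal q"
          from order_tendstoD(1)[OF eQ this] show ?thesis
            by eventually_elim (auto simp: sojourn_def)
        qed
      qed
      ultimately have "\<forall>\<^sub>F n in sequentially. \<forall>m\<in>F. \<not> sojourn p w (Q n) m"
        by (auto intro: eventually_ball_finite)
      moreover have "\<forall>\<^sub>F n in sequentially. Q n < q + 1" using Q by (rule order_tendstoD) simp
      ultimately show "\<forall>\<^sub>F n in sequentially. dist (f (state (Q n) p w)) (f (state q p w)) < e"
      proof eventually_elim
        case (elim n)
        show ?case
        proof (cases "state (Q n) p w")
          case None2: None
          then show ?thesis using \<open>0 < e\<close> None by simp
        next
          case (Some x)
          then obtain i where i: "sojourn p w (Q n) (x, i)" by (rule state_Some)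
          have "p (x, i) \<le> v"
          proof (rule ccontr)
            assume "\<not> p (x, i) \<le> v"
            then have "clk p w v \<le> clk_pre p w (p (x, i))" by (intro clk_le_pre) simp
            also have "\<dots> \<le> ennreal (Q n)" using i by (simp add: sojourn_def)
            also have "\<dots> \<le> ennreal (q + 1)" using elim(2) by (intro ennreal_leI) simp
            finally show False using v by simp
          qed
          then have "\<gamma> x < d" using elim(1) i by (force simp: F_def)
          then show ?thesis using d(2) Some None by (simp add: dist_real_def)
        qed
      qed
    qed
  qed
qed

text \<open>
  The clock that runs at time \<open>r\<close> has no influence on the path up to time \<open>r\<close>, as long as it
  still runs at time \<open>r\<close>.
\<close>
lemma state_fun_upd:
  assumes inj: "inj p" and q: "q \<le> r"
    and s: "sojourn p (w(Some m := v)) r m" "sojourn p (w(Some m := v')) r m"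
  shows "state q p (w(Some m := v)) = state q p (w(Some m := v'))"
proof -
  have qr: "ennreal q \<le> ennreal r" using q by (rule ennreal_leI)
  have "sojourn p (w(Some m := v)) q m' \<longleftrightarrow> sojourn p (w(Some m := v')) q m'" for m'
  proof -
    consider "m' = m" | "p m' < p m" | "p m < p m'" using inj by (metis injD linorder_neqE)
    then show ?thesis
    proof cases
      case 1
      then show ?thesis using s qr le_less_trans by (auto simp: sojourn_def clk_pre_fun_upd[OF inj])
    next
      case 2
      then show ?thesis by (simp add: sojourn_def clk_def clk_pre_def mass_fun_upd[OF inj])
    next
      case 3
      have "\<not> sojourn p (w(Some m := u)) q m'" if "sojourn p (w(Some m := u)) r m" for u
        using clk_le_pre[OF 3, of p "w(Some m := u)"] that qr by (auto simp: sojourn_def)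
      then show ?thesis using s by auto
    qed
  qed
  then show ?thesis by (simp add: state_def)
qed

end

section \<open>Regeneration of Poisson marks\<close>

abbreviation POS :: "'s marks measure" where
  "POS \<equiv> PiM UNIV (\<lambda>_. borel)"

abbreviation COUNTS :: "('i \<Rightarrow> nat) measure" where
  "COUNTS \<equiv> PiM UNIV (\<lambda>_. count_space UNIV)"

lemma measurable_select [measurable]:
  assumes "\<And>i. case_sum \<nu> \<nu>' (e i) = \<mu> i"
  shows "(\<lambda>(a, b). select e a b) \<in> measurable (PiM UNIV \<nu> \<Otimes>\<^sub>M PiM UNIV \<nu>') (PiM UNIV \<mu>)"
proof (rule measurable_PiM_single')
  fix i
  show "(\<lambda>\<omega>. (case \<omega> of (a, b) \<Rightarrow> select e a b) i) \<in> measurable (PiM UNIV \<nu> \<Otimes>\<^sub>M PiM UNIV \<nu>') (\<mu> i)"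
    unfolding select_def assms[of i, symmetric] by (cases "e i") (auto simp: case_prod_beta)
qed (auto simp: space_PiM space_pair_measure PiE_iff select_def assms[symmetric] split: sum.split)

text \<open>
  A cylinder event for the selected family is a product of two cylinder events, and as the
  selection is injective, each factor of its probability occurs once.
\<close>
lemma distr_select:
  fixes \<nu> :: "'i \<Rightarrow> 'a measure"
  assumes prob: "\<And>i. prob_space (\<nu> i)" and inj: "inj e" and e: "\<And>i. case_sum \<nu> \<nu> (e i) = \<nu> i"
  shows "distr (PiM UNIV \<nu> \<Otimes>\<^sub>M PiM UNIV \<nu>) (PiM UNIV \<nu>) (\<lambda>(a, b). select e a b) = PiM UNIV \<nu>"
proof -
  interpret product_prob_space \<nu> UNIV by (rule product_prob_spaceI[OF prob])
  let ?P = "PiM UNIV \<nu>"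
  interpret PP: pair_prob_space ?P ?P ..
  note meas = measurable_select[of \<nu> \<nu> e \<nu>, OF e]
  show ?thesis
  proof (rule PiM_eq)
    fix J :: "'i set" and F assume J: "finite J" and F: "\<And>j. j \<in> J \<Longrightarrow> F j \<in> sets (\<nu> j)"
    define KL where "KL = {k. Inl k \<in> e ` J}"
    define KR where "KR = {k. Inr k \<in> e ` J}"
    define X where "X s = F (inv e s)" for s
    have eJ: "e ` J = Inl ` KL \<union> Inr ` KR"
    proof (rule set_eqI)
      fix s show "s \<in> e ` J \<longleftrightarrow> s \<in> Inl ` KL \<union> Inr ` KR" by (cases s) (auto simp: KL_def KR_def)
    qed
    have fin: "finite KL" "finite KR"
      using finite_vimageI[OF finite_imageI[OF J], of Inl e] finite_vimageI[OF finite_imageI[OF J], of Inr e]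
      by (simp_all add: KL_def KR_def vimage_def)
    have X: "X (e j) = F j" for j using inj by (simp add: X_def)
    have sets: "X s \<in> sets (case_sum \<nu> \<nu> s)" if "s \<in> e ` J" for s using that F by (auto simp: X e)
    have setsL: "X (Inl k) \<in> sets (\<nu> k)" if "k \<in> KL" for k using sets[of "Inl k"] that by (auto simp: KL_def)
    have setsR: "X (Inr k) \<in> sets (\<nu> k)" if "k \<in> KR" for k using sets[of "Inr k"] that by (auto simp: KR_def)
    have cyl: "{a \<in> space ?P. \<forall>k\<in>K. a k \<in> Y k} \<in> sets ?P"
      if "finite K" "\<And>k. k \<in> K \<Longrightarrow> Y k \<in> sets (\<nu> k)" for K Y
    proof (rule sets.sets_Collect_finite_All[OF _ that(1)])
      fix k assume "k \<in> K"
      note [measurable] = that(2)[OF this]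
      show "{a \<in> space ?P. a k \<in> Y k} \<in> sets ?P" by measurable
    qed
    have space: "a i \<in> space (\<nu> i)" if "a \<in> space ?P" for a i using that by (auto simp: space_PiM)
    have vimage: "(\<lambda>(a, b). select e a b) -` prod_emb UNIV \<nu> J (Pi\<^sub>E J F) \<inter> space (?P \<Otimes>\<^sub>M ?P) =
      {a \<in> space ?P. \<forall>k\<in>KL. a k \<in> X (Inl k)} \<times> {b \<in> space ?P. \<forall>k\<in>KR. b k \<in> X (Inr k)}" (is "?A = ?B")
    proof -
      have "select e a b \<in> prod_emb UNIV \<nu> J (Pi\<^sub>E J F) \<longleftrightarrow> (\<forall>k\<in>KL. a k \<in> X (Inl k)) \<and> (\<forall>k\<in>KR. b k \<in> X (Inr k))"
        if ab: "a \<in> space ?P" "b \<in> space ?P" for a b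
      proof -
        have "(\<lambda>(a, b). select e a b) (a, b) \<in> space ?P"
          using ab by (intro measurable_space[OF meas]) (auto simp: space_pair_measure)
        then have "select e a b \<in> prod_emb UNIV \<nu> J (Pi\<^sub>E J F) \<longleftrightarrow> (\<forall>j\<in>J. case_sum a b (e j) \<in> X (e j))"
          by (auto simp: prod_emb_def space_PiM select_def X)
        also have "\<dots> \<longleftrightarrow> (\<forall>s\<in>e ` J. case_sum a b s \<in> X s)" by auto
        also have "\<dots> \<longleftrightarrow> (\<forall>k\<in>KL. a k \<in> X (Inl k)) \<and> (\<forall>k\<in>KR. b k \<in> X (Inr k))" unfolding eJ by (simp add: ball_Un)
        finally show ?thesis .
      qed
      then show ?thesis by (auto simp: space_pair_measure)
    qed
    have "emeasure (distr (?P \<Otimes>\<^sub>M ?P) ?P (\<lambda>(a, b). select e a b)) (prod_emb UNIV \<nu> J (Pi\<^sub>E J F)) =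
      emeasure (?P \<Otimes>\<^sub>M ?P) ?A"
      using J F by (intro emeasure_distr meas sets_PiM_I) auto
    also have "\<dots> = (\<Prod>k\<in>KL. emeasure (\<nu> k) (X (Inl k))) * (\<Prod>k\<in>KR. emeasure (\<nu> k) (X (Inr k)))"
      unfolding vimage
      using cyl[OF fin(1) setsL] cyl[OF fin(2) setsR] setsL setsR fin
      by (simp add: P.emeasure_pair_measure_Times emeasure_PiM_Collect)
    also have "\<dots> = (\<Prod>s\<in>Inl ` KL. emeasure (case_sum \<nu> \<nu> s) (X s)) * (\<Prod>s\<in>Inr ` KR. emeasure (case_sum \<nu> \<nu> s) (X s))"
      by (simp add: prod.reindex)
    also have "\<dots> = (\<Prod>s\<in>e ` J. emeasure (case_sum \<nu> \<nu> s) (X s))"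
      unfolding eJ by (rule prod.union_disjoint[symmetric]) (use fin in auto)
    also have "\<dots> = (\<Prod>j\<in>J. emeasure (\<nu> j) (F j))"
      using inj by (subst prod.reindex) (auto simp: X e intro: inj_on_subset)
    finally show "emeasure (distr (?P \<Otimes>\<^sub>M ?P) ?P (\<lambda>(a, b). select e a b)) (prod_emb UNIV \<nu> J (Pi\<^sub>E J F)) =
      (\<Prod>j\<in>J. emeasure (\<nu> j) (F j))" .
  qed simp
qed

lemma measurable_cnt [measurable]: "(\<lambda>p. cnt p x u) \<in> measurable POS (count_space UNIV)"
  unfolding cnt_def by measurable

definition incr :: "real \<Rightarrow> 's marks \<Rightarrow> 's \<times> nat \<Rightarrow> nat" where
  "incr h p m = cnt p (fst m) (real (Suc (snd m)) * h) - cnt p (fst m) (real (snd m) * h)"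

lemma measurable_incr [measurable]: "incr h \<in> measurable POS COUNTS"
  unfolding incr_def by (intro measurable_PiM_single') (auto simp: space_PiM)

lemma cnt_eq_sum_incr:
  assumes "regular p" "0 \<le> h"
  shows "cnt p x (real k * h) = (\<Sum>j<k. incr h p (x, j))"
proof (induction k)
  case 0
  then show ?case using cnt_nonpos[OF assms(1)] by simp
next
  case (Suc k)
  have "cnt p x (real k * h) \<le> cnt p x (real (Suc k) * h)"
    by (intro cnt_mono assms mult_right_mono) simp_all
  then show ?case using Suc by (simp add: incr_def)
qed

text \<open>
  On the dyadic grid of level \<open>n\<close> the increments determine the counts, and the counts at all levels
  determine the marks: a mark is the limit over \<open>n\<close> of the first grid point at which it is
  counted. Conversely finitely many counts only involve one sufficiently fine level, so that the
  joint law of all counts is determined by the laws of the increments at each level.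
\<close>
lemma position_law_unique:
  fixes P Q :: "'s::countable marks measure"
  assumes "sets P = sets POS" "sets Q = sets POS"
    and "prob_space P" "prob_space Q"
    and "AE p in P. regular p" "AE p in Q. regular p"
    and u: "0 < u"
    and eq: "\<And>n. distr P COUNTS (incr (u / 2 ^ n)) = distr Q COUNTS (incr (u / 2 ^ n))"
  shows "P = Q"
proof -
  define \<delta> where "\<delta> n = u / 2 ^ n" for n :: nat
  have \<delta>: "0 < \<delta> n" for n using u by (simp add: \<delta>_def)
  have \<delta>_lim: "\<delta> \<longlonglongrightarrow> 0"
    unfolding \<delta>_def using tendsto_mult[OF tendsto_const LIMSEQ_power_zero[of "1/2::real"], of u]
    by (simp add: power_one_over)
  define cum where "cum n p m = cnt p (fst m) (real (snd m) * \<delta> n)" for n :: nat and p :: "'s marks" and m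
  define all where "all p = (\<lambda>(n, m). cum n p m)" for p :: "'s marks"
  define pos where "pos f m = lim (\<lambda>n. \<delta> n * real (LEAST k. snd m < f (n, (fst m, k))))"
    for f :: "nat \<times> 's \<times> nat \<Rightarrow> nat" and m :: "'s \<times> nat"
  have cum [measurable]: "cum n \<in> measurable POS COUNTS" for n
    unfolding cum_def by (intro measurable_PiM_single') (auto simp: space_PiM)
  have all [measurable]: "all \<in> measurable POS COUNTS"
    unfolding all_def cum_def by (intro measurable_PiM_single') (auto simp: space_PiM split_beta)
  have pos [measurable]: "pos \<in> measurable COUNTS POS"
    unfolding pos_def by (intro measurable_PiM_single') (auto simp: space_PiM)
  have pos_all: "pos (all p) = p" if p: "regular p" for p
  proof
    fix m :: "'s \<times> nat"
    obtain x i where m: "m = (x, i)" by (cases m)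
    define K where "K n = (LEAST k. i < all p (n, (x, k)))" for n
    have K: "i < all p (n, (x, k)) \<longleftrightarrow> p m \<le> real k * \<delta> n" for n k
      by (simp add: all_def cum_def less_cnt_iff[OF p] m)
    have "p m \<le> real (K n) * \<delta> n \<and> real (K n) * \<delta> n \<le> p m + \<delta> n" for n
    proof
      obtain k where "p m / \<delta> n < real k" using reals_Archimedean2 by blast
      then have "p m \<le> real k * \<delta> n" using \<delta>[of n] by (simp add: field_simps)
      then show ge: "p m \<le> real (K n) * \<delta> n"
        unfolding K_def K[symmetric] by (rule LeastI)
      have "K n \<noteq> 0" using ge regular_pos[OF p, of m] by (metis mult_zero_left not_le of_nat_0)
      then have "\<not> p m \<le> real (K n - 1) * \<delta> n"
        unfolding K[symmetric] using not_less_Least[of "K n - 1" "\<lambda>k. i < all p (n, (x, k))"] by (simp add: K_def)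
      then show "real (K n) * \<delta> n \<le> p m + \<delta> n" using \<open>K n \<noteq> 0\<close> by (simp add: of_nat_diff algebra_simps)
    qed
    then have ev: "\<forall>\<^sub>F n in sequentially. p m \<le> real (K n) * \<delta> n" "\<forall>\<^sub>F n in sequentially. real (K n) * \<delta> n \<le> p m + \<delta> n"
      by simp_all
    have "(\<lambda>n. p m + \<delta> n) \<longlonglongrightarrow> p m"
      using tendsto_add[OF tendsto_const \<delta>_lim, of "p m"] by simp
    then have "(\<lambda>n. real (K n) * \<delta> n) \<longlonglongrightarrow> p m"
      by (rule tendsto_sandwich[OF ev tendsto_const])
    then show "pos (all p) m = p m" unfolding pos_def K_def m by (intro limI) (simp add: mult.commute)
  qed
  have cum_distr: "distr R COUNTS (cum n) = distr (distr R COUNTS (incr (\<delta> n))) COUNTS (\<lambda>d m. \<Sum>j<snd m. d (fst m, j))"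
    if "sets R = sets POS" "AE p in R. regular p" for R :: "'s marks measure" and n
  proof -
    note [measurable_cong] = that(1)
    have meas: "(\<lambda>d m. \<Sum>j<snd m. d (fst m, j)) \<in> measurable COUNTS COUNTS"
      by (intro measurable_PiM_single') (auto simp: space_PiM)
    have "distr R COUNTS (cum n) = distr R COUNTS ((\<lambda>d m. \<Sum>j<snd m. d (fst m, j)) \<circ> incr (\<delta> n))"
    proof (rule distr_cong_AE)
      show "AE p in R. cum n p = ((\<lambda>d m. \<Sum>j<snd m. d (fst m, j)) \<circ> incr (\<delta> n)) p"
        using that(2) by eventually_elim (use \<delta>[of n] in \<open>auto simp: cum_def cnt_eq_sum_incr\<close>)
    qed (use meas in \<open>measurable\<close>)
    also have "\<dots> = distr (distr R COUNTS (incr (\<delta> n))) COUNTS (\<lambda>d m. \<Sum>j<snd m. d (fst m, j))"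
      by (intro distr_distr[symmetric] meas) measurable
    finally show ?thesis .
  qed
  have all_eq: "distr P COUNTS all = distr Q COUNTS all"
  proof (rule measure_eqI_PiM_infinite)
    show "sets (distr P COUNTS all) = sets COUNTS" "sets (distr Q COUNTS all) = sets COUNTS" by simp_all
    interpret P: prob_space P by fact
    show "finite_measure (distr P COUNTS all)"
      using assms(1) by (intro P.finite_measure_distr) simp
  next
    fix A :: "nat \<times> 's \<times> nat \<Rightarrow> nat set" and J :: "(nat \<times> 's \<times> nat) set" assume J: "finite J"
    (* The finest level among the finitely many counts; the coarser grids are contained in it. *)
    define N where "N = Max (insert 0 (fst ` J))"
    have N: "fst j \<le> N" if "j \<in> J" for j using J that by (simp add: N_def)
    define \<phi> where "\<phi> j = (fst (snd j), snd (snd j) * 2 ^ (N - fst j))" for j :: "nat \<times> 's \<times> nat"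
    define B where "B = {d. \<forall>j\<in>J. d (\<phi> j) \<in> A j}"
    have all_cum: "all p j = cum N p (\<phi> j)" if "j \<in> J" for p j
    proof -
      have "\<delta> (fst j) = 2 ^ (N - fst j) * \<delta> N" using N[OF that] by (simp add: \<delta>_def power_diff)
      then show ?thesis by (simp add: all_def cum_def \<phi>_def split_beta mult.assoc)
    qed
    have B: "B \<in> sets COUNTS"
    proof -
      have "B = {d \<in> space COUNTS. \<forall>j\<in>J. d (\<phi> j) \<in> A j}" by (simp add: B_def space_PiM)
      also have "\<dots> \<in> sets COUNTS" using J by measurable
      finally show ?thesis .
    qed
    have *: "emeasure (distr R COUNTS all) (prod_emb UNIV (\<lambda>_. count_space UNIV) J (Pi\<^sub>E J A)) = emeasure (distr R COUNTS (cum N)) B"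
      if R: "sets R = sets POS" for R :: "'s marks measure"
    proof -
      note [measurable_cong] = R
      have "prod_emb UNIV (\<lambda>_. count_space UNIV) J (Pi\<^sub>E J A) \<in> sets COUNTS"
        using J by (intro sets_PiM_I) auto
      moreover have "all -` prod_emb UNIV (\<lambda>_. count_space UNIV) J (Pi\<^sub>E J A) = cum N -` B"
        by (auto simp: prod_emb_def B_def Pi_iff simp flip: all_cum)
      ultimately show ?thesis using B by (simp add: emeasure_distr)
    qed
    show "emeasure (distr P COUNTS all) (prod_emb UNIV (\<lambda>_. count_space UNIV) J (Pi\<^sub>E J A)) =
      emeasure (distr Q COUNTS all) (prod_emb UNIV (\<lambda>_. count_space UNIV) J (Pi\<^sub>E J A))"
      using assms by (simp add: * cum_distr \<delta>_def)
  qed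
  have "R = distr (distr R COUNTS all) POS pos"
    if "sets R = sets POS" "AE p in R. regular p" for R :: "'s marks measure"
  proof -
    note [measurable_cong] = that(1)
    have "R = distr R POS (\<lambda>p. p)" using that(1) by (intro distr_id2[symmetric]) simp
    also have "\<dots> = distr R POS (pos \<circ> all)"
    proof (rule distr_cong_AE)
      show "AE p in R. p = (pos \<circ> all) p" using that(2) by eventually_elim (simp add: pos_all)
    qed measurable
    also have "\<dots> = distr (distr R COUNTS all) POS pos" by (intro distr_distr[symmetric]) measurable
    finally show ?thesis .
  qed
  from this[of P] this[of Q] show "P = Q" using assms all_eq by simp
qed

lemma regular_glue_pos:
  assumes p: "regular p" and p': "regular p'" and u: "0 \<le> u"
  shows "regular (glue_pos u p p')"
  unfolding regular_def
proof (intro allI conjI)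
  fix x
  show "0 < glue_pos u p p' (x, 0)"
    using regular_pos[OF p, of "(x, 0)"] regular_pos[OF p', of "(x, 0)"] less_cnt_iff[OF p, of 0 x u]
    using u by (auto simp: glue_pos_def)
next
  fix x i
  have inc: "q (x, j) < q (x, Suc j)" if "regular q" for q :: "'a \<times> nat \<Rightarrow> real" and j
    using that by (simp add: regular_def)
  consider "Suc i < cnt p x u" | "Suc i = cnt p x u" | "cnt p x u \<le> i" by linarith
  then show "glue_pos u p p' (x, i) < glue_pos u p p' (x, Suc i)"
  proof cases
    case 2
    then have "p (x, i) \<le> u" using less_cnt_iff[OF p, of i x u] by simp
    then show ?thesis using 2 regular_pos[OF p', of "(x, 0)"] by (simp add: glue_pos_def)
  qed (use inc[OF p] inc[OF p'] in \<open>auto simp: glue_pos_def Suc_diff_le\<close>)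
next
  fix x and k :: nat
  obtain i where i: "real (k + nat \<lceil>- u\<rceil>) < p' (x, i)" using p' unfolding regular_def by blast
  then have "real k < glue_pos u p p' (x, i + cnt p x u)" by (simp add: glue_pos_def) linarith
  then show "\<exists>i. real k < glue_pos u p p' (x, i)" by blast
qed

lemma measurable_regular [measurable]: "Measurable.pred POS (regular :: 's::countable marks \<Rightarrow> bool)"
  unfolding regular_def by measurable

lemma AE_pair_both:
  assumes "sigma_finite_measure M" "sigma_finite_measure N" "AE x in M. A x" "AE y in N. B y"
    and [measurable]: "Measurable.pred M A" "Measurable.pred N B"
  shows "AE z in M \<Otimes>\<^sub>M N. A (fst z) \<and> B (snd z)"
proof -
  interpret pair_sigma_finite M N using assms(1,2) by (intro pair_sigma_finite.intro)
  show ?thesis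
  proof (rule AE_pair_measure)
    show "AE x in M. AE y in N. A (fst (x, y)) \<and> B (snd (x, y))"
      using assms(3) by eventually_elim (use assms(4) in simp)
  qed measurable
qed

lemma measurable_glue_pos [measurable]:
  "(\<lambda>(p, p'). glue_pos u p p') \<in> measurable (POS \<Otimes>\<^sub>M POS) (POS :: 's::countable marks measure)"
proof (rule measurable_PiM_single')
  fix m :: "'s \<times> nat"
  have [measurable]: "(\<lambda>x. snd x (fst m, snd m - cnt (fst x) (fst m) u)) \<in> borel_measurable (POS \<Otimes>\<^sub>M POS)"
    by (rule measurable_compose_countable[where f = "\<lambda>k x. snd x (fst m, snd m - k)"]) measurable
  show "(\<lambda>\<omega>. (case \<omega> of (p, p') \<Rightarrow> glue_pos u p p') m) \<in> borel_measurable (POS \<Otimes>\<^sub>M POS)"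
    unfolding glue_pos_def by (simp add: split_beta)
qed (auto simp: space_PiM)

text \<open>
  The gluing time \<open>u\<close> is a grid point, so each cell lies entirely before or entirely after it, and
  gluing merely selects the increments from the two families.
\<close>
lemma incr_glue_pos:
  fixes p p' :: "'s marks"
  assumes p: "regular p" "regular p'" and u: "0 < u" and h: "h = u / 2 ^ n"
  shows "incr h (glue_pos u p p') = select (\<lambda>(x, k). if k < 2 ^ n then Inl (x, k) else Inr (x, k - 2 ^ n)) (incr h p) (incr h p')"
proof
  fix m :: "'s \<times> nat" obtain x k where m: "m = (x, k)" by (cases m)
  have u': "u = real (2 ^ n) * h" and h0: "0 < h" using u h by auto
  show "incr h (glue_pos u p p') m = select (\<lambda>(x, k). if k < 2 ^ n then Inl (x, k) else Inr (x, k - 2 ^ n)) (incr h p) (incr h p') m"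
  proof (cases "k < 2 ^ n")
    case True
    then have "real (Suc k) * h \<le> u" unfolding u' using h0 by (intro mult_right_mono) (auto simp: Suc_le_eq simp del: of_nat_Suc of_nat_power)
    moreover have "real k * h \<le> real (Suc k) * h" using h0 by simp
    ultimately show ?thesis using True
      by (simp add: m select_def incr_def cnt_glue_pos[OF p] cnt_nonpos[OF p(2)] min_def del: of_nat_Suc)
  next
    case False
    then have "u \<le> real k * h" unfolding u' using h0 by (intro mult_right_mono) (auto simp flip: of_nat_power)
    moreover have "real k * h \<le> real (Suc k) * h" using h0 by simp
    moreover have "real k * h - u = real (k - 2 ^ n) * h" "real (Suc k) * h - u = real (Suc (k - 2 ^ n)) * h"
      using False unfolding u' by (simp_all add: of_nat_diff algebra_simps)
    ultimately show ?thesis using False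
      by (simp add: m select_def incr_def cnt_glue_pos[OF p] min_absorb1 del: of_nat_Suc)
  qed
qed

text \<open>
  The increments over cells of equal length are independent with a law that depends only on the
  site. Selecting them from two independent copies therefore reproduces their law, at every
  dyadic level.
\<close>
lemma distr_glue_pos:
  fixes P :: "'s::countable marks measure" and rate :: "'s \<Rightarrow> real"
  assumes P: "prob_space P" "sets P = sets POS" and reg: "AE p in P. regular p"
    and incr: "\<And>h. 0 < h \<Longrightarrow> distr P COUNTS (incr h) = PiM UNIV (\<lambda>m. measure_pmf (poisson_pmf (rate (fst m) * h)))"
    and u: "0 < u"
  shows "distr (P \<Otimes>\<^sub>M P) POS (\<lambda>(p, p'). glue_pos u p p') = P"
proof -
  interpret P: prob_space P by fact
  interpret PP: pair_prob_space P P ..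
  note [measurable_cong] = P(2)
  let ?g = "\<lambda>(p, p'). glue_pos u p p'"
  have reg2: "AE x in P \<Otimes>\<^sub>M P. regular (fst x) \<and> regular (snd x)"
    by (intro AE_pair_both reg P.sigma_finite_measure_axioms) measurable
  show ?thesis
  proof (rule position_law_unique[OF _ P(2) _ P(1) _ reg u])
    show "sets (distr (P \<Otimes>\<^sub>M P) POS ?g) = sets POS" by simp
    show "prob_space (distr (P \<Otimes>\<^sub>M P) POS ?g)" by (intro PP.prob_space_distr) measurable
    show "AE p in distr (P \<Otimes>\<^sub>M P) POS ?g. regular p"
    proof (subst AE_distr_iff)
      show "AE x in P \<Otimes>\<^sub>M P. regular (?g x)"
        using reg2 by eventually_elim (use u in \<open>simp add: split_beta regular_glue_pos\<close>)
      show "{x \<in> space POS. regular x} \<in> sets (POS :: 's marks measure)" by measurable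
    qed measurable
    fix n
    define h where "h = u / 2 ^ n"
    have h: "0 < h" using u by (simp add: h_def)
    let ?e = "\<lambda>(x::'s, k::nat). if k < 2 ^ n then Inl (x, k) else Inr (x, k - 2 ^ n)"
    let ?M = "\<lambda>m::'s \<times> nat. measure_pmf (poisson_pmf (rate (fst m) * h))"
    have setsM [measurable_cong]: "sets (PiM UNIV ?M) = sets COUNTS" by (intro sets_PiM_cong) simp_all
    have M: "distr P COUNTS (incr h) = PiM UNIV ?M"
      using incr[OF h] .
    have "distr (distr (P \<Otimes>\<^sub>M P) POS ?g) COUNTS (incr h) = distr (P \<Otimes>\<^sub>M P) COUNTS (incr h \<circ> ?g)"
      by (intro distr_distr) measurable
    also have "\<dots> = distr (P \<Otimes>\<^sub>M P) COUNTS ((\<lambda>(a, b). select ?e a b) \<circ> (\<lambda>(p, p'). (incr h p, incr h p')))"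
    proof (rule distr_cong_AE)
      show "AE x in P \<Otimes>\<^sub>M P. (incr h \<circ> ?g) x = ((\<lambda>(a, b). select ?e a b) \<circ> (\<lambda>(p, p'). (incr h p, incr h p'))) x"
        using reg2 by eventually_elim (auto simp: incr_glue_pos[OF _ _ u h_def] split_beta)
    qed (measurable, auto split: sum.split)
    also have "\<dots> = distr (distr (P \<Otimes>\<^sub>M P) (COUNTS \<Otimes>\<^sub>M COUNTS) (\<lambda>(p, p'). (incr h p, incr h p'))) COUNTS (\<lambda>(a, b). select ?e a b)"
      by (intro distr_distr[symmetric]) (measurable, auto split: sum.split)
    also have "distr (P \<Otimes>\<^sub>M P) (COUNTS \<Otimes>\<^sub>M COUNTS) (\<lambda>(p, p'). (incr h p, incr h p')) = PiM UNIV ?M \<Otimes>\<^sub>M PiM UNIV ?M"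
      unfolding M[symmetric]
      by (intro pair_measure_distr[symmetric]) (measurable, simp add: M prob_space_PiM measure_pmf.prob_space_axioms prob_space_imp_sigma_finite)
    also have "distr (PiM UNIV ?M \<Otimes>\<^sub>M PiM UNIV ?M) COUNTS (\<lambda>(a, b). select ?e a b) =
        distr (PiM UNIV ?M \<Otimes>\<^sub>M PiM UNIV ?M) (PiM UNIV ?M) (\<lambda>(a, b). select ?e a b)"
      by (intro distr_cong) (simp_all add: setsM)
    also have "\<dots> = PiM UNIV ?M"
      by (intro distr_select measure_pmf.prob_space_axioms) (auto simp: inj_def split: if_splits)
    finally show "distr (distr (P \<Otimes>\<^sub>M P) POS ?g) COUNTS (incr (u / 2 ^ n)) = distr P COUNTS (incr (u / 2 ^ n))"
      by (simp add: M h_def[symmetric])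
  qed
qed

section \<open>Exponential clocks and Poisson variables\<close>

abbreviation EXP :: "real measure" where
  "EXP \<equiv> density lborel (\<lambda>x. ennreal (exponential_density 1 x))"

abbreviation CLOCKS :: "('i \<Rightarrow> real) measure" where
  "CLOCKS \<equiv> PiM UNIV (\<lambda>_. EXP)"

interpretation EXP: prob_space EXP
  by (rule prob_space_exponential_density) simp

lemma EXP_nonneg: "AE v in EXP. 0 \<le> v"
  by (subst AE_density) (auto simp: exponential_density_def)

lemma EXP_neq: "AE v in EXP. v \<noteq> a"
  using AE_lborel_singleton[of a] by (subst AE_density) auto

lemma EXP_memoryless:
  fixes g :: "real \<Rightarrow> real"
  assumes g [measurable]: "g \<in> borel_measurable borel" and a: "0 < a" and b: "0 \<le> b"
  shows "(\<integral>v. indicator {v. b < a * v} v * g (a * v - b) \<partial>EXP) = exp (- b / a) * (\<integral>v. g (a * v) \<partial>EXP)"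
proof -
  have "(\<integral>v. indicator {v. b < a * v} v * g (a * v - b) \<partial>EXP)
      = (\<integral>v. exponential_density 1 v * (indicator {v. b < a * v} v * g (a * v - b)) \<partial>lborel)"
    by (subst integral_density) (auto simp: exponential_density_nonneg)
  also have "\<dots> = (\<integral>v. exponential_density 1 (b / a + v) * (indicator {v. b < a * v} (b / a + v) * g (a * (b / a + v) - b)) \<partial>lborel)"
    by (subst lborel_integral_real_affine[where c = 1 and t = "b / a"]) simp_all
  also have "\<dots> = (\<integral>v. exp (- b / a) * (exponential_density 1 v * g (a * v)) \<partial>lborel)"
  proof (rule integral_cong_AE)
    show "AE v in lborel. exponential_density 1 (b / a + v) * (indicator {v. b < a * v} (b / a + v) * g (a * (b / a + v) - b))
        = exp (- b / a) * (exponential_density 1 v * g (a * v))"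
      using AE_lborel_singleton[of 0]
    proof eventually_elim
      case (elim v)
      have eq: "a * (b / a + v) = b + a * v" using a by (simp add: field_simps)
      show ?case
      proof (cases "0 < v")
        case True
        then have "0 \<le> b / a + v" "0 < a * v" using a b by simp_all
        then show ?thesis using True by (simp add: eq exponential_density_def exp_add[symmetric])
      next
        case False
        then have "v < 0" "\<not> 0 < a * v" using elim a by (simp_all add: zero_less_mult_iff)
        then show ?thesis by (simp add: eq exponential_density_def)
      qed
    qed
  qed measurable
  also have "\<dots> = exp (- b / a) * (\<integral>v. g (a * v) \<partial>EXP)"
    by (subst integral_density) (auto simp: exponential_density_nonneg)
  finally show ?thesis .
qed

text \<open>
  Memorylessness in the form needed for conditioning on the event that a clock still runs, without
  its probability: that probability is the same factor for \<open>g\<close> and for the constant.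
\<close>
lemma EXP_memoryless_diff:
  fixes g :: "real \<Rightarrow> real"
  assumes g [measurable]: "g \<in> borel_measurable borel" and bdd: "\<And>x. \<bar>g x\<bar> \<le> C" and a: "0 < a" and b: "0 \<le> b"
  shows "(\<integral>v. indicator {v. b < a * v} v * (g (a * v - b) - (\<integral>v. g (a * v) \<partial>EXP)) \<partial>EXP) = 0"
proof -
  define D where "D = (\<integral>v. g (a * v) \<partial>EXP)"
  have "measure EXP UNIV = 1" using EXP.prob_space by simp
  then have "(\<integral>v. g (a * v) - D \<partial>EXP) = D - D"
    by (subst Bochner_Integration.integral_diff)
       (auto simp: D_def bdd intro!: EXP.integrable_const_bound[where B = C])
  then show ?thesis
    using EXP_memoryless[of "\<lambda>x. g x - D", OF _ a b] by (simp add: D_def)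
qed

lemma EXP_mean: "0 \<le> a \<Longrightarrow> (\<integral>\<^sup>+v. ennreal (a * v) \<partial>EXP) = ennreal a"
proof -
  assume a: "0 \<le> a"
  have "(\<integral>\<^sup>+v. ennreal (a * v) \<partial>EXP) = (\<integral>\<^sup>+v. ennreal a * ennreal (exponential_density 1 v * v ^ 1) \<partial>lborel)"
  proof (subst nn_integral_density, simp_all, intro nn_integral_cong)
    fix v
    have "ennreal (exponential_density 1 v) * ennreal (a * v) = ennreal (exponential_density 1 v * (a * v))"
      by (intro ennreal_mult'[symmetric] exponential_density_nonneg) simp
    also have "\<dots> = ennreal a * ennreal (exponential_density 1 v * v)"
      using a by (simp add: ennreal_mult'[symmetric] mult_ac)
    finally show "ennreal (exponential_density 1 v) * ennreal (a * v) = ennreal a * ennreal (exponential_density 1 v * v)" .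
  qed
  also have "\<dots> = ennreal a"
    using nn_integral_erlang_ith_moment[of 1 0 1] by (simp add: nn_integral_cmult)
  finally show ?thesis .
qed

lemma EXP_atMost_1: "emeasure EXP {..1} = ennreal (1 - exp (- 1))"
  using emeasure_erlang_density[of 1 0 1] by (simp add: erlang_CDF_0)

lemma CLOCKS_component: "distr CLOCKS EXP (\<lambda>w. w j) = EXP"
  by (intro distr_PiM_component EXP.prob_space_axioms) simp

lemma AE_CLOCKS_nonneg: "AE w in (CLOCKS :: ('i \<Rightarrow> real) measure). 0 \<le> w j"
  by (intro AE_PiM_component EXP.prob_space_axioms EXP_nonneg) simp

lemma prob_space_CLOCKS: "prob_space CLOCKS"
  by (intro prob_space_PiM EXP.prob_space_axioms)

text \<open>
  The probability that \<open>n\<close> given clocks are all at most \<open>1\<close> is the \<open>n\<close>-th power of a number less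
  than \<open>1\<close>.
\<close>
lemma AE_CLOCKS_infinitely_often:
  assumes inj: "inj (e :: nat \<Rightarrow> 'i)"
  shows "AE w in CLOCKS. infinite {i. 1 < w (e i)}"
proof -
  interpret product_prob_space "\<lambda>_::'i. EXP" UNIV by (intro product_prob_spaceI EXP.prob_space_axioms)
  define q where "q = emeasure EXP {..1}"
  have "AE w in CLOCKS. \<exists>i\<ge>N. 1 < w (e i)" for N
  proof (rule AE_I)
    define A where "A = {w \<in> space CLOCKS. \<forall>i\<ge>N. w (e i) \<le> 1}"
    show "{w \<in> space CLOCKS. \<not> (\<exists>i\<ge>N. 1 < w (e i))} \<subseteq> A" by (auto simp: A_def not_less)
    show A: "A \<in> sets CLOCKS" unfolding A_def by measurable
    have "emeasure CLOCKS A \<le> q ^ n" for n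
    proof -
      have "emeasure CLOCKS A \<le> emeasure CLOCKS {w \<in> space CLOCKS. \<forall>j\<in>e ` {N..<N + n}. w j \<in> {..1}}"
        by (intro emeasure_mono) (auto simp: A_def)
      also have "\<dots> = (\<Prod>j\<in>e ` {N..<N + n}. q)"
        unfolding q_def by (intro emeasure_PiM_Collect) auto
      also have "\<dots> = q ^ n" using inj by (simp add: card_image inj_on_subset)
      finally show ?thesis .
    qed
    moreover have "(\<lambda>n. ennreal ((1 - exp (- 1)) ^ n)) \<longlonglongrightarrow> ennreal 0"
      by (intro tendsto_ennrealI LIMSEQ_power_zero) simp
    then have "(\<lambda>n. q ^ n) \<longlonglongrightarrow> 0" by (simp add: q_def EXP_atMost_1 ennreal_power)
    ultimately have "emeasure CLOCKS A \<le> 0" by (intro LIMSEQ_le_const) auto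
    then show "emeasure CLOCKS A = 0" by simp
  qed
  then have "AE w in CLOCKS. \<forall>N. \<exists>i\<ge>N. 1 < w (e i)" by (simp add: AE_all_countable)
  then show ?thesis by eventually_elim (auto simp: infinite_nat_iff_unbounded_le)
qed

lemma CLOCKS_resample:
  "distr (EXP \<Otimes>\<^sub>M CLOCKS) CLOCKS (\<lambda>(v, w). w(j := v)) = (CLOCKS :: ('i \<Rightarrow> real) measure)"
  using distr_pair_PiM_eq_PiM[of UNIV "\<lambda>_::'i. EXP" j] EXP.prob_space_axioms by simp

lemma nn_integral_poisson: "0 < r \<Longrightarrow> (\<integral>\<^sup>+n. of_nat n \<partial>measure_pmf (poisson_pmf r)) = ennreal r"
proof -
  assume r: "0 < r"
  have "(\<lambda>n. r * exp (- r) * (r ^ n /\<^sub>R fact n)) sums (r * exp (- r) * exp r)"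
    by (intro sums_mult exp_converges)
  moreover have "r * exp (- r) * exp r = r" by (simp add: mult.assoc flip: exp_add)
  moreover have "r * exp (- r) * (r ^ n /\<^sub>R fact n) = real (Suc n) * pmf (poisson_pmf r) (Suc n)" for n
  proof -
    have "real (Suc n) * (r ^ Suc n / (real (Suc n) * fact n) * e) = r * e * (r ^ n / fact n)" for e
      by (simp add: divide_simps del: of_nat_Suc)
    then show ?thesis using r by (simp add: divide_inverse_commute del: of_nat_Suc)
  qed
  ultimately have "(\<lambda>n. real (Suc n) * pmf (poisson_pmf r) (Suc n)) sums r" by simp
  then have "(\<lambda>n. real n * pmf (poisson_pmf r) n) sums r"
    by (subst (asm) sums_Suc_iff) simp
  then have *: "(\<Sum>n. ennreal (real n * pmf (poisson_pmf r) n)) = ennreal r"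
    by (intro suminf_ennreal_eq) auto
  have "(\<integral>\<^sup>+n. of_nat n \<partial>measure_pmf (poisson_pmf r)) = (\<integral>\<^sup>+n. ennreal (pmf (poisson_pmf r) n) * of_nat n \<partial>count_space UNIV)"
    by (rule nn_integral_measure_pmf)
  also have "\<dots> = (\<Sum>n. ennreal (real n * pmf (poisson_pmf r) n))"
    by (simp add: nn_integral_count_space_nat ennreal_mult mult.commute ennreal_of_nat_eq_real_of_nat)
  finally show ?thesis using * by simp
qed

text \<open>Markov's inequality.\<close>
lemma emeasure_poisson_pos: "0 < r \<Longrightarrow> emeasure (measure_pmf (poisson_pmf r)) {1..} \<le> ennreal r"
proof -
  assume r: "0 < r"
  have "emeasure (measure_pmf (poisson_pmf r)) {1..} = (\<integral>\<^sup>+n. indicator {1..} n \<partial>measure_pmf (poisson_pmf r))"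
    by simp
  also have "\<dots> \<le> (\<integral>\<^sup>+n. of_nat n \<partial>measure_pmf (poisson_pmf r))"
    by (intro nn_integral_mono) (auto split: split_indicator simp: ennreal_of_nat_eq_real_of_nat)
  finally show ?thesis using r by (simp add: nn_integral_poisson)
qed

lemma emeasure_zero_limit:
  assumes "\<And>n. e \<le> ennreal (C / real (Suc n))" shows "e = 0"
proof -
  have "(\<lambda>n. C / real (Suc n)) \<longlonglongrightarrow> 0"
    using tendsto_mult[OF tendsto_const LIMSEQ_inverse_real_of_nat, of C] by (simp add: divide_inverse)
  from tendsto_ennrealI[OF this] have "(\<lambda>n. ennreal (C / real (Suc n))) \<longlonglongrightarrow> 0" by simp
  then have "e \<le> 0" by (rule LIMSEQ_le_const) (use assms in blast)
  then show ?thesis by simp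
qed

section \<open>Measurability\<close>

abbreviation REALS :: "('i \<Rightarrow> real) measure" where
  "REALS \<equiv> PiM UNIV (\<lambda>_. borel)"

context K_params begin

text \<open>The sum over the marks is an integral over a \<open>\<sigma>\<close>-finite counting measure.\<close>
lemma mass_measurable:
  assumes [measurable]: "p \<in> measurable M POS" "w \<in> measurable M REALS" "Measurable.pred (M \<Otimes>\<^sub>M borel) (\<lambda>(x, v). v \<in> B x)"
  shows "(\<lambda>x. mass (B x) (p x) (w x)) \<in> borel_measurable M"
proof -
  interpret sigma_finite_measure "count_space (UNIV :: ('s \<times> nat) set)"
    by (rule sigma_finite_measure_count_space)
  have [measurable]: "Measurable.pred M (\<lambda>x. p x m \<in> B x)" for m
  proof -
    have "(\<lambda>x. (x, p x m)) \<in> measurable M (M \<Otimes>\<^sub>M borel)" by measurable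
    from measurable_compose[OF this assms(3)] show ?thesis by simp
  qed
  have [measurable]: "Measurable.pred (M \<Otimes>\<^sub>M N) (\<lambda>z. p (fst z) m \<in> B (fst z))" for m and N :: "('s \<times> nat) measure"
    by (rule measurable_compose[OF measurable_fst]) measurable
  have "(\<lambda>z. jump (w (fst z)) (snd z) * indicator (B (fst z)) (p (fst z) (snd z))) \<in> borel_measurable (M \<Otimes>\<^sub>M count_space UNIV)"
    unfolding jump_def
    by (rule measurable_compose_countable[where f = "\<lambda>m z. ennreal (\<gamma> (fst m) * w (fst z) (Some m)) * indicator (B (fst z)) (p (fst z) m)" and g = snd]) measurable
  then show ?thesis
    unfolding mass_def by (intro borel_measurable_nn_integral) (simp add: split_beta)
qed

lemma clk_measurable [measurable (raw)]:
  assumes [measurable]: "p \<in> measurable M POS" "w \<in> measurable M REALS" "g \<in> borel_measurable M"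
  shows "(\<lambda>x. clk (p x) (w x) (g x)) \<in> borel_measurable M"
    and "(\<lambda>x. clk_pre (p x) (w x) (g x)) \<in> borel_measurable M"
proof -
  have [measurable]: "(\<lambda>x. mass {..g x} (p x) (w x)) \<in> borel_measurable M"
    "(\<lambda>x. mass {..<g x} (p x) (w x)) \<in> borel_measurable M"
    by (intro mass_measurable; simp)+
  show "(\<lambda>x. clk (p x) (w x) (g x)) \<in> borel_measurable M"
    "(\<lambda>x. clk_pre (p x) (w x) (g x)) \<in> borel_measurable M"
    unfolding clk_def clk_pre_def by measurable
qed

lemma sojourn_measurable [measurable (raw)]:
  assumes [measurable]: "p \<in> measurable M POS" "w \<in> measurable M REALS" "q \<in> borel_measurable M"
  shows "Measurable.pred M (\<lambda>x. sojourn (p x) (w x) (q x) m)"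
  unfolding sojourn_def by measurable

lemma measurable_unique_choice:
  fixes P :: "'a \<Rightarrow> 'b::countable \<Rightarrow> bool"
  assumes [measurable]: "\<And>y. Measurable.pred M (\<lambda>x. P x y)"
  shows "(\<lambda>x. if \<exists>!y. P x y then Some (THE y. P x y) else None) \<in> measurable M (count_space UNIV)"
proof -
  define F where "F x = (if \<exists>!y. P x y then Some (THE y. P x y) else None)" for x
  have Some: "F x = Some y \<longleftrightarrow> P x y \<and> (\<forall>y'. P x y' \<longrightarrow> y' = y)" for x y
    unfolding F_def by (auto intro: theI2)
  have S: "{x \<in> space M. F x = Some y} \<in> sets M" for y
    unfolding Some by measurable
  have "F -` {z} \<inter> space M \<in> sets M" for z
  proof (cases z)
    case (Some y)
    then have "F -` {z} \<inter> space M = {x \<in> space M. F x = Some y}" by auto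
    then show ?thesis using S by simp
  next
    case None
    then have "F -` {z} \<inter> space M = space M - (\<Union>y. {x \<in> space M. F x = Some y})" by auto
    then show ?thesis using S by auto
  qed
  then have "F \<in> measurable M (count_space UNIV)"
    by (auto simp: measurable_count_space_eq2_countable)
  then show ?thesis unfolding F_def[abs_def] .
qed

lemma state_measurable [measurable (raw)]:
  assumes [measurable]: "p \<in> measurable M POS" "w \<in> measurable M REALS" "q \<in> borel_measurable M"
  shows "(\<lambda>x. state (q x) (p x) (w x)) \<in> measurable M (count_space UNIV)"
  unfolding state_def by (rule measurable_unique_choice) measurable

end

lemma sets_CLOCKS [measurable_cong]: "sets (CLOCKS :: ('i \<Rightarrow> real) measure) = sets REALS"
  by (intro sets_PiM_cong) simp_all

lemma AE_fst:
  assumes "prob_space N" "AE x in M. A x" shows "AE z in M \<Otimes>\<^sub>M N. A (fst z)"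
proof (rule AE_distrD[where f = fst and M' = M])
  interpret prob_space N by fact
  show "AE x in distr (M \<Otimes>\<^sub>M N) M fst. A x" using assms(2) by (subst distr_pair_fst)
qed simp

lemma AE_snd:
  assumes "prob_space M" "prob_space N" "AE x in N. A x" shows "AE z in M \<Otimes>\<^sub>M N. A (snd z)"
proof (rule AE_distrD[where f = snd and M' = N])
  interpret M: prob_space M by fact
  interpret N: prob_space N by fact
  have *: "distr (M \<Otimes>\<^sub>M N) N snd = N"
  proof (rule measure_eqI)
    fix B assume "B \<in> sets (distr (M \<Otimes>\<^sub>M N) N snd)"
    then have B: "B \<in> sets N" by simp
    have "snd -` B \<inter> space (M \<Otimes>\<^sub>M N) = space M \<times> B"
      using sets.sets_into_space[OF B] by (auto simp: space_pair_measure)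
    then show "emeasure (distr (M \<Otimes>\<^sub>M N) N snd) B = emeasure N B"
      using B by (simp add: emeasure_distr N.emeasure_pair_measure_Times M.emeasure_space_1)
  qed simp
  show "AE x in distr (M \<Otimes>\<^sub>M N) N snd. A x" using assms(3) by (subst *)
qed simp

lemma measure_eqI_nn_integral:
  assumes "sets M = sets N" "\<And>f. f \<in> borel_measurable M \<Longrightarrow> (\<integral>\<^sup>+x. f x \<partial>M) = (\<integral>\<^sup>+x. f x \<partial>N)"
  shows "M = N"
proof (rule measure_eqI)
  fix A assume A: "A \<in> sets M"
  then have "(\<integral>\<^sup>+x. indicator A x \<partial>M) = (\<integral>\<^sup>+x. indicator A x \<partial>N)" by (intro assms) simp
  then show "emeasure M A = emeasure N A" using A assms(1) by simp
qed fact

lemma measurable_fun_upd_UNIV [measurable (raw)]: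
  assumes "f \<in> measurable N (PiM UNIV M)" "h \<in> measurable N (M i)"
  shows "(\<lambda>x. (f x)(i := h x)) \<in> measurable N (PiM UNIV M)"
  by (rule measurable_fun_upd[of UNIV UNIV, OF _ assms]) simp

lemma measurable_glue_clk:
  fixes n :: "'a \<Rightarrow> 's::countable \<Rightarrow> nat"
  assumes [measurable]: "\<And>x. (\<lambda>a. n a x) \<in> measurable M (count_space UNIV)" "w \<in> measurable M REALS" "w' \<in> measurable M REALS"
  shows "(\<lambda>a. select (glue_src (n a)) (w a) (w' a)) \<in> measurable M REALS"
proof (rule measurable_PiM_single')
  fix j :: "('s \<times> nat) option"
  show "(\<lambda>a. select (glue_src (n a)) (w a) (w' a) j) \<in> borel_measurable M"
  proof (cases j)
    case None
    then show ?thesis by (simp add: select_def glue_src_def)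
  next
    case (Some m)
    obtain x i where m: "m = (x, i)" by (cases m)
    have [measurable]: "(\<lambda>a. w' a (Some (x, i - n a x))) \<in> borel_measurable M"
      by (rule measurable_compose_countable[where f = "\<lambda>k a. w' a (Some (x, i - k))"]) measurable
    have "(\<lambda>a. if i < n a x then w a (Some (x, i)) else w' a (Some (x, i - n a x))) \<in> borel_measurable M"
      by measurable
    then show ?thesis
      by (rule measurable_cong[THEN iffD1, rotated]) (simp add: Some m select_def glue_src_def)
  qed
qed (auto simp: space_PiM)

section \<open>The law of marks and clocks\<close>

text \<open>
  The law \<open>PN\<close> of independent Poisson marks is described by the joint law of the increments of the
  counting processes over cells of equal length, for all cell lengths. This one condition yields
  the regeneration, the absence of coinciding marks, and the intensities.
\<close>

locale K_law = K_params \<gamma> c for \<gamma> :: "'s::countable \<Rightarrow> real" and c +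
  fixes rate :: "'s \<Rightarrow> real" and PN :: "'s marks measure"
  assumes prob_PN: "prob_space PN" and sets_PN [measurable_cong]: "sets PN = sets POS"
    and regular_AE: "AE p in PN. regular p"
    and rate_pos: "\<And>x. 0 < rate x"
    and incr_law: "\<And>h. 0 < h \<Longrightarrow> distr PN COUNTS (incr h) = PiM UNIV (\<lambda>m. measure_pmf (poisson_pmf (rate (fst m) * h)))"
    and summable: "(\<lambda>x. rate x * \<gamma> x) summable_on UNIV"
begin

abbreviation CL :: "'s clocks measure" where "CL \<equiv> CLOCKS"

abbreviation P :: "('s marks \<times> 's clocks) measure" where "P \<equiv> PN \<Otimes>\<^sub>M CL"

sublocale PN: prob_space PN by (rule prob_PN)
sublocale CL: prob_space CL by (rule prob_space_CLOCKS)
sublocale PC: pair_prob_space PN CL ..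
sublocale PE: pair_prob_space P EXP ..
sublocale PP: pair_prob_space P P ..
sublocale CN: pair_prob_space CL PN ..
sublocale EC: pair_prob_space EXP CL ..

lemma emeasure_incr_pos:
  assumes h: "0 < h" and J: "finite J"
  shows "emeasure PN {p \<in> space PN. \<forall>m\<in>J. 1 \<le> incr h p m} \<le> (\<Prod>m\<in>J. ennreal (rate (fst m) * h))"
proof -
  let ?M = "\<lambda>m::'s \<times> nat. measure_pmf (poisson_pmf (rate (fst m) * h))"
  interpret product_prob_space ?M UNIV by (intro product_prob_spaceI measure_pmf.prob_space_axioms)
  have sets [measurable_cong]: "sets (PiM UNIV ?M) = sets COUNTS" by (intro sets_PiM_cong) simp_all
  have [measurable]: "(\<lambda>d. d m) \<in> measurable COUNTS (count_space UNIV)" for m :: "'s \<times> nat"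
    by (rule measurable_component_singleton) simp
  have B: "{d \<in> space COUNTS. \<forall>m\<in>J. d m \<in> {1..}} \<in> sets COUNTS" unfolding atLeast_iff using J by measurable
  have "emeasure PN {p \<in> space PN. \<forall>m\<in>J. 1 \<le> incr h p m} = emeasure (distr PN COUNTS (incr h)) {d \<in> space COUNTS. \<forall>m\<in>J. d m \<in> {1..}}"
    by (subst emeasure_distr[OF _ B]) (auto intro!: arg_cong[where f = "emeasure PN"] simp: space_PiM)
  also have "\<dots> = emeasure (PiM UNIV ?M) {d \<in> space (PiM UNIV ?M). \<forall>m\<in>J. d m \<in> {1..}}"
    by (simp add: incr_law[OF h] space_PiM)
  also have "\<dots> = (\<Prod>m\<in>J. emeasure (?M m) {1..})"
    using J by (intro emeasure_PiM_Collect) auto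
  also have "\<dots> \<le> (\<Prod>m\<in>J. ennreal (rate (fst m) * h))"
    by (intro prod_mono_ennreal emeasure_poisson_pos mult_pos_pos rate_pos h)
  finally show ?thesis .
qed

lemma incr_pos_at_mark:
  assumes p: "regular p" and h: "0 < h" and k: "real k * h < p (x, i)" "p (x, i) \<le> real (Suc k) * h"
  shows "1 \<le> incr h p (x, k)"
proof -
  have "i < cnt p x (real (Suc k) * h)" "\<not> i < cnt p x (real k * h)"
    using k by (simp_all add: less_cnt_iff[OF p] del: of_nat_Suc)
  then show ?thesis by (simp add: incr_def del: of_nat_Suc)
qed

text \<open>
  If the mark sits at \<open>v\<close>, the last of \<open>n + 1\<close> equal cells of \<open>(0, v]\<close> is not empty, and the
  probability of this is of order \<open>1 / n\<close>.
\<close>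
lemma AE_mark_neq: "AE p in PN. p m \<noteq> v"
proof (cases "0 < v")
  case True
  obtain x i where m: "m = (x, i)" by (cases m)
  have meas: "{p \<in> space PN. p m = v \<and> regular p} \<in> sets PN" by measurable
  have "emeasure PN {p \<in> space PN. p m = v \<and> regular p} = 0"
  proof (rule emeasure_zero_limit)
    fix n
    define h where "h = v / real (Suc n)"
    have h: "0 < h" using True by (simp add: h_def)
    have v: "real n * h < v" "v \<le> real (Suc n) * h" using True by (simp_all add: h_def field_simps)
    have "emeasure PN {p \<in> space PN. p m = v \<and> regular p} \<le> emeasure PN {p \<in> space PN. \<forall>m\<in>{(x, n)}. 1 \<le> incr h p m}"
      using incr_pos_at_mark[OF _ h, of _ n x i] v by (intro emeasure_mono) (auto simp: m simp del: of_nat_Suc)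
    also have "\<dots> \<le> ennreal (rate x * v / real (Suc n))"
      using emeasure_incr_pos[OF h, of "{(x, n)}"] by (simp add: h_def)
    finally show "emeasure PN {p \<in> space PN. p m = v \<and> regular p} \<le> ennreal (rate x * v / real (Suc n))" .
  qed
  then have "AE p in PN. \<not> (p m = v \<and> regular p)" using meas by (intro AE_I[where N = "{p \<in> space PN. p m = v \<and> regular p}"]) auto
  then show ?thesis using regular_AE by eventually_elim auto
next
  case False
  show ?thesis using regular_AE by eventually_elim (use regular_pos[of _ m] False in fastforce)
qed

text \<open>
  Two coinciding marks in \<open>(0, T]\<close> occupy the same one of \<open>n + 1\<close> equal cells. Two given sites both
  have a mark in a given cell with a probability of order \<open>1 / n\<^sup>2\<close>, and there are \<open>n + 1\<close> cells.
\<close>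
lemma AE_mark_neq_mark:
  assumes "x \<noteq> z" shows "AE p in PN. p (x, i) \<noteq> p (z, j)"
proof -
  have "AE p in PN. \<not> (p (x, i) = p (z, j) \<and> p (x, i) \<le> real T \<and> regular p)" for T :: nat
  proof (rule AE_I)
    let ?A = "{p \<in> space PN. p (x, i) = p (z, j) \<and> p (x, i) \<le> real T \<and> regular p}"
    show "{p \<in> space PN. \<not> \<not> (p (x, i) = p (z, j) \<and> p (x, i) \<le> real T \<and> regular p)} \<subseteq> ?A" by auto
    have "?A = {p \<in> space PN. \<not> p (x, i) < p (z, j) \<and> \<not> p (z, j) < p (x, i) \<and> p (x, i) \<le> real T \<and> regular p}" by auto
    also have "\<dots> \<in> sets PN" by measurable
    finally show "?A \<in> sets PN" .
    show "emeasure PN ?A = 0"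
    (* The mesh below has to be positive. *)
    proof (cases "T = 0")
      case True
      have "\<not> (p (x, i) \<le> 0 \<and> regular p)" for p :: "'s marks" using regular_pos[of p "(x, i)"] by auto
      then have "?A = {}" using True by auto
      then show ?thesis by (simp only: emeasure_empty)
    next
      case False
      show ?thesis
      proof (rule emeasure_zero_limit)
        fix n
        define h where "h = real T / real (Suc n)"
        have h: "0 < h" and nh: "real (Suc n) * h = real T" using False by (simp_all add: h_def)
        define D where "D k = {p \<in> space PN. \<forall>m\<in>{(x, k), (z, k)}. 1 \<le> incr h p m}" for k
        have D: "D k \<in> sets PN" for k unfolding D_def by measurable
        have "?A \<subseteq> (\<Union>k<Suc n. D k)"
        proof safe
          fix p assume p: "p \<in> space PN" "p (x, i) = p (z, j)" "p (x, i) \<le> real T" "regular p"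
          define k where "k = (LEAST k. p (x, i) \<le> real (Suc k) * h)"
          have ex: "p (x, i) \<le> real (Suc n) * h" using p(3) nh by simp
          have 1: "p (x, i) \<le> real (Suc k) * h" unfolding k_def using ex by (rule LeastI[where P = "\<lambda>k. p (x, i) \<le> real (Suc k) * h"])
          have "k \<le> n" unfolding k_def using ex by (rule Least_le)
          have 2: "real k * h < p (x, i)"
          proof (cases k)
            case 0 then show ?thesis using regular_pos[OF p(4)] by simp
          next
            case (Suc k')
            then have "\<not> p (x, i) \<le> real (Suc k') * h" using not_less_Least[of k' "\<lambda>k. p (x, i) \<le> real (Suc k) * h"] by (simp add: k_def)
            then show ?thesis by (simp add: Suc del: of_nat_Suc)
          qed
          have "p \<in> D k"
            using p(1,2) 1 2 incr_pos_at_mark[OF p(4) h, of k x i] incr_pos_at_mark[OF p(4) h, of k z j] by (simp add: D_def)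
          then show "p \<in> (\<Union>k<Suc n. D k)" using \<open>k \<le> n\<close> by auto
        qed
        then have "emeasure PN ?A \<le> emeasure PN (\<Union>k<Suc n. D k)" using D by (intro emeasure_mono) auto
        also have "\<dots> \<le> (\<Sum>k<Suc n. emeasure PN (D k))" using D by (intro emeasure_subadditive_finite) auto
        also have "\<dots> \<le> (\<Sum>k<Suc n. ennreal (rate x * h * (rate z * h)))"
        proof (intro sum_mono)
          fix k
          have "emeasure PN (D k) \<le> (\<Prod>m\<in>{(x, k), (z, k)}. ennreal (rate (fst m) * h))"
            unfolding D_def by (rule emeasure_incr_pos[OF h]) simp
          also have "\<dots> = ennreal (rate x * h * (rate z * h))"
            using assms rate_pos[of x] rate_pos[of z] h by (simp add: ennreal_mult'[symmetric])
          finally show "emeasure PN (D k) \<le> ennreal (rate x * h * (rate z * h))" .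
        qed
        also have "\<dots> = ennreal (real (Suc n) * (rate x * h * (rate z * h)))"
          using rate_pos[of x] rate_pos[of z] h by (simp add: ennreal_of_nat_eq_real_of_nat ennreal_mult del: of_nat_Suc)
        also have "real (Suc n) * (rate x * h * (rate z * h)) = rate x * rate z * real T * real T / real (Suc n)"
          by (simp add: h_def del: of_nat_Suc)
        finally show "emeasure PN ?A \<le> ennreal (rate x * rate z * real T * real T / real (Suc n))" .
      qed
    qed
  qed
  then have "AE p in PN. \<forall>T::nat. \<not> (p (x, i) = p (z, j) \<and> p (x, i) \<le> real T \<and> regular p)"
    by (subst AE_all_countable) blast
  then show ?thesis using regular_AE
    by eventually_elim (metis real_arch_simple)
qed

lemma AE_inj: "AE p in PN. inj p"
proof -
  have "AE p in PN. \<forall>x z i j. x \<noteq> z \<longrightarrow> p (x, i) \<noteq> p (z, j)"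
    by (simp add: AE_all_countable AE_mark_neq_mark)
  then show ?thesis using regular_AE
  proof eventually_elim
    case (elim p)
    have "i = j" if "p (x, i) = p (x, j)" for x i j
    proof -
      have "strict_mono (\<lambda>i. p (x, i))" using elim(2) by (intro strict_monoI_Suc) (simp add: regular_def)
      then show ?thesis using that strict_mono_eq[of "\<lambda>i. p (x, i)" i j] by simp
    qed
    then show ?case using elim(1) unfolding inj_def by (metis prod.collapse)
  qed
qed

lemma nn_integral_marks:
  assumes p: "regular p"
  shows "(\<integral>\<^sup>+m. ennreal (\<gamma> (fst m)) * indicator {..t} (p m) \<partial>count_space UNIV) =
    (\<integral>\<^sup>+x. ennreal (\<gamma> x) * of_nat (cnt p x t) \<partial>count_space UNIV)"
proof -
  have "(\<integral>\<^sup>+m. ennreal (\<gamma> (fst m)) * indicator {..t} (p m) \<partial>count_space UNIV) =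
    (\<integral>\<^sup>+x. \<integral>\<^sup>+i. ennreal (\<gamma> x) * indicator {..t} (p (x, i)) \<partial>count_space UNIV \<partial>count_space UNIV)"
    by (subst nn_integral_fst_count_space[symmetric]) simp
  also have "\<dots> = (\<integral>\<^sup>+x. ennreal (\<gamma> x) * of_nat (cnt p x t) \<partial>count_space UNIV)"
  proof (intro nn_integral_cong)
    fix x
    have "(\<integral>\<^sup>+i. ennreal (\<gamma> x) * indicator {..t} (p (x, i)) \<partial>count_space UNIV) = (\<integral>\<^sup>+i. ennreal (\<gamma> x) * indicator {..<cnt p x t} i \<partial>count_space UNIV)"
      by (intro nn_integral_cong) (auto simp: less_cnt_iff[OF p] split: split_indicator)
    also have "\<dots> = ennreal (\<gamma> x) * of_nat (cnt p x t)"
      by (subst nn_integral_cmult_indicator) auto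
    finally show "(\<integral>\<^sup>+i. ennreal (\<gamma> x) * indicator {..t} (p (x, i)) \<partial>count_space UNIV) = ennreal (\<gamma> x) * of_nat (cnt p x t)" .
  qed
  finally show ?thesis .
qed

lemma nn_integral_cnt:
  assumes t: "0 < t" shows "(\<integral>\<^sup>+p. of_nat (cnt p x t) \<partial>PN) = ennreal (rate x * t)"
proof -
  let ?M = "\<lambda>m::'s \<times> nat. measure_pmf (poisson_pmf (rate (fst m) * t))"
  have sets [measurable_cong]: "sets (PiM UNIV ?M) = sets COUNTS" by (intro sets_PiM_cong) simp_all
  have "(\<integral>\<^sup>+p. of_nat (cnt p x t) \<partial>PN) = (\<integral>\<^sup>+p. of_nat (incr t p (x, 0)) \<partial>PN)"
    using regular_AE by (intro nn_integral_cong_AE) (auto elim!: eventually_mono simp: incr_def cnt_nonpos)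
  also have "\<dots> = (\<integral>\<^sup>+d. of_nat (d (x, 0)) \<partial>distr PN COUNTS (incr t))"
    by (subst nn_integral_distr) measurable
  also have "\<dots> = (\<integral>\<^sup>+n. of_nat n \<partial>distr (PiM UNIV ?M) (?M (x, 0)) (\<lambda>d. d (x, 0)))"
    unfolding incr_law[OF t] by (subst nn_integral_distr) measurable
  also have "distr (PiM UNIV ?M) (?M (x, 0)) (\<lambda>d. d (x, 0)) = ?M (x, 0)"
    by (intro distr_PiM_component measure_pmf.prob_space_axioms) simp
  also have "(\<integral>\<^sup>+n. of_nat n \<partial>?M (x, 0)) = ennreal (rate x * t)"
    using rate_pos t by (simp add: nn_integral_poisson)
  finally show ?thesis .
qed

text \<open>
  The expected number of marks of \<open>x\<close> up to \<open>t\<close> is \<open>rate x * t\<close>, so summability of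
  \<open>rate x * \<gamma> x\<close> is what makes the expectation finite.
\<close>
lemma expected_marks_finite:
  assumes t: "0 < t"
  shows "(\<integral>\<^sup>+p. \<integral>\<^sup>+m. ennreal (\<gamma> (fst m)) * indicator {..t} (p m) \<partial>count_space UNIV \<partial>PN) < \<infinity>"
proof -
  have "(\<integral>\<^sup>+p. \<integral>\<^sup>+m. ennreal (\<gamma> (fst m)) * indicator {..t} (p m) \<partial>count_space UNIV \<partial>PN) =
    (\<integral>\<^sup>+p. \<integral>\<^sup>+x. ennreal (\<gamma> x) * of_nat (cnt p x t) \<partial>count_space UNIV \<partial>PN)"
    using regular_AE by (intro nn_integral_cong_AE) (auto elim!: eventually_mono simp: nn_integral_marks)
  also have "\<dots> = (\<integral>\<^sup>+x. \<integral>\<^sup>+p. ennreal (\<gamma> x) * of_nat (cnt p x t) \<partial>PN \<partial>count_space UNIV)"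
    by (intro nn_integral_count_space_nn_integral) auto
  also have "\<dots> = (\<integral>\<^sup>+x. ennreal t * ennreal (rate x * \<gamma> x) \<partial>count_space UNIV)"
    using t \<gamma>_pos rate_pos
    by (intro nn_integral_cong) (simp add: nn_integral_cmult nn_integral_cnt ennreal_mult'[symmetric] less_imp_le mult_ac)
  also have "\<dots> = ennreal t * (\<integral>\<^sup>+x. ennreal (rate x * \<gamma> x) \<partial>count_space UNIV)"
    by (simp add: nn_integral_cmult)
  also have "\<dots> < \<infinity>"
  proof -
    have "Infinite_Set_Sum.abs_summable_on (\<lambda>x. rate x * \<gamma> x) UNIV"
      using summable \<gamma>_pos rate_pos by (subst abs_summable_equivalent[symmetric]) (simp add: less_imp_le)
    then have "integrable (count_space UNIV) (\<lambda>x. rate x * \<gamma> x)" by (simp add: Infinite_Set_Sum.abs_summable_on_def)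
    then have "(\<integral>\<^sup>+x. ennreal (rate x * \<gamma> x) \<partial>count_space UNIV) < \<infinity>"
      using \<gamma>_pos rate_pos by (subst (asm) integrable_iff_bounded) (simp add: less_imp_le)
    then show ?thesis by (simp add: ennreal_mult_less_top)
  qed
  finally show ?thesis .
qed

lemma nn_integral_P: "f \<in> borel_measurable P \<Longrightarrow> (\<integral>\<^sup>+\<omega>. f \<omega> \<partial>P) = (\<integral>\<^sup>+p. \<integral>\<^sup>+w. f (p, w) \<partial>CL \<partial>PN)"
  by (rule CL.nn_integral_fst[symmetric])

text \<open>
  The clocks have mean \<open>1\<close> and are independent of the marks; hence the expected mass up to \<open>t\<close> is
  the expectation in \<open>expected_marks_finite\<close>.
\<close>
lemma AE_clk_finite: "AE \<omega> in P. \<forall>v. clk_at \<omega> v < \<infinity>"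
proof -
  have "AE \<omega> in P. mass {..real (Suc t)} (fst \<omega>) (snd \<omega>) \<noteq> \<infinity>" for t
  proof (rule nn_integral_PInf_AE)
    let ?t = "real (Suc t)"
    show meas: "(\<lambda>\<omega>. mass {..?t} (fst \<omega>) (snd \<omega>)) \<in> borel_measurable P"
      by (intro mass_measurable) measurable
    have "(\<integral>\<^sup>+\<omega>. mass {..?t} (fst \<omega>) (snd \<omega>) \<partial>P) = (\<integral>\<^sup>+p. \<integral>\<^sup>+w. mass {..?t} p w \<partial>CL \<partial>PN)"
      using nn_integral_P[OF meas] by simp
    also have "\<dots> = (\<integral>\<^sup>+p. \<integral>\<^sup>+m. ennreal (\<gamma> (fst m)) * indicator {..?t} (p m) \<partial>count_space UNIV \<partial>PN)"
    proof (intro nn_integral_cong)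
      fix p
      have "(\<integral>\<^sup>+w. mass {..?t} p w \<partial>CL) = (\<integral>\<^sup>+m. \<integral>\<^sup>+w. jump w m * indicator {..?t} (p m) \<partial>CL \<partial>count_space UNIV)"
        unfolding mass_def jump_def by (intro nn_integral_count_space_nn_integral) auto
      also have "\<dots> = (\<integral>\<^sup>+m. ennreal (\<gamma> (fst m)) * indicator {..?t} (p m) \<partial>count_space UNIV)"
      proof (intro nn_integral_cong)
        fix m
        have "(\<integral>\<^sup>+w. jump w m \<partial>CL) = (\<integral>\<^sup>+v. ennreal (\<gamma> (fst m) * v) \<partial>distr CL EXP (\<lambda>w. w (Some m)))"
          unfolding jump_def by (subst nn_integral_distr) auto
        then show "(\<integral>\<^sup>+w. jump w m * indicator {..?t} (p m) \<partial>CL) = ennreal (\<gamma> (fst m)) * indicator {..?t} (p m)"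
          using \<gamma>_pos[of "fst m"] by (subst nn_integral_multc) (auto simp: jump_def CLOCKS_component EXP_mean)
      qed
      finally show "(\<integral>\<^sup>+w. mass {..?t} p w \<partial>CL) = (\<integral>\<^sup>+m. ennreal (\<gamma> (fst m)) * indicator {..?t} (p m) \<partial>count_space UNIV)" .
    qed
    also have "\<dots> < \<infinity>" by (rule expected_marks_finite) simp
    finally show "(\<integral>\<^sup>+\<omega>. mass {..?t} (fst \<omega>) (snd \<omega>) \<partial>P) \<noteq> \<infinity>" by simp
  qed
  then have "AE \<omega> in P. \<forall>t. mass {..real (Suc t)} (fst \<omega>) (snd \<omega>) \<noteq> \<infinity>" by (simp add: AE_all_countable)
  then show ?thesis
  proof eventually_elim
    case (elim \<omega>)
    show ?case
    proof
      fix v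
      obtain t where "v \<le> real (Suc t)" by (meson real_arch_simple of_nat_mono le_SucI order_refl order_trans)
      then have "clk_at \<omega> v \<le> clk_at \<omega> (real (Suc t))" by (rule clk_mono)
      also have "\<dots> < \<infinity>" using elim by (simp add: clk_def less_top)
      finally show "clk_at \<omega> v < \<infinity>" .
    qed
  qed
qed

lemma AE_finite_large: "AE p in PN. \<forall>e>0. \<forall>v. finite {m. e \<le> \<gamma> (fst m) \<and> p m \<le> v}"
proof -
  have "AE p in PN. (\<integral>\<^sup>+m. ennreal (\<gamma> (fst m)) * indicator {..real (Suc t)} (p m) \<partial>count_space UNIV) \<noteq> \<infinity>" for t
  proof (rule nn_integral_PInf_AE)
    interpret sigma_finite_measure "count_space (UNIV :: ('s \<times> nat) set)" by (rule sigma_finite_measure_count_space)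
    have "(\<lambda>z. ennreal (\<gamma> (fst (snd z))) * indicator {..real (Suc t)} (fst z (snd z))) \<in> borel_measurable (PN \<Otimes>\<^sub>M count_space UNIV)"
      by (rule measurable_compose_countable[where f = "\<lambda>m z. ennreal (\<gamma> (fst m)) * indicator {..real (Suc t)} (fst z m)" and g = snd]) measurable
    then show "(\<lambda>p. \<integral>\<^sup>+m. ennreal (\<gamma> (fst m)) * indicator {..real (Suc t)} (p m) \<partial>count_space UNIV) \<in> borel_measurable PN"
      by (intro borel_measurable_nn_integral) (simp add: split_beta)
  qed (use expected_marks_finite[of "real (Suc t)"] in simp)
  then have "AE p in PN. \<forall>t. (\<integral>\<^sup>+m. ennreal (\<gamma> (fst m)) * indicator {..real (Suc t)} (p m) \<partial>count_space UNIV) \<noteq> \<infinity>"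
    by (simp add: AE_all_countable)
  then show ?thesis
  proof eventually_elim
    case (elim p)
    show ?case
    proof (intro allI impI)
      fix e v :: real assume e: "0 < e"
      obtain t where t: "v \<le> real (Suc t)" by (meson real_arch_simple of_nat_mono le_SucI order_refl order_trans)
      define A where "A = {m. e \<le> \<gamma> (fst m) \<and> p m \<le> v}"
      have "ennreal e * emeasure (count_space UNIV) A = (\<integral>\<^sup>+m. ennreal e * indicator A m \<partial>count_space UNIV)"
        by (simp add: nn_integral_cmult_indicator)
      also have "\<dots> \<le> (\<integral>\<^sup>+m. ennreal (\<gamma> (fst m)) * indicator {..real (Suc t)} (p m) \<partial>count_space UNIV)"
        using t by (intro nn_integral_mono) (auto simp: A_def ennreal_leI split: split_indicator)
      finally have "ennreal e * emeasure (count_space UNIV) A \<noteq> \<infinity>" using elim by (metis infinity_ennreal_def top.extremum_unique)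
      then show "finite A" using e by (cases "finite A") (auto simp: ennreal_mult_top)
    qed
  qed
qed

text \<open>Already a single site has infinitely many clocks larger than \<open>1\<close>.\<close>
lemma AE_clk_unbounded: "AE \<omega> in P. \<forall>b::real. \<exists>v. ennreal b < clk_at \<omega> v"
proof -
  define x :: 's where "x = undefined"
  have "AE w in CL. infinite {i. 1 < w (Some (x, i))}"
    by (intro AE_CLOCKS_infinitely_often) (simp add: inj_def)
  then have "AE \<omega> in P. infinite {i. 1 < snd \<omega> (Some (x, i))}"
    by (intro AE_snd prob_PN prob_space_CLOCKS)
  then show ?thesis
  proof eventually_elim
    case (elim \<omega>)
    obtain p w where \<omega>: "\<omega> = (p, w)" by (cases \<omega>)
    show ?case
    proof
      fix b :: real
      (* n clocks larger than 1 contribute more than b. *)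
      obtain n0 where "b / \<gamma> x < real n0" using reals_Archimedean2 by blast
      moreover define n where "n = Suc n0"
      ultimately have n: "b < \<gamma> x * real n" "0 < n" using \<gamma>_pos[of x] by (auto simp: field_simps intro: less_trans)
      obtain A where A: "finite A" "card A = n" "A \<subseteq> {i. 1 < w (Some (x, i))}"
        using infinite_arbitrarily_large[OF elim[unfolded \<omega> snd_conv]] by metis
      define v where "v = Max (insert 0 ((\<lambda>i. p (x, i)) ` A))"
      have v: "p (x, i) \<le> v" if "i \<in> A" for i using that A(1) by (auto simp: v_def)
      have "ennreal b < ennreal (\<gamma> x * real n)"
        using n \<gamma>_pos[of x] by (intro ennreal_lessI) simp_all
      also have "ennreal (\<gamma> x * real n) = (\<integral>\<^sup>+m. ennreal (\<gamma> x) * indicator (Pair x ` A) m \<partial>count_space UNIV)"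
        using A \<gamma>_pos[of x] by (simp add: nn_integral_cmult_indicator card_image inj_on_def ennreal_mult ennreal_of_nat_eq_real_of_nat less_imp_le)
      also have "\<dots> \<le> mass {..v} p w"
        unfolding mass_def
      proof (intro nn_integral_mono)
        fix m
        have "\<gamma> x * 1 \<le> \<gamma> x * w (Some (x, i))" if "i \<in> A" for i
          using that A(3) \<gamma>_pos[of x] by (intro mult_left_mono) auto
        then show "ennreal (\<gamma> x) * indicator (Pair x ` A) m \<le> jump w m * indicator {..v} (p m)"
          using v by (auto simp: jump_def intro!: ennreal_leI split: split_indicator)
      qed
      also have "\<dots> \<le> clk p w v" by (simp add: clk_def)
      finally show "\<exists>v. ennreal b < clk_at \<omega> v" by (auto simp: \<omega>)
    qed
  qed
qed

lemma AE_good: "AE \<omega> in P. good (fst \<omega>) (snd \<omega>)"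
  using AE_fst[OF prob_space_CLOCKS regular_AE] AE_fst[OF prob_space_CLOCKS AE_inj]
    AE_fst[OF prob_space_CLOCKS AE_finite_large] AE_clk_finite AE_clk_unbounded
  by eventually_elim (simp add: good_def)

text \<open>Replacing one clock by an independent exponential variable does not change the joint law.\<close>
lemma resample_P:
  "distr (P \<Otimes>\<^sub>M EXP) P (\<lambda>(\<omega>, v). (fst \<omega>, (snd \<omega>)(j := v))) = P"
proof (rule measure_eqI_nn_integral)
  have T [measurable]: "(\<lambda>(\<omega>, v). (fst \<omega>, (snd \<omega>)(j := v))) \<in> measurable (P \<Otimes>\<^sub>M EXP) P"
    by measurable
  fix f :: "_ \<Rightarrow> ennreal" assume "f \<in> borel_measurable (distr (P \<Otimes>\<^sub>M EXP) P (\<lambda>(\<omega>, v). (fst \<omega>, (snd \<omega>)(j := v))))"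
  then have f [measurable]: "f \<in> borel_measurable P" by simp
  have "(\<integral>\<^sup>+\<omega>. f \<omega> \<partial>distr (P \<Otimes>\<^sub>M EXP) P (\<lambda>(\<omega>, v). (fst \<omega>, (snd \<omega>)(j := v)))) =
    (\<integral>\<^sup>+z. f (fst (fst z), (snd (fst z))(j := snd z)) \<partial>(P \<Otimes>\<^sub>M EXP))"
    by (subst nn_integral_distr) (auto simp: split_beta)
  also have "\<dots> = (\<integral>\<^sup>+\<omega>. \<integral>\<^sup>+v. f (fst \<omega>, (snd \<omega>)(j := v)) \<partial>EXP \<partial>P)"
    by (subst EXP.nn_integral_fst[symmetric]) auto
  also have "\<dots> = (\<integral>\<^sup>+p. \<integral>\<^sup>+w. \<integral>\<^sup>+v. f (p, w(j := v)) \<partial>EXP \<partial>CL \<partial>PN)"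
    by (subst nn_integral_P) auto
  also have "\<dots> = (\<integral>\<^sup>+p. \<integral>\<^sup>+w. f (p, w) \<partial>CL \<partial>PN)"
  proof (rule nn_integral_cong)
    fix p assume [measurable]: "p \<in> space PN"
    have "(\<integral>\<^sup>+w. \<integral>\<^sup>+v. f (p, w(j := v)) \<partial>EXP \<partial>CL) = (\<integral>\<^sup>+v. \<integral>\<^sup>+w. f (p, w(j := v)) \<partial>CL \<partial>EXP)"
      by (rule EC.Fubini') measurable
    also have "\<dots> = (\<integral>\<^sup>+z. f (p, (snd z)(j := fst z)) \<partial>(EXP \<Otimes>\<^sub>M CL))"
      by (subst CL.nn_integral_fst[symmetric]) auto
    also have "\<dots> = (\<integral>\<^sup>+w. f (p, w) \<partial>distr (EXP \<Otimes>\<^sub>M CL) CL (\<lambda>(v, w). w(j := v)))"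
      by (subst nn_integral_distr) (auto simp: split_beta)
    finally show "(\<integral>\<^sup>+w. \<integral>\<^sup>+v. f (p, w(j := v)) \<partial>EXP \<partial>CL) = (\<integral>\<^sup>+w. f (p, w) \<partial>CL)"
      by (simp add: CLOCKS_resample)
  qed
  also have "\<dots> = (\<integral>\<^sup>+\<omega>. f \<omega> \<partial>P)" by (rule nn_integral_P[symmetric]) measurable
  finally show "(\<integral>\<^sup>+\<omega>. f \<omega> \<partial>distr (P \<Otimes>\<^sub>M EXP) P (\<lambda>(\<omega>, v). (fst \<omega>, (snd \<omega>)(j := v)))) = (\<integral>\<^sup>+\<omega>. f \<omega> \<partial>P)" .
qed simp

definition glue :: "real \<Rightarrow> 's marks \<times> 's clocks \<Rightarrow> 's marks \<times> 's clocks \<Rightarrow>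
    's marks \<times> 's clocks" where
  "glue u \<omega> \<omega>' = (glue_pos u (fst \<omega>) (fst \<omega>'), select (glue_src (\<lambda>x. cnt (fst \<omega>) x u)) (snd \<omega>) (snd \<omega>'))"

lemma measurable_glue_pos' [measurable (raw)]:
  "p \<in> measurable M POS \<Longrightarrow> p' \<in> measurable M POS \<Longrightarrow> (\<lambda>x. glue_pos u (p x) (p' x) :: 's \<times> nat \<Rightarrow> real) \<in> measurable M POS"
  using measurable_compose[OF measurable_Pair measurable_glue_pos, of p M p' u] by simp

lemma measurable_glue [measurable]: "(\<lambda>z. glue u (fst z) (snd z)) \<in> measurable (P \<Otimes>\<^sub>M P) P"
proof -
  have [measurable]: "(\<lambda>z. select (glue_src (\<lambda>x. cnt (fst (fst z)) x u)) (snd (fst z)) (snd (snd z))) \<in> measurable (P \<Otimes>\<^sub>M P) CL"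
    unfolding measurable_cong_sets[OF refl sets_CLOCKS] by (intro measurable_glue_clk) measurable
  show ?thesis unfolding glue_def by measurable
qed

lemma distr_glue_clk: "distr (CL \<Otimes>\<^sub>M CL) CL (\<lambda>(a, b). select (glue_src n) a b) = CL"
  by (intro distr_select EXP.prob_space_axioms) (auto simp: inj_def glue_src_def split: option.splits sum.splits if_splits)

text \<open>
  Given both families of marks, the number of old marks of each site is fixed and the clocks of the
  glued family are an injective selection from two independent families; integrating them out
  leaves a function of the glued marks alone, to which \<open>distr_glue_pos\<close> applies.
\<close>
lemma glue_P:
  assumes u: "0 < u"
  shows "distr (P \<Otimes>\<^sub>M P) P (\<lambda>z. glue u (fst z) (snd z)) = P"
proof (rule measure_eqI_nn_integral)
  fix f :: "_ \<Rightarrow> ennreal" assume "f \<in> borel_measurable (distr (P \<Otimes>\<^sub>M P) P (\<lambda>z. glue u (fst z) (snd z)))"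
  then have f [measurable]: "f \<in> borel_measurable P" by simp
  let ?n = "\<lambda>p x. cnt p x u"
  define g where "g p w p' w' = f (glue_pos u p p', select (glue_src (?n p)) w w')" for p w p' w'
  have g [measurable (raw)]: "(\<lambda>x. g (a x) (b x) (a' x) (b' x)) \<in> borel_measurable N"
    if [measurable]: "a \<in> measurable N PN" "b \<in> measurable N CL" "a' \<in> measurable N PN" "b' \<in> measurable N CL" for a b a' b' and N :: "'x measure"
  proof -
    have [measurable]: "a \<in> measurable N POS" "a' \<in> measurable N POS" "b \<in> measurable N REALS" "b' \<in> measurable N REALS"
      using that by (simp_all only: measurable_cong_sets[OF refl sets_PN] measurable_cong_sets[OF refl sets_CLOCKS])
    have sel: "(\<lambda>z. select (glue_src (\<lambda>x. cnt (a z) x u)) (b z) (b' z)) \<in> measurable N CL"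
      unfolding measurable_cong_sets[OF refl sets_CLOCKS] by (intro measurable_glue_clk) measurable
    have "(\<lambda>z. glue_pos u (a z) (a' z)) \<in> measurable N PN"
      unfolding measurable_cong_sets[OF refl sets_PN] by measurable
    from measurable_compose[OF measurable_Pair[OF this sel] f] show ?thesis unfolding g_def .
  qed
  have "(\<integral>\<^sup>+\<omega>. f \<omega> \<partial>distr (P \<Otimes>\<^sub>M P) P (\<lambda>z. glue u (fst z) (snd z))) =
    (\<integral>\<^sup>+z. g (fst (fst z)) (snd (fst z)) (fst (snd z)) (snd (snd z)) \<partial>(P \<Otimes>\<^sub>M P))"
    by (subst nn_integral_distr[OF measurable_glue]) (simp_all add: glue_def g_def)
  also have "\<dots> = (\<integral>\<^sup>+\<omega>. \<integral>\<^sup>+\<omega>'. g (fst \<omega>) (snd \<omega>) (fst \<omega>') (snd \<omega>') \<partial>P \<partial>P)"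
    by (subst PC.nn_integral_fst[symmetric]) auto
  also have "\<dots> = (\<integral>\<^sup>+p. \<integral>\<^sup>+w. \<integral>\<^sup>+p'. \<integral>\<^sup>+w'. g p w p' w' \<partial>CL \<partial>PN \<partial>CL \<partial>PN)"
  proof (subst nn_integral_P, measurable, rule nn_integral_cong, rule nn_integral_cong)
    fix p w assume [measurable]: "p \<in> space PN" "w \<in> space CL"
    show "(\<integral>\<^sup>+\<omega>'. g (fst (p, w)) (snd (p, w)) (fst \<omega>') (snd \<omega>') \<partial>P) = (\<integral>\<^sup>+p'. \<integral>\<^sup>+w'. g p w p' w' \<partial>CL \<partial>PN)"
      by (subst nn_integral_P) simp_all
  qed
  also have "\<dots> = (\<integral>\<^sup>+p. \<integral>\<^sup>+p'. \<integral>\<^sup>+w. \<integral>\<^sup>+w'. g p w p' w' \<partial>CL \<partial>CL \<partial>PN \<partial>PN)"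
    by (rule nn_integral_cong, rule CN.Fubini'[symmetric]) measurable
  also have "\<dots> = (\<integral>\<^sup>+p. \<integral>\<^sup>+p'. \<integral>\<^sup>+w. f (glue_pos u p p', w) \<partial>CL \<partial>PN \<partial>PN)"
  proof (rule nn_integral_cong, rule nn_integral_cong)
    fix p p' assume [measurable]: "p \<in> space PN" "p' \<in> space PN"
    have "glue_pos u p p' \<in> space PN"
      by (simp add: sets_eq_imp_space_eq[OF sets_PN] space_PiM)
    then have [measurable]: "(\<lambda>w. f (glue_pos u p p', w)) \<in> borel_measurable CL"
      using measurable_compose[OF measurable_Pair1' f] by blast
    have [measurable]: "(\<lambda>(a, b). select (glue_src (?n p)) a b) \<in> measurable (CL \<Otimes>\<^sub>M CL) CL"
      by (rule measurable_select) (simp split: sum.split)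
    have "(\<integral>\<^sup>+w. \<integral>\<^sup>+w'. g p w p' w' \<partial>CL \<partial>CL) = (\<integral>\<^sup>+z. g p (fst z) p' (snd z) \<partial>(CL \<Otimes>\<^sub>M CL))"
      by (subst CL.nn_integral_fst[symmetric]) auto
    also have "\<dots> = (\<integral>\<^sup>+w. f (glue_pos u p p', w) \<partial>distr (CL \<Otimes>\<^sub>M CL) CL (\<lambda>(a, b). select (glue_src (?n p)) a b))"
      by (subst nn_integral_distr) (auto simp: g_def split_beta)
    finally show "(\<integral>\<^sup>+w. \<integral>\<^sup>+w'. g p w p' w' \<partial>CL \<partial>CL) = (\<integral>\<^sup>+w. f (glue_pos u p p', w) \<partial>CL)"
      by (simp add: distr_glue_clk)
  qed
  also have "\<dots> = (\<integral>\<^sup>+z. (\<integral>\<^sup>+w. f (glue_pos u (fst z) (snd z), w) \<partial>CL) \<partial>(PN \<Otimes>\<^sub>M PN))"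
    by (subst PN.nn_integral_fst[symmetric]) auto
  also have "\<dots> = (\<integral>\<^sup>+p. (\<integral>\<^sup>+w. f (p, w) \<partial>CL) \<partial>distr (PN \<Otimes>\<^sub>M PN) POS (\<lambda>(p, p'). glue_pos u p p'))"
    by (subst nn_integral_distr) (auto simp: split_beta)
  also have "\<dots> = (\<integral>\<^sup>+p. (\<integral>\<^sup>+w. f (p, w) \<partial>CL) \<partial>PN)"
    by (simp add: distr_glue_pos[OF prob_PN sets_PN regular_AE incr_law u])
  also have "\<dots> = (\<integral>\<^sup>+\<omega>. f \<omega> \<partial>P)" by (rule nn_integral_P[symmetric]) measurable
  finally show "(\<integral>\<^sup>+\<omega>. f \<omega> \<partial>distr (P \<Otimes>\<^sub>M P) P (\<lambda>z. glue u (fst z) (snd z))) = (\<integral>\<^sup>+\<omega>. f \<omega> \<partial>P)" .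
qed simp

end

text \<open>Dominated convergence along finite unions of the cells.\<close>
lemma integral_eq_by_partition:
  fixes D :: "'i::countable \<Rightarrow> 'a set" and g h :: "'a \<Rightarrow> real"
  assumes D: "\<And>i. D i \<in> sets M" and part: "AE x in M. \<exists>!i. x \<in> D i"
    and g: "integrable M g" and h: "integrable M h"
    and eq: "\<And>i. (\<integral>x. indicator (D i) x * g x \<partial>M) = (\<integral>x. indicator (D i) x * h x \<partial>M)"
  shows "(\<integral>x. g x \<partial>M) = (\<integral>x. h x \<partial>M)"
proof -
  define k where "k x = g x - h x" for x
  have k: "integrable M k" unfolding k_def by (intro Bochner_Integration.integrable_diff g h)
  have ind: "integrable M (\<lambda>x. indicator (D i) x * f x)" if "integrable M f" for i and f :: "'a \<Rightarrow> real"
    using integrable_mult_indicator[OF D that] by simp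
  have k0: "(\<integral>x. indicator (D i) x * k x \<partial>M) = 0" for i
    by (simp add: k_def right_diff_distrib Bochner_Integration.integral_diff ind g h eq)
  define I where "I n = (to_nat -` {..<n} :: 'i set)" for n :: nat
  have I: "finite (I n)" for n unfolding I_def by (intro finite_vimageI) simp_all
  define s where "s n x = (\<Sum>i\<in>I n. indicator (D i) x * k x)" for n x
  have s: "s n x = (if to_nat i < n then k x else 0)" if i: "x \<in> D i" "\<And>i'. x \<in> D i' \<Longrightarrow> i' = i" for n x i
  proof -
    have "s n x = (\<Sum>i'\<in>I n. if i' = i then k x else 0)"
      unfolding s_def
    proof (rule sum.cong[OF refl])
      fix i'
      have "x \<in> D i' \<longleftrightarrow> i' = i" using i by blast
      then show "indicator (D i') x * k x = (if i' = i then k x else 0)" by (simp add: indicator_def)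
    qed
    then show ?thesis using I by (simp add: I_def)
  qed
  have "(\<lambda>n. \<integral>x. s n x \<partial>M) \<longlonglongrightarrow> (\<integral>x. k x \<partial>M)"
  proof (rule integral_dominated_convergence[where w = "\<lambda>x. norm (k x)"])
    show "AE x in M. (\<lambda>n. s n x) \<longlonglongrightarrow> k x"
      using part
    proof eventually_elim
      case (elim x)
      then obtain i where i: "x \<in> D i" "\<And>i'. x \<in> D i' \<Longrightarrow> i' = i" by blast
      have "\<forall>\<^sub>F n in sequentially. to_nat i < n" by (rule eventually_gt_at_top)
      then have "\<forall>\<^sub>F n in sequentially. s n x = k x" by eventually_elim (simp add: s[OF i])
      then show ?case by (rule tendsto_eventually)
    qed
    show "AE x in M. norm (s n x) \<le> norm (k x)" for n
      using part
    proof eventually_elim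
      case (elim x)
      then obtain i where i: "x \<in> D i" "\<And>i'. x \<in> D i' \<Longrightarrow> i' = i" by blast
      show ?case by (simp add: s[OF i])
    qed
    show "s n \<in> borel_measurable M" for n
      unfolding s_def using k D by (intro borel_measurable_sum borel_measurable_times) auto
  qed (use k in auto)
  moreover have "(\<integral>x. s n x \<partial>M) = 0" for n
    unfolding s_def by (subst Bochner_Integration.integral_sum) (auto intro: ind k simp: k0)
  ultimately have "(\<integral>x. k x \<partial>M) = 0" using LIMSEQ_unique[of "\<lambda>_. 0::real"] by simp
  then show ?thesis using g h by (simp add: k_def)
qed

section \<open>Sojourns have no fixed end points\<close>

lemma EXP_shift_neq:
  assumes "0 < a" "0 < q" shows "AE v in EXP. b + ennreal (a * v) \<noteq> ennreal q"
  using EXP_nonneg EXP_neq[of "(q - enn2real b) / a"]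
proof eventually_elim
  case (elim v)
  show ?case
  proof
    assume eq: "b + ennreal (a * v) = ennreal q"
    then have "b \<noteq> \<infinity>" by auto
    then have b: "b = ennreal (enn2real b)" by (simp add: less_top)
    have "ennreal (enn2real b + a * v) = ennreal q"
      using eq elim assms by (subst ennreal_plus) (auto simp: b[symmetric])
    then have "enn2real b + a * v = q" using assms elim by (subst (asm) ennreal_inj) auto
    then show False using elim(2) assms by (auto simp: field_simps)
  qed
qed

lemma bounded_integral_le:
  assumes "prob_space M" "\<And>x. \<bar>f x\<bar> \<le> C" shows "\<bar>\<integral>x. f x \<partial>M\<bar> \<le> (C :: real)"
proof -
  interpret prob_space M by fact
  have C: "0 \<le> C" using assms(2)[of undefined] by simp
  show ?thesis
  proof (cases "integrable M f")
    case True
    have "\<bar>\<integral>x. f x \<partial>M\<bar> \<le> (\<integral>x. \<bar>f x\<bar> \<partial>M)" using integral_norm_bound[of M f] by simp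
    also have "\<dots> \<le> (\<integral>x. C \<partial>M)" using True assms(2) by (intro integral_mono) auto
    finally show ?thesis by (simp add: prob_space)
  qed (use C in \<open>simp add: not_integrable_integral_eq\<close>)
qed

context K_law begin

lemma AE_resample:
  assumes [measurable]: "Measurable.pred P A"
    and AE: "AE \<omega> in P. AE v in EXP. A (fst \<omega>, (snd \<omega>)(j := v))"
  shows "AE \<omega> in P. A \<omega>"
proof -
  have [measurable]: "(\<lambda>(\<omega>, v). (fst \<omega>, (snd \<omega>)(j := v))) \<in> measurable (P \<Otimes>\<^sub>M EXP) P" by measurable
  have "AE z in P \<Otimes>\<^sub>M EXP. A ((\<lambda>(\<omega>, v). (fst \<omega>, (snd \<omega>)(j := v))) z)"
    by (rule PE.AE_pair_measure) (measurable, use AE in simp)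
  then have "AE \<omega> in distr (P \<Otimes>\<^sub>M EXP) P (\<lambda>(\<omega>, v). (fst \<omega>, (snd \<omega>)(j := v))). A \<omega>"
    by (subst AE_distr_iff) measurable
  then show ?thesis by (subst (asm) resample_P)
qed

lemma AE_P_inj: "AE \<omega> in P. inj (fst \<omega>)"
  by (intro AE_fst prob_space_CLOCKS AE_inj)

lemma AE_clk_at_mark_neq:
  assumes q: "0 < q" shows "AE \<omega> in P. clk_at \<omega> (fst \<omega> m) \<noteq> ennreal q"
proof (rule AE_resample[where j = "Some m"])
  show "Measurable.pred P (\<lambda>\<omega>. clk_at \<omega> (fst \<omega> m) \<noteq> ennreal q)" by measurable
  show "AE \<omega> in P. AE v in EXP. clk (fst (fst \<omega>, (snd \<omega>)(Some m := v))) (snd (fst \<omega>, (snd \<omega>)(Some m := v))) (fst (fst \<omega>, (snd \<omega>)(Some m := v)) m) \<noteq> ennreal q"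
    using AE_P_inj
  proof eventually_elim
    case (elim \<omega>)
    show ?case
      using EXP_shift_neq[OF \<gamma>_pos q, of "clk_pre_at \<omega> (fst \<omega> m)" "fst m"]
      by eventually_elim (simp add: clk_at_mark[OF elim] clk_pre_fun_upd[OF elim] jump_def)
  qed
qed

lemma AE_clk_pre_at_mark_neq:
  assumes q: "0 < q"
  shows "AE \<omega> in P. fst \<omega> m' < fst \<omega> m \<longrightarrow> clk_pre_at \<omega> (fst \<omega> m) \<noteq> ennreal q"
proof (rule AE_resample[where j = "Some m'"])
  show "Measurable.pred P (\<lambda>\<omega>. fst \<omega> m' < fst \<omega> m \<longrightarrow> clk_pre_at \<omega> (fst \<omega> m) \<noteq> ennreal q)" by measurable
  show "AE \<omega> in P. AE v in EXP. fst (fst \<omega>, (snd \<omega>)(Some m' := v)) m' < fst (fst \<omega>, (snd \<omega>)(Some m' := v)) m \<longrightarrow>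
     clk_pre (fst (fst \<omega>, (snd \<omega>)(Some m' := v))) (snd (fst \<omega>, (snd \<omega>)(Some m' := v))) (fst (fst \<omega>, (snd \<omega>)(Some m' := v)) m) \<noteq> ennreal q"
    using AE_P_inj
  proof eventually_elim
    case (elim \<omega>)
    let ?p = "fst \<omega>" and ?B = "{..<fst \<omega> m}"
    show ?case
      using EXP_shift_neq[OF \<gamma>_pos q, of "mass (?B - {?p m'}) ?p (snd \<omega>) + ennreal (c * ?p m)" "fst m'"]
    proof eventually_elim
      case (elim v)
      then show ?case
        using mass_split[OF \<open>inj ?p\<close>, of m' ?B "(snd \<omega>)(Some m' := v)"] \<open>inj ?p\<close>
        by (simp add: clk_pre_def mass_fun_upd jump_def ac_simps)
    qed
  qed
qed

text \<open>
  The end of a sojourn contains the clock of its own mark as an additive term, and its start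
  contains the clock of any earlier mark; resampling that clock shows that a given value is missed.
  If there is no earlier mark, the start is \<open>c\<close> times the position of the mark, which misses a
  given positive value because a mark has no fixed position.
\<close>
lemma AE_clk_neq:
  assumes q: "0 < q"
  shows "AE \<omega> in P. \<forall>m. clk_at \<omega> (fst \<omega> m) \<noteq> ennreal q \<and> clk_pre_at \<omega> (fst \<omega> m) \<noteq> ennreal q"
proof -
  have "AE \<omega> in P. \<forall>m. clk_at \<omega> (fst \<omega> m) \<noteq> ennreal q"
    unfolding AE_all_countable using AE_clk_at_mark_neq[OF q] by blast
  moreover have "AE \<omega> in P. \<forall>m m'. fst \<omega> m' < fst \<omega> m \<longrightarrow> clk_pre_at \<omega> (fst \<omega> m) \<noteq> ennreal q"
    unfolding AE_all_countable using AE_clk_pre_at_mark_neq[OF q] by blast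
  moreover have "AE \<omega> in P. \<forall>m. fst \<omega> m \<noteq> q / c"
    unfolding AE_all_countable by (intro allI AE_fst prob_space_CLOCKS AE_mark_neq)
  ultimately show ?thesis
  proof eventually_elim
    case (elim \<omega>)
    show ?case
    proof (intro allI conjI)
      fix m
      show "clk_at \<omega> (fst \<omega> m) \<noteq> ennreal q" using elim(1) by blast
      show "clk_pre_at \<omega> (fst \<omega> m) \<noteq> ennreal q"
      proof (cases "\<exists>m'. fst \<omega> m' < fst \<omega> m")
        case True
        then show ?thesis using elim(2) by blast
      next
        case False
        then have pre: "clk_pre_at \<omega> (fst \<omega> m) = ennreal (c * fst \<omega> m)"
          using mass_empty[of "fst \<omega>" "{..<fst \<omega> m}" "snd \<omega>"] unfolding clk_pre_def by (metis add_0 lessThan_iff)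
        show ?thesis
        proof
          assume "clk_pre_at \<omega> (fst \<omega> m) = ennreal q"
          then have "ennreal (c * fst \<omega> m) = ennreal q" unfolding pre .
          then have "c * fst \<omega> m = q" using q by (metis ennreal_eq_0_iff ennreal_inj less_le_not_le linear)
          moreover from this have "c \<noteq> 0" using q by auto
          ultimately have "fst \<omega> m = q / c" by (simp add: field_simps)
          then show False using elim(3) by blast
        qed
      qed
    qed
  qed
qed

section \<open>The semigroup\<close>

definition mean_from_infinity :: "('s option \<Rightarrow> real) \<Rightarrow> real \<Rightarrow> real" where
  "mean_from_infinity f q = (\<integral>\<omega>. f (state_at q \<omega>) \<partial>P)"

text \<open>
  From a site \<open>x\<close> the process stays there for a time \<open>\<gamma> x * v\<close>, with \<open>v\<close> exponential, and then
  behaves as if started from \<open>\<infinity>\<close>. That this is the semigroup of the K process is shown in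
  \<open>semigroup_eq\<close>.
\<close>
definition semigroup :: "('s option \<Rightarrow> real) \<Rightarrow> real \<Rightarrow> 's option \<Rightarrow> real" where
  "semigroup f s y = (case y of None \<Rightarrow> mean_from_infinity f s
     | Some x \<Rightarrow> (\<integral>v. (if s < \<gamma> x * v then f (Some x) else mean_from_infinity f (s - \<gamma> x * v)) \<partial>EXP))"

lemma measurable_state_fun [measurable (raw)]:
  fixes f :: "'s option \<Rightarrow> real"
  assumes [measurable]: "p \<in> measurable M POS" "w \<in> measurable M REALS" "q \<in> borel_measurable M"
  shows "(\<lambda>x. f (state (q x) (p x) (w x))) \<in> borel_measurable M"
  by (rule measurable_compose[OF state_measurable]) (use assms in auto)

lemma measurable_mean_from_infinity [measurable]: "mean_from_infinity f \<in> borel_measurable borel"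
  unfolding mean_from_infinity_def[abs_def] by measurable

context
  fixes f :: "'s option \<Rightarrow> real" and C :: real
  assumes f_bdd: "\<And>y. \<bar>f y\<bar> \<le> C"
    and f_cont: "\<And>e. 0 < e \<Longrightarrow> \<exists>d>0. \<forall>x. \<gamma> x < d \<longrightarrow> \<bar>f (Some x) - f None\<bar> < e"
begin

lemma mean_from_infinity_bdd: "\<bar>mean_from_infinity f q\<bar> \<le> C"
  unfolding mean_from_infinity_def by (intro bounded_integral_le PC.prob_space_axioms f_bdd)

lemma semigroup_bdd: "\<bar>semigroup f s y\<bar> \<le> C"
  unfolding semigroup_def by (cases y) (auto intro!: bounded_integral_le EXP.prob_space_axioms f_bdd mean_from_infinity_bdd)

lemma mean_from_infinity_continuous:
  assumes q: "0 < q" and Q: "Q \<longlonglongrightarrow> q"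
  shows "(\<lambda>n. mean_from_infinity f (Q n)) \<longlonglongrightarrow> mean_from_infinity f q"
  unfolding mean_from_infinity_def
proof (rule integral_dominated_convergence[where w = "\<lambda>_. C"])
  show "AE \<omega> in P. (\<lambda>n. f (state_at (Q n) \<omega>)) \<longlonglongrightarrow> f (state_at q \<omega>)"
    using AE_good AE_clk_neq[OF q]
    by eventually_elim (intro state_continuous_at f_cont Q q; blast)
qed (auto simp: f_bdd)

section \<open>The Markov property from infinity\<close>

text \<open>
  The conditional mean of \<open>f\<close> at time \<open>r + s\<close> if the process restarts from \<open>\<infinity>\<close> at the time \<open>V\<close>
  and is known up to that time.
\<close>

definition forecast :: "real \<Rightarrow> real \<Rightarrow> ennreal \<Rightarrow> _ \<Rightarrow> real" where
  "forecast r s V \<omega> = (if ennreal (r + s) < V then f (state_at (r + s) \<omega>) else mean_from_infinity f (r + s - enn2real V))"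

lemma forecast_bdd: "\<bar>forecast r s V \<omega>\<bar> \<le> C" by (simp add: forecast_def f_bdd mean_from_infinity_bdd)

context
  fixes A :: "'s marks \<times> 's clocks \<Rightarrow> real" and a r s :: real
  assumes A_meas [measurable]: "A \<in> borel_measurable P" and A_bdd: "\<And>\<omega>. \<bar>A \<omega>\<bar> \<le> a"
    and A_past: "\<And>\<omega> \<omega>'. (\<And>q. 0 \<le> q \<Longrightarrow> q \<le> r \<Longrightarrow> state_at q \<omega> = state_at q \<omega>') \<Longrightarrow> A \<omega> = A \<omega>'"
    and r: "0 \<le> r" and s: "0 < s"
begin

lemma integrable_A_times:
  assumes "g \<in> borel_measurable P" "\<And>\<omega>. \<bar>g \<omega>\<bar> \<le> C"
  shows "integrable P (\<lambda>\<omega>. A \<omega> * g \<omega>)"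
proof (rule PC.integrable_const_bound[where B = "a * C"])
  show "AE \<omega> in P. norm (A \<omega> * g \<omega>) \<le> a * C"
    using A_bdd assms(2) by (intro AE_I2) (auto simp: abs_mult intro!: mult_mono order_trans[OF abs_ge_zero A_bdd])
qed (use assms(1) in measurable)

definition slot :: "real \<Rightarrow> nat \<Rightarrow> ('s marks \<times> 's clocks) set" where
  "slot h k = {\<omega> \<in> space P. ennreal r < clk_at \<omega> (real k * h) \<and> (\<forall>j<k. \<not> ennreal r < clk_at \<omega> (real j * h))}"

lemma slot_sets [measurable]: "slot h k \<in> sets P"
  unfolding slot_def by measurable

lemma slot_first_above: "\<omega> \<in> slot h k \<Longrightarrow> first_above h r (fst \<omega>) (snd \<omega>) = k"
  unfolding first_above_def by (rule Least_equality) (auto simp: slot_def not_less[symmetric])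

lemma first_above_measurable [measurable]:
  "(\<lambda>\<omega>. first_above h r (fst \<omega>) (snd \<omega>)) \<in> measurable P (count_space UNIV)"
  unfolding first_above_def by measurable

abbreviation "clk_up h \<omega> \<equiv> clk_at \<omega> (real (first_above h r (fst \<omega>) (snd \<omega>)) * h)"

lemma space_P: "space P = UNIV"
  using sets_eq_imp_space_eq[OF sets_PN] sets_eq_imp_space_eq[OF sets_CLOCKS] by (simp add: space_pair_measure space_PiM)

text \<open>
  Glue an independent copy at the grid point \<open>u = k * h\<close>. The event \<open>slot h k\<close> and the factor \<open>A\<close>
  depend only on the part before \<open>u\<close>, because the clock at \<open>u\<close> exceeds \<open>r\<close>. If \<open>r + s\<close> exceeds
  the clock value at \<open>u\<close>, the state at \<open>r + s\<close> is one of the copy, over which the integral is taken.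
\<close>
lemma regeneration_on_slot:
  assumes h: "0 < h"
  shows "(\<integral>\<omega>. indicator (slot h k) \<omega> * (A \<omega> * f (state_at (r + s) \<omega>)) \<partial>P) =
    (\<integral>\<omega>. indicator (slot h k) \<omega> * (A \<omega> * forecast r s (clk_up h \<omega>) \<omega>) \<partial>P)"
proof (cases "k = 0")
  case True
  (* The clock vanishes at time 0, hence the grid point 0 is never the first one above r. *)
  have "AE \<omega> in P. \<omega> \<notin> slot h k"
    using AE_good by eventually_elim (auto simp: slot_def True clk_0 good_def)
  then have "AE \<omega> in P. indicator (slot h k) \<omega> = (0::real)" by eventually_elim simp
  then show ?thesis by (intro integral_cong_AE) (auto elim!: eventually_mono simp: forecast_def)
next
  case False
  define u where "u = real k * h"
  have u: "0 < u" using False h by (simp add: u_def)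
  define \<Phi> where "\<Phi> \<omega> = indicator (slot h k) \<omega> * (A \<omega> * f (state_at (r + s) \<omega>))" for \<omega>
  have [measurable]: "\<Phi> \<in> borel_measurable P" unfolding \<Phi>_def by measurable
  have \<Phi>_bdd: "\<bar>\<Phi> \<omega>\<bar> \<le> a * C" for \<omega>
  proof -
    have "\<bar>\<Phi> \<omega>\<bar> \<le> \<bar>A \<omega> * f (state_at (r + s) \<omega>)\<bar>"
      by (simp add: \<Phi>_def abs_mult split: split_indicator)
    also have "\<dots> \<le> a * C"
      unfolding abs_mult by (intro mult_mono A_bdd f_bdd order_trans[OF abs_ge_zero A_bdd[of \<omega>]] abs_ge_zero)
    finally show ?thesis .
  qed
  have [measurable]: "(\<lambda>z. glue u (fst z) (snd z)) \<in> measurable (P \<Otimes>\<^sub>M P) P" by (rule measurable_glue)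
  have int: "integrable (P \<Otimes>\<^sub>M P) (\<lambda>z. \<Phi> (glue u (fst z) (snd z)))"
    using \<Phi>_bdd by (intro PP.integrable_const_bound[where B = "a * C"]) auto
  have "(\<integral>\<omega>. \<Phi> \<omega> \<partial>P) = (\<integral>\<omega>. \<Phi> \<omega> \<partial>distr (P \<Otimes>\<^sub>M P) P (\<lambda>z. glue u (fst z) (snd z)))"
    by (simp add: glue_P[OF u])
  also have "\<dots> = (\<integral>z. \<Phi> (glue u (fst z) (snd z)) \<partial>(P \<Otimes>\<^sub>M P))"
    by (rule integral_distr) measurable
  also have "\<dots> = (\<integral>\<omega>. \<integral>\<omega>'. \<Phi> (glue u \<omega> \<omega>') \<partial>P \<partial>P)"
    using PP.integral_fst'[OF int] by simp
  also have "\<dots> = (\<integral>\<omega>. indicator (slot h k) \<omega> * (A \<omega> * forecast r s (clk_up h \<omega>) \<omega>) \<partial>P)"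
  proof (rule integral_cong_AE)
    have "integrable P (\<lambda>\<omega>. \<integral>\<omega>'. \<Phi> (glue u \<omega> \<omega>') \<partial>P)" using PP.integrable_fst'[OF int] by simp
    then show "(\<lambda>\<omega>. \<integral>\<omega>'. \<Phi> (glue u \<omega> \<omega>') \<partial>P) \<in> borel_measurable P" by simp
    show "(\<lambda>\<omega>. indicator (slot h k) \<omega> * (A \<omega> * forecast r s (clk_up h \<omega>) \<omega>)) \<in> borel_measurable P"
      unfolding forecast_def by measurable
    show "AE \<omega> in P. (\<integral>\<omega>'. \<Phi> (glue u \<omega> \<omega>') \<partial>P) = indicator (slot h k) \<omega> * (A \<omega> * forecast r s (clk_up h \<omega>) \<omega>)"
      using AE_good
    proof eventually_elim
      case (elim \<omega>)
      obtain p w where \<omega>: "\<omega> = (p, w)" by (cases \<omega>)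
      have p: "regular p" using elim by (simp add: \<omega> good_def)
      let ?G = "\<lambda>\<omega>'. if ennreal (r + s) < clk p w u then f (state (r + s) p w) else f (state (r + s - enn2real (clk p w u)) (fst \<omega>') (snd \<omega>'))"
      have "AE \<omega>' in P. \<Phi> (glue u \<omega> \<omega>') = (indicator (slot h k) \<omega> * A \<omega>) * ?G \<omega>'"
        using AE_good
      proof eventually_elim
        case (elim \<omega>')
        obtain p' w' where \<omega>': "\<omega>' = (p', w')" by (cases \<omega>')
        have p': "regular p'" using elim by (simp add: \<omega>' good_def)
        have u0: "0 \<le> u" using u by simp
        note glue_simps = glue_def \<omega> \<omega>'
        have clk_eq: "clk (fst (glue u \<omega> \<omega>')) (snd (glue u \<omega> \<omega>')) (real j * h) = clk p w (real j * h)" if "j \<le> k" for j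
          unfolding glue_simps fst_conv snd_conv
          by (rule clk_glue_before[OF p p' u0]) (use that h in \<open>simp add: u_def\<close>)
        have slot_eq: "glue u \<omega> \<omega>' \<in> slot h k \<longleftrightarrow> \<omega> \<in> slot h k"
          unfolding slot_def space_P by (simp add: clk_eq) (simp add: \<omega>)
        then have ind_eq: "indicator (slot h k) (glue u \<omega> \<omega>') = (indicator (slot h k) \<omega> :: real)"
          by (simp add: indicator_def)
        show ?case
        proof (cases "\<omega> \<in> slot h k")
          case True
          then have ru: "ennreal r < clk p w u" by (simp add: slot_def u_def \<omega>)
          have before: "state q (fst (glue u \<omega> \<omega>')) (snd (glue u \<omega> \<omega>')) = state q p w" if "ennreal q < clk p w u" for q
            unfolding glue_simps fst_conv snd_conv by (rule state_glue_before[OF p p' u0 that])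
          have "A (glue u \<omega> \<omega>') = A \<omega>"
          proof (rule A_past)
            fix q assume "0 \<le> q" "q \<le> r"
            then have "ennreal q < clk p w u" using ru by (meson ennreal_leI le_less_trans)
            then show "state q (fst (glue u \<omega> \<omega>')) (snd (glue u \<omega> \<omega>')) = state_at q \<omega>"
              by (simp add: before) (simp add: \<omega>)
          qed
          moreover have "f (state (r + s) (fst (glue u \<omega> \<omega>')) (snd (glue u \<omega> \<omega>'))) = ?G \<omega>'"
          proof (cases "ennreal (r + s) < clk p w u")
            case False
            then have "state (r + s) (fst (glue u \<omega> \<omega>')) (snd (glue u \<omega> \<omega>')) = state (r + s - enn2real (clk p w u)) p' w'"
              unfolding glue_simps fst_conv snd_conv using r s
              by (intro state_glue_after[OF p p' u0]) auto
            then show ?thesis using False by (simp add: \<omega>')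
          qed (simp add: before)
          ultimately show ?thesis by (simp only: \<Phi>_def ind_eq mult.assoc)
        qed (simp add: \<Phi>_def ind_eq)
      qed
      then have "(\<integral>\<omega>'. \<Phi> (glue u \<omega> \<omega>') \<partial>P) = (\<integral>\<omega>'. (indicator (slot h k) \<omega> * A \<omega>) * ?G \<omega>' \<partial>P)"
      proof (rule integral_cong_AE[rotated 2])
        have "\<omega> \<in> space P" by (simp add: space_P)
        from measurable_compose[OF measurable_Pair1'[OF this] measurable_glue[of u]]
        have [measurable]: "(\<lambda>\<omega>'. glue u \<omega> \<omega>') \<in> measurable P P" by simp
        show "(\<lambda>\<omega>'. \<Phi> (glue u \<omega> \<omega>')) \<in> borel_measurable P" by measurable
      qed measurable
      also have "\<dots> = (indicator (slot h k) \<omega> * A \<omega>) * (\<integral>\<omega>'. ?G \<omega>' \<partial>P)" by simp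
      also have "\<dots> = indicator (slot h k) \<omega> * (A \<omega> * forecast r s (clk_up h \<omega>) \<omega>)"
      proof (cases "\<omega> \<in> slot h k")
        case True
        then have V: "clk_up h \<omega> = clk p w u" by (simp add: slot_first_above u_def) (simp add: \<omega>)
        have "(\<integral>\<omega>'. ?G \<omega>' \<partial>P) = forecast r s (clk p w u) \<omega>"
          using PC.prob_space by (cases "ennreal (r + s) < clk p w u") (simp_all add: forecast_def mean_from_infinity_def \<omega>)
        then show ?thesis by (simp add: V)
      qed simp
      finally show ?case .
    qed
  qed
  finally show ?thesis by (simp add: \<Phi>_def)
qed

lemma forecast_measurable:
  assumes [measurable]: "V \<in> borel_measurable P"
  shows "(\<lambda>\<omega>. forecast r s (V \<omega>) \<omega>) \<in> borel_measurable P"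
  unfolding forecast_def by measurable

lemma regeneration_on_grid:
  assumes h: "0 < h"
  shows "(\<integral>\<omega>. A \<omega> * f (state_at (r + s) \<omega>) \<partial>P) = (\<integral>\<omega>. A \<omega> * forecast r s (clk_up h \<omega>) \<omega> \<partial>P)"
proof (rule integral_eq_by_partition[where D = "slot h"])
  show "AE \<omega> in P. \<exists>!k. \<omega> \<in> slot h k"
    using AE_good
  proof eventually_elim
    case (elim \<omega>)
    let ?k = "first_above h r (fst \<omega>) (snd \<omega>)"
    have "\<omega> \<in> slot h ?k"
      using clk_first_above[OF elim h] not_less_Least[of _ "\<lambda>k. ennreal r < clk_at \<omega> (real k * h)"]
      by (auto simp: slot_def space_P first_above_def)
    then show ?case using slot_first_above by blast
  qed
  show "integrable P (\<lambda>\<omega>. A \<omega> * f (state_at (r + s) \<omega>))"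
    by (intro integrable_A_times f_bdd) measurable
  show "integrable P (\<lambda>\<omega>. A \<omega> * forecast r s (clk_up h \<omega>) \<omega>)"
    by (intro integrable_A_times forecast_bdd forecast_measurable) measurable
qed (use regeneration_on_slot[OF h] in auto)

lemma occupied_measurable [measurable]:
  "(\<lambda>\<omega>. occupied r (fst \<omega>) (snd \<omega>)) \<in> measurable P (count_space UNIV)"
  unfolding occupied_def by (rule measurable_unique_choice) measurable

lemma clk_after_measurable [measurable]: "(\<lambda>\<omega>. clk_after r (fst \<omega>) (snd \<omega>)) \<in> borel_measurable P"
  unfolding clk_after_def
proof (rule measurable_compose_countable[OF _ occupied_measurable])
  show "(\<lambda>\<omega>. case y of None \<Rightarrow> ennreal r | Some m \<Rightarrow> clk_at \<omega> (fst \<omega> m)) \<in> borel_measurable P" for y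
    by (cases y) simp_all
qed

abbreviation "forecast_after \<omega> \<equiv> forecast r s (clk_after r (fst \<omega>) (snd \<omega>)) \<omega>"

text \<open>
  Let the mesh tend to zero. The limit of the restart times differs almost surely from \<open>r + s\<close>.
  If it is larger, the sojourn at \<open>r\<close> lasts beyond \<open>r + s\<close> and nothing changes for fine grids; if it
  is smaller, the mean of the restarted process is continuous in the elapsed time.
\<close>
lemma regeneration_after_residual:
  "(\<integral>\<omega>. A \<omega> * f (state_at (r + s) \<omega>) \<partial>P) = (\<integral>\<omega>. A \<omega> * forecast_after \<omega> \<partial>P)"
proof -
  define h where "h n = 1 / real (Suc n)" for n
  have h: "0 < h n" for n by (simp add: h_def)
  have h_lim: "h \<longlonglongrightarrow> 0"
    unfolding h_def using LIMSEQ_inverse_real_of_nat by (simp add: inverse_eq_divide)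
  have "(\<lambda>n. \<integral>\<omega>. A \<omega> * forecast r s (clk_up (h n) \<omega>) \<omega> \<partial>P) \<longlonglongrightarrow> (\<integral>\<omega>. A \<omega> * forecast_after \<omega> \<partial>P)"
  proof (rule integral_dominated_convergence[where w = "\<lambda>_. a * C"])
    show "(\<lambda>\<omega>. A \<omega> * forecast_after \<omega>) \<in> borel_measurable P"
      by (intro borel_measurable_times A_meas forecast_measurable clk_after_measurable)
    show "(\<lambda>\<omega>. A \<omega> * forecast r s (clk_up (h n) \<omega>) \<omega>) \<in> borel_measurable P" for n
      by (intro borel_measurable_times A_meas forecast_measurable) measurable
    show "AE \<omega> in P. norm (A \<omega> * forecast r s (clk_up (h n) \<omega>) \<omega>) \<le> a * C" for n
      unfolding real_norm_def abs_mult
      by (intro AE_I2 mult_mono A_bdd forecast_bdd abs_ge_zero order_trans[OF abs_ge_zero A_bdd])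
    have "0 < r + s" using r s by simp
    show "AE \<omega> in P. (\<lambda>n. A \<omega> * forecast r s (clk_up (h n) \<omega>) \<omega>) \<longlonglongrightarrow> A \<omega> * forecast_after \<omega>"
      using AE_good AE_clk_neq[OF \<open>0 < r + s\<close>]
    proof eventually_elim
      case (elim \<omega>)
      let ?V = "clk_after r (fst \<omega>) (snd \<omega>)"
      have V: "(\<lambda>n. clk_up (h n) \<omega>) \<longlonglongrightarrow> ?V"
        by (rule clk_first_above_tendsto[OF elim(1) r h h_lim])
      have fin: "?V < \<infinity>"
        using elim(1) by (auto simp: clk_after_def good_def split: option.split)
      have "?V \<noteq> ennreal (r + s)"
        using elim(2) r s by (auto simp: clk_after_def split: option.split)
      then have "(\<lambda>n. forecast r s (clk_up (h n) \<omega>) \<omega>) \<longlonglongrightarrow> forecast_after \<omega>"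
      proof (rule linorder_neqE)
        assume less: "?V < ennreal (r + s)"
        then have pos: "0 < r + s - enn2real ?V"
          using r s fin by (cases ?V) (auto simp: ennreal_less_iff simp del: ennreal_plus)
        have "(\<lambda>n. r + s - enn2real (clk_up (h n) \<omega>)) \<longlonglongrightarrow> r + s - enn2real ?V"
        proof (intro tendsto_diff tendsto_const tendsto_enn2real)
          show "(\<lambda>n. clk_up (h n) \<omega>) \<longlonglongrightarrow> ennreal (enn2real ?V)" using V fin by simp
        qed simp
        then have lim: "(\<lambda>n. mean_from_infinity f (r + s - enn2real (clk_up (h n) \<omega>))) \<longlonglongrightarrow> mean_from_infinity f (r + s - enn2real ?V)"
          by (rule mean_from_infinity_continuous[OF pos])
        have "\<forall>\<^sub>F n in sequentially. mean_from_infinity f (r + s - enn2real (clk_up (h n) \<omega>)) = forecast r s (clk_up (h n) \<omega>) \<omega>"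
          using order_tendstoD(2)[OF V less] by eventually_elim (auto simp: forecast_def dest: less_asym)
        from Lim_transform_eventually[OF lim this] show ?thesis using less by (auto simp: forecast_def dest: less_asym)
      next
        assume less: "ennreal (r + s) < ?V"
        have "\<forall>\<^sub>F n in sequentially. forecast r s (clk_up (h n) \<omega>) \<omega> = forecast_after \<omega>"
          using order_tendstoD(1)[OF V less] by eventually_elim (use less in \<open>simp add: forecast_def\<close>)
        then show ?thesis by (rule tendsto_eventually)
      qed
      then show ?case by (intro tendsto_mult tendsto_const)
    qed
  qed simp
  moreover have "(\<integral>\<omega>. A \<omega> * forecast r s (clk_up (h n) \<omega>) \<omega> \<partial>P) = (\<integral>\<omega>. A \<omega> * f (state_at (r + s) \<omega>) \<partial>P)" for n
    by (rule regeneration_on_grid[OF h, symmetric])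
  ultimately show ?thesis using LIMSEQ_unique[OF tendsto_const] by simp
qed

text \<open>
  Resample the clock of the mark \<open>m\<close>. The start of its sojourn and, while it contains \<open>r\<close>, also
  \<open>A\<close> do not depend on this clock, so that memorylessness applies to the inner integral.
\<close>
lemma residual_memoryless:
  "(\<integral>\<omega>. indicator {\<omega>. sojourn_at \<omega> r m} \<omega> * (A \<omega> * (forecast_after \<omega> - semigroup f s (Some (fst m)))) \<partial>P) = 0"
proof -
  define x where "x = fst m"
  define G where "G \<rho> = (if s < \<rho> then f (Some x) else mean_from_infinity f (s - \<rho>))" for \<rho>
  have [measurable]: "G \<in> borel_measurable borel" unfolding G_def[abs_def] by measurable
  have G_bdd: "\<bar>G \<rho>\<bar> \<le> C" for \<rho> by (simp add: G_def f_bdd mean_from_infinity_bdd)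
  have semigroup_G: "semigroup f s (Some x) = (\<integral>v. G (\<gamma> x * v) \<partial>EXP)" by (simp add: semigroup_def G_def)
  define \<Phi> where "\<Phi> \<omega> = indicator {\<omega>. sojourn_at \<omega> r m} \<omega> *
      (A \<omega> * (G (enn2real (clk_at \<omega> (fst \<omega> m)) - r) - semigroup f s (Some x)))" for \<omega>
  have [measurable]: "\<Phi> \<in> borel_measurable P" unfolding \<Phi>_def by measurable
  have bdd: "\<bar>\<Phi> \<omega>\<bar> \<le> a * (C + C)" for \<omega>
  proof -
    have "\<bar>\<Phi> \<omega>\<bar> \<le> \<bar>A \<omega>\<bar> * \<bar>G (enn2real (clk_at \<omega> (fst \<omega> m)) - r) - semigroup f s (Some x)\<bar>"
      by (simp add: \<Phi>_def abs_mult split: split_indicator)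
    also have "\<dots> \<le> a * (C + C)"
      using order_trans[OF abs_triangle_ineq4 add_mono[OF G_bdd semigroup_bdd]]
      by (intro mult_mono A_bdd abs_ge_zero order_trans[OF abs_ge_zero A_bdd[of \<omega>]]) blast
    finally show ?thesis .
  qed
  have "(\<integral>\<omega>. indicator {\<omega>. sojourn_at \<omega> r m} \<omega> * (A \<omega> * (forecast_after \<omega> - semigroup f s (Some (fst m)))) \<partial>P) = (\<integral>\<omega>. \<Phi> \<omega> \<partial>P)"
  proof (rule integral_cong_AE)
    have [measurable]: "forecast_after \<in> borel_measurable P" by (intro forecast_measurable clk_after_measurable)
    show "(\<lambda>\<omega>. indicator {\<omega>. sojourn_at \<omega> r m} \<omega> * (A \<omega> * (forecast_after \<omega> - semigroup f s (Some (fst m))))) \<in> borel_measurable P"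
      by measurable
    show "AE \<omega> in P. indicator {\<omega>. sojourn_at \<omega> r m} \<omega> * (A \<omega> * (forecast_after \<omega> - semigroup f s (Some (fst m)))) = \<Phi> \<omega>"
      using AE_good
    proof eventually_elim
      case (elim \<omega>)
      show ?case
      proof (cases "sojourn_at \<omega> r m")
        case True
        have inj: "inj (fst \<omega>)" and fin: "clk_at \<omega> (fst \<omega> m) < \<infinity>" using elim by (auto simp: good_def)
        have V: "clk_after r (fst \<omega>) (snd \<omega>) = clk_at \<omega> (fst \<omega> m)"
          using occupied_eq_Some_iff[OF inj, of r "snd \<omega>" m] True by (simp add: clk_after_def)
        have iff: "ennreal (r + s) < clk_at \<omega> (fst \<omega> m) \<longleftrightarrow> s < enn2real (clk_at \<omega> (fst \<omega> m)) - r"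
          using fin r s by (cases "clk_at \<omega> (fst \<omega> m)") (auto simp: ennreal_less_iff simp del: ennreal_plus)
        have "state_at (r + s) \<omega> = Some x" if "ennreal (r + s) < clk_at \<omega> (fst \<omega> m)"
          unfolding x_def
        proof (rule state_sojourn[OF inj])
          have "clk_pre_at \<omega> (fst \<omega> m) \<le> ennreal r" using True by (simp add: sojourn_def)
          also have "\<dots> \<le> ennreal (r + s)" using s by (intro ennreal_leI) simp
          finally show "sojourn_at \<omega> (r + s) m" using that by (simp add: sojourn_def)
        qed
        then have "forecast_after \<omega> = G (enn2real (clk_at \<omega> (fst \<omega> m)) - r)"
          unfolding forecast_def V G_def iff by (simp add: algebra_simps)
        then show ?thesis by (simp add: \<Phi>_def x_def)
      qed (simp add: \<Phi>_def)
    qed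
  qed measurable
  also have "(\<integral>\<omega>. \<Phi> \<omega> \<partial>P) = (\<integral>\<omega>. \<Phi> \<omega> \<partial>distr (P \<Otimes>\<^sub>M EXP) P (\<lambda>(\<omega>, v). (fst \<omega>, (snd \<omega>)(Some m := v))))"
    by (simp add: resample_P)
  also have "\<dots> = (\<integral>z. \<Phi> (fst (fst z), (snd (fst z))(Some m := snd z)) \<partial>(P \<Otimes>\<^sub>M EXP))"
    by (subst integral_distr) (auto simp: split_beta)
  also have "\<dots> = (\<integral>\<omega>. \<integral>v. \<Phi> (fst \<omega>, (snd \<omega>)(Some m := v)) \<partial>EXP \<partial>P)"
  proof -
    have "integrable (P \<Otimes>\<^sub>M EXP) (\<lambda>z. \<Phi> (fst (fst z), (snd (fst z))(Some m := snd z)))"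
      using bdd by (intro PE.integrable_const_bound[where B = "a * (C + C)"]) auto
    from PE.integral_fst'[OF this] show ?thesis by simp
  qed
  also have "\<dots> = (\<integral>\<omega>. 0 \<partial>P)"
  proof (rule integral_cong_AE)
    show "(\<lambda>\<omega>. \<integral>v. \<Phi> (fst \<omega>, (snd \<omega>)(Some m := v)) \<partial>EXP) \<in> borel_measurable P" by measurable
    show "AE \<omega> in P. (\<integral>v. \<Phi> (fst \<omega>, (snd \<omega>)(Some m := v)) \<partial>EXP) = 0"
      using AE_P_inj
    proof eventually_elim
      case (elim \<omega>)
      obtain p w where \<omega>: "\<omega> = (p, w)" by (cases \<omega>)
      have inj: "inj p" using elim by (simp add: \<omega>)
      let ?w = "\<lambda>v. w(Some m := v)"
      have pre: "clk_pre p (?w v) (p m) = clk_pre p w (p m)" for v by (rule clk_pre_fun_upd[OF inj])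
      show ?case
      proof (cases "clk_pre p w (p m) \<le> ennreal r")
        case False
        then have "\<not> sojourn p (?w v) r m" for v by (simp add: sojourn_def pre)
        then show ?thesis by (simp add: \<Phi>_def \<omega>)
      next
        case True
        then obtain \<beta> where \<beta>: "clk_pre p w (p m) = ennreal \<beta>" "0 \<le> \<beta>" "\<beta> \<le> r"
          using r by (cases "clk_pre p w (p m)") (auto simp: top_unique)
        have at: "clk p (?w v) (p m) = ennreal (\<beta> + \<gamma> x * v)" if "0 \<le> v" for v
          using that \<beta>(2) \<gamma>_pos[of x] by (simp add: clk_at_mark[OF inj] pre \<beta>(1) jump_def x_def)
        have soj: "sojourn p (?w v) r m \<longleftrightarrow> r - \<beta> < \<gamma> x * v" if "0 \<le> v" for v
        proof -
          have "sojourn p (?w v) r m \<longleftrightarrow> ennreal r < ennreal (\<beta> + \<gamma> x * v)"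
            using True by (simp only: sojourn_def pre at[OF that]) simp
          then show ?thesis using r by (auto simp: ennreal_less_iff simp del: ennreal_plus)
        qed
        (* Some value for which the clock still runs at time r. All such values give the same path
           up to time r, hence the same value A0 of the past functional. *)
        define v0 where "v0 = (r - \<beta> + 1) / \<gamma> x"
        have v0: "0 \<le> v0" "r - \<beta> < \<gamma> x * v0" using \<beta>(3) \<gamma>_pos[of x] by (auto simp: v0_def)
        define A0 where "A0 = A (p, ?w v0)"
        have "(\<integral>v. \<Phi> (fst \<omega>, (snd \<omega>)(Some m := v)) \<partial>EXP) =
          (\<integral>v. A0 * (indicator {v. r - \<beta> < \<gamma> x * v} v * (G (\<gamma> x * v - (r - \<beta>)) - semigroup f s (Some x))) \<partial>EXP)"
        proof (rule integral_cong_AE)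
          show "(\<lambda>v. \<Phi> (fst \<omega>, (snd \<omega>)(Some m := v))) \<in> borel_measurable EXP"
          proof -
            have "\<omega> \<in> space P" by (simp add: space_P)
            from measurable_compose[OF measurable_Pair1'[OF this], of "\<lambda>z. \<Phi> (fst (fst z), (snd (fst z))(Some m := snd z))"]
            show ?thesis by simp
          qed
          show "AE v in EXP. \<Phi> (fst \<omega>, (snd \<omega>)(Some m := v)) =
              A0 * (indicator {v. r - \<beta> < \<gamma> x * v} v * (G (\<gamma> x * v - (r - \<beta>)) - semigroup f s (Some x)))"
            using EXP_nonneg
          proof eventually_elim
            case (elim v)
            show ?case
            proof (cases "r - \<beta> < \<gamma> x * v")
              case True
              then have soj_v: "sojourn p (?w v) r m" by (simp add: soj elim)
              have soj_v0: "sojourn p (?w v0) r m" using v0 by (simp add: soj)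
              have "A (p, ?w v) = A0"
                unfolding A0_def by (rule A_past) (simp add: state_fun_upd[OF inj _ soj_v soj_v0])
              moreover have clk_v: "enn2real (clk p (?w v) (p m)) - r = \<gamma> x * v - (r - \<beta>)"
                using elim \<beta>(2) \<gamma>_pos[of x] by (simp add: at del: ennreal_plus)
              ultimately show ?thesis
                unfolding \<Phi>_def \<omega> fst_conv snd_conv clk_v using True soj_v by simp
            next
              case False
              then show ?thesis using soj[OF elim] by (simp add: \<Phi>_def \<omega>)
            qed
          qed
        qed measurable
        also have "\<dots> = A0 * (\<integral>v. indicator {v. r - \<beta> < \<gamma> x * v} v * (G (\<gamma> x * v - (r - \<beta>)) - semigroup f s (Some x)) \<partial>EXP)"
          by simp
        also have "\<dots> = 0"
          unfolding semigroup_G using \<beta>(3) by (subst EXP_memoryless_diff[OF _ G_bdd \<gamma>_pos]) auto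
        finally show ?thesis .
      qed
    qed
  qed simp
  finally show ?thesis by simp
qed

text \<open>
  Split according to the mark that occupies the time \<open>r\<close>. If there is none, the process is at
  \<open>\<infinity>\<close> and the restart time is \<open>r\<close> itself.
\<close>
theorem markov_property:
  "(\<integral>\<omega>. A \<omega> * f (state_at (r + s) \<omega>) \<partial>P) = (\<integral>\<omega>. A \<omega> * semigroup f s (state_at r \<omega>) \<partial>P)"
  unfolding regeneration_after_residual
proof (rule integral_eq_by_partition)
  define D where "D y = {\<omega> \<in> space P. occupied r (fst \<omega>) (snd \<omega>) = y}" for y
  show D: "D y \<in> sets P" for y unfolding D_def by measurable
  show "AE \<omega> in P. \<exists>!y. \<omega> \<in> D y" by (auto simp: D_def)
  show int1: "integrable P (\<lambda>\<omega>. A \<omega> * forecast_after \<omega>)"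
    by (intro integrable_A_times forecast_bdd forecast_measurable clk_after_measurable)
  show int2: "integrable P (\<lambda>\<omega>. A \<omega> * semigroup f s (state_at r \<omega>))"
    by (intro integrable_A_times semigroup_bdd) measurable
  fix y
  show "(\<integral>\<omega>. indicator (D y) \<omega> * (A \<omega> * forecast_after \<omega>) \<partial>P) =
    (\<integral>\<omega>. indicator (D y) \<omega> * (A \<omega> * semigroup f s (state_at r \<omega>)) \<partial>P)"
  proof (cases y)
    case None
    show ?thesis
    proof (rule integral_cong_AE)
      show "AE \<omega> in P. indicator (D y) \<omega> * (A \<omega> * forecast_after \<omega>) = indicator (D y) \<omega> * (A \<omega> * semigroup f s (state_at r \<omega>))"
        using AE_P_inj
      proof eventually_elim
        case (elim \<omega>)
        show ?case
        proof (cases "occupied r (fst \<omega>) (snd \<omega>) = None")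
          case True
          then have "\<not> sojourn_at \<omega> r m" for m
            using occupied_eq_None_iff[OF elim, of r "snd \<omega>"] by blast
          then have "state_at r \<omega> = None" by (rule state_None)
          moreover have "clk_after r (fst \<omega>) (snd \<omega>) = ennreal r" using True by (simp add: clk_after_def)
          ultimately show ?thesis using r s by (simp add: forecast_def semigroup_def ennreal_less_iff)
        qed (simp add: D_def None)
      qed
    qed (use D int1 int2 in auto)
  next
    case (Some m)
    have ind: "integrable P (\<lambda>\<omega>. indicator (D y) \<omega> * g \<omega>)" if "integrable P g" for g :: "_ \<Rightarrow> real"
      using integrable_mult_indicator[OF D that] by simp
    have "(\<integral>\<omega>. indicator (D y) \<omega> * (A \<omega> * forecast_after \<omega>) \<partial>P) - (\<integral>\<omega>. indicator (D y) \<omega> * (A \<omega> * semigroup f s (state_at r \<omega>)) \<partial>P)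
      = (\<integral>\<omega>. indicator (D y) \<omega> * (A \<omega> * forecast_after \<omega>) - indicator (D y) \<omega> * (A \<omega> * semigroup f s (state_at r \<omega>)) \<partial>P)"
      by (intro Bochner_Integration.integral_diff[symmetric] ind int1 int2)
    also have "\<dots> = (\<integral>\<omega>. indicator {\<omega>. sojourn_at \<omega> r m} \<omega> * (A \<omega> * (forecast_after \<omega> - semigroup f s (Some (fst m)))) \<partial>P)"
    proof (rule integral_cong_AE)
      show "AE \<omega> in P. indicator (D y) \<omega> * (A \<omega> * forecast_after \<omega>) - indicator (D y) \<omega> * (A \<omega> * semigroup f s (state_at r \<omega>)) =
        indicator {\<omega>. sojourn_at \<omega> r m} \<omega> * (A \<omega> * (forecast_after \<omega> - semigroup f s (Some (fst m))))"
        using AE_P_inj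
      proof eventually_elim
        case (elim \<omega>)
        have "\<omega> \<in> D y \<longleftrightarrow> sojourn_at \<omega> r m"
          by (simp add: D_def Some space_P occupied_eq_Some_iff[OF elim])
        then show ?case using state_sojourn[OF elim, of "snd \<omega>" r m]
          by (simp add: indicator_def right_diff_distrib)
      qed
      have [measurable]: "forecast_after \<in> borel_measurable P" by (intro forecast_measurable clk_after_measurable)
      show "(\<lambda>\<omega>. indicator {\<omega>. sojourn_at \<omega> r m} \<omega> * (A \<omega> * (forecast_after \<omega> - semigroup f s (Some (fst m))))) \<in> borel_measurable P"
        by measurable
    qed (use ind[OF int1] ind[OF int2] in auto)
    also have "\<dots> = 0" by (rule residual_memoryless)
    finally show ?thesis by simp
  qed
qed

end
end
end

context K_params begin

lemma ext_gamma_nonneg: "0 \<le> ext_gamma \<gamma> y"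
  using \<gamma>_pos by (auto simp: ext_gamma_def less_imp_le split: option.split)

lemma state_upd_None: "state q p (w(None := v)) = state q p w"
  by (simp add: state_def sojourn_def clk_def clk_pre_def mass_def jump_def)

section \<open>Arbitrary initial states\<close>

text \<open>
  The K process with initial state \<open>y\<close> whose initial clock has the value \<open>v\<close>. Keeping \<open>v\<close> apart
  from the configuration allows the initial clock to be integrated out.
\<close>

definition delayed_state :: "'s option \<Rightarrow> real \<Rightarrow> real \<Rightarrow> 's marks \<times> 's clocks \<Rightarrow> 's option" where
  "delayed_state y t v \<omega> = (if t < ext_gamma \<gamma> y * v then y else state_at (t - ext_gamma \<gamma> y * v) \<omega>)"

end

context K_law begin

lemma measurable_delayed_state [measurable (raw)]:
  assumes [measurable]: "v \<in> borel_measurable M" "\<omega> \<in> measurable M P"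
  shows "(\<lambda>x. delayed_state y t (v x) (\<omega> x)) \<in> measurable M (count_space UNIV)"
proof -
  have [measurable]: "(\<lambda>x. fst (\<omega> x)) \<in> measurable M POS"
    using measurable_compose[OF assms(2) measurable_fst] by (simp only: measurable_cong_sets[OF refl sets_PN])
  have [measurable]: "(\<lambda>x. snd (\<omega> x)) \<in> measurable M REALS"
    using measurable_compose[OF assms(2) measurable_snd] by (simp only: measurable_cong_sets[OF refl sets_CLOCKS])
  show ?thesis unfolding delayed_state_def by measurable
qed

lemma measurable_delayed_state_fun [measurable (raw)]:
  fixes g :: "'s option \<Rightarrow> real"
  assumes [measurable]: "v \<in> borel_measurable M" "\<omega> \<in> measurable M P"
  shows "(\<lambda>x. g (delayed_state y t (v x) (\<omega> x))) \<in> borel_measurable M"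
  by (rule measurable_compose[OF measurable_delayed_state]) (use assms in auto)

lemma integral_initial_clock:
  fixes g :: "real \<Rightarrow> _ \<Rightarrow> real"
  assumes g [measurable]: "(\<lambda>(v, \<omega>). g v \<omega>) \<in> borel_measurable (borel \<Otimes>\<^sub>M P)"
    and bdd: "\<And>v \<omega>. \<bar>g v \<omega>\<bar> \<le> B" and upd: "\<And>v p w v'. g v (p, w(None := v')) = g v (p, w)"
  shows "integrable EXP (\<lambda>v. \<integral>\<omega>. g v \<omega> \<partial>P)"
    and "(\<integral>\<omega>. g (snd \<omega> None) \<omega> \<partial>P) = (\<integral>v. (\<integral>\<omega>. g v \<omega> \<partial>P) \<partial>EXP)"
proof -
  have gm [measurable (raw)]: "(\<lambda>x. g (a x) (b x)) \<in> borel_measurable N"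
    if "a \<in> borel_measurable N" "b \<in> measurable N P" for a b and N :: "'x measure"
    using measurable_compose[OF measurable_Pair[OF that] g] by simp
  have int: "integrable (P \<Otimes>\<^sub>M EXP) (\<lambda>(\<omega>, v). g v \<omega>)"
    using bdd by (intro PE.integrable_const_bound[where B = B]) (auto simp: split_beta)
  show "integrable EXP (\<lambda>v. \<integral>\<omega>. g v \<omega> \<partial>P)"
    using PE.integrable_snd[OF int] .
  have "(\<integral>\<omega>. g (snd \<omega> None) \<omega> \<partial>P) = (\<integral>\<omega>. g (snd \<omega> None) \<omega> \<partial>distr (P \<Otimes>\<^sub>M EXP) P (\<lambda>(\<omega>, v). (fst \<omega>, (snd \<omega>)(None := v))))"
    by (simp add: resample_P)
  also have "\<dots> = (\<integral>z. g (snd z) (fst (fst z), (snd (fst z))(None := snd z)) \<partial>(P \<Otimes>\<^sub>M EXP))"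
    by (subst integral_distr) (auto simp: split_beta)
  also have "\<dots> = (\<integral>(\<omega>, v). g v \<omega> \<partial>(P \<Otimes>\<^sub>M EXP))"
    by (simp add: upd case_prod_unfold)
  also have "\<dots> = (\<integral>v. (\<integral>\<omega>. g v \<omega> \<partial>P) \<partial>EXP)"
    by (rule PE.integral_snd[OF int, symmetric])
  finally show "(\<integral>\<omega>. g (snd \<omega> None) \<omega> \<partial>P) = (\<integral>v. (\<integral>\<omega>. g v \<omega> \<partial>P) \<partial>EXP)" .
qed

lemma delayed_state_upd_None: "delayed_state y t v (p, w(None := v')) = delayed_state y t v (p, w)"
  by (simp add: delayed_state_def state_upd_None)

lemma semigroup_eq:
  assumes bdd: "\<And>y. \<bar>f y\<bar> \<le> C" and s: "0 \<le> s"
  shows "semigroup f s y = (\<integral>\<omega>. f (delayed_state y s (snd \<omega> None) \<omega>) \<partial>P)"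
proof -
  have "(\<integral>\<omega>. f (delayed_state y s (snd \<omega> None) \<omega>) \<partial>P) = (\<integral>v. (\<integral>\<omega>. f (delayed_state y s v \<omega>) \<partial>P) \<partial>EXP)"
    by (rule integral_initial_clock(2)[where B = C]) (auto simp: bdd delayed_state_upd_None split_beta)
  also have "\<dots> = (\<integral>v. (if s < ext_gamma \<gamma> y * v then f y else mean_from_infinity f (s - ext_gamma \<gamma> y * v)) \<partial>EXP)"
    using PC.prob_space by (intro Bochner_Integration.integral_cong) (auto simp: delayed_state_def mean_from_infinity_def)
  also have "\<dots> = semigroup f s y"
  proof (cases y)
    case None
    show ?thesis unfolding None using s EXP.prob_space by (simp add: semigroup_def ext_gamma_def)
  next
    case (Some x)
    show ?thesis unfolding Some semigroup_def ext_gamma_def option.case by (rule refl)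
  qed
  finally show ?thesis ..
qed

text \<open>
  Fix the value \<open>v\<close> of the initial clock. If the initial sojourn ends by time \<open>t m\<close>, the claim is
  the Markov property from \<open>\<infinity>\<close> with all times shifted. The other values of \<open>v\<close> contribute
  the same to both sides by memorylessness of the initial clock.
\<close>
theorem delayed_markov:
  fixes f :: "nat \<Rightarrow> 's option \<Rightarrow> real" and t :: "nat \<Rightarrow> real"
  assumes m: "1 \<le> m" and t1: "0 \<le> t 1" and t: "\<And>i. i \<in> {1..m} \<Longrightarrow> t i < t (Suc i)"
    and bdd: "\<And>i y. i \<in> {1..Suc m} \<Longrightarrow> \<bar>f i y\<bar> \<le> C"
    and cont: "\<And>e. 0 < e \<Longrightarrow> \<exists>d>0. \<forall>x. \<gamma> x < d \<longrightarrow> \<bar>f (Suc m) (Some x) - f (Suc m) None\<bar> < e"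
  shows "(\<integral>\<omega>. (\<Prod>i=1..m. f i (delayed_state y (t i) (snd \<omega> None) \<omega>)) * f (Suc m) (delayed_state y (t (Suc m)) (snd \<omega> None) \<omega>) \<partial>P) =
    (\<integral>\<omega>. (\<Prod>i=1..m. f i (delayed_state y (t i) (snd \<omega> None) \<omega>)) * semigroup (f (Suc m)) (t (Suc m) - t m) (delayed_state y (t m) (snd \<omega> None) \<omega>) \<partial>P)"
proof -
  define s where "s = t (Suc m) - t m"
  define F where "F = f (Suc m)"
  define e where "e = ext_gamma \<gamma> y"
  have s: "0 < s" using t[of m] m by (simp add: s_def)
  have tm: "t i \<le> t m" if "i \<in> {1..m}" for i
  proof -
    have "t i \<le> t j" if "i \<le> j" "j \<le> m" for j
      using that
    proof (induction j rule: dec_induct)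
      case (step n)
      then show ?case using t[of n] \<open>i \<in> {1..m}\<close> by simp
    qed simp
    then show ?thesis using that by simp
  qed
  have tm0: "0 \<le> t m" using tm[of 1] t1 m by simp
  have F_bdd: "\<bar>F y\<bar> \<le> C" for y using bdd[of "Suc m"] by (simp add: F_def)
  have F_cont: "\<exists>d>0. \<forall>x. \<gamma> x < d \<longrightarrow> \<bar>F (Some x) - F None\<bar> < e" if "0 < e" for e
    unfolding F_def by (rule cont[OF that])
  have semigroup_bdd: "\<bar>semigroup F s y\<bar> \<le> C" for y by (rule semigroup_bdd[OF F_bdd F_cont])
  define A where "A v \<omega> = (\<Prod>i=1..m. f i (delayed_state y (t i) v \<omega>))" for v \<omega>
  have A_meas [measurable (raw)]: "(\<lambda>x. A (a x) (b x)) \<in> borel_measurable N"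
    if [measurable]: "a \<in> borel_measurable N" "b \<in> measurable N P" for a b and N :: "'x measure"
    unfolding A_def by measurable
  have A_bdd: "\<bar>A v \<omega>\<bar> \<le> C ^ m" for v \<omega>
  proof -
    have "\<bar>A v \<omega>\<bar> \<le> (\<Prod>i=1..m. C)"
      unfolding A_def abs_prod by (intro prod_mono conjI abs_ge_zero bdd) simp
    then show ?thesis by simp
  qed
  have A_upd: "A v (p, w(None := v')) = A v (p, w)" for v p w v'
    by (simp add: A_def delayed_state_upd_None)
  define g where "g v \<omega> = A v \<omega> * F (delayed_state y (t (Suc m)) v \<omega>)" for v \<omega>
  define h where "h v \<omega> = A v \<omega> * semigroup F s (delayed_state y (t m) v \<omega>)" for v \<omega>
  have gh_bdd: "\<bar>g v \<omega>\<bar> \<le> C ^ m * C" "\<bar>h v \<omega>\<bar> \<le> C ^ m * C" for v \<omega>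
    unfolding g_def h_def abs_mult
    by (intro mult_mono A_bdd F_bdd semigroup_bdd abs_ge_zero order_trans[OF abs_ge_zero A_bdd[of v \<omega>]])+
  have gh_meas: "(\<lambda>(v, \<omega>). g v \<omega>) \<in> borel_measurable (borel \<Otimes>\<^sub>M P)" "(\<lambda>(v, \<omega>). h v \<omega>) \<in> borel_measurable (borel \<Otimes>\<^sub>M P)"
    unfolding g_def h_def by measurable
  have gh_upd: "g v (p, w(None := v')) = g v (p, w)" "h v (p, w(None := v')) = h v (p, w)" for v p w v'
    by (simp_all add: g_def h_def A_upd delayed_state_upd_None)
  note g = integral_initial_clock[of g, OF gh_meas(1) gh_bdd(1) gh_upd(1)]
  note h = integral_initial_clock[of h, OF gh_meas(2) gh_bdd(2) gh_upd(2)]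
  define C0 where "C0 = (\<Prod>i=1..m. f i y)"
  define G where "G \<rho> = (if s < \<rho> then F y else mean_from_infinity F (s - \<rho>))" for \<rho>
  have [measurable]: "G \<in> borel_measurable borel" unfolding G_def[abs_def] by measurable
  have G_bdd: "\<bar>G \<rho>\<bar> \<le> C" for \<rho> by (simp add: G_def F_bdd mean_from_infinity_bdd[OF F_bdd F_cont])
  (* The initial sojourn is over at time t m. *)
  have late: "(\<integral>\<omega>. g v \<omega> \<partial>P) = (\<integral>\<omega>. h v \<omega> \<partial>P)" if v: "e * v \<le> t m" "0 \<le> v" for v
  proof -
    have "0 \<le> e * v" using v(2) ext_gamma_nonneg by (simp add: e_def)
    have eq: "(t m - e * v) + s = t (Suc m) - e * v" by (simp add: s_def)
    have core: "(\<integral>\<omega>. A v \<omega> * F (state ((t m - e * v) + s) (fst \<omega>) (snd \<omega>)) \<partial>P) =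
      (\<integral>\<omega>. A v \<omega> * semigroup F s (state_at (t m - e * v) \<omega>) \<partial>P)"
    proof (rule markov_property[OF F_bdd F_cont])
      show "A v \<in> borel_measurable P" by measurable
      show "A v \<omega> = A v \<omega>'" if "\<And>q. 0 \<le> q \<Longrightarrow> q \<le> t m - e * v \<Longrightarrow> state_at q \<omega> = state_at q \<omega>'" for \<omega> \<omega>'
        unfolding A_def
      proof (rule prod.cong[OF refl])
        fix i assume "i \<in> {1..m}"
        then have "t i \<le> t m" by (rule tm)
        then show "f i (delayed_state y (t i) v \<omega>) = f i (delayed_state y (t i) v \<omega>')"
          using that[of "t i - e * v"] by (simp add: delayed_state_def e_def)
      qed
    qed (use A_bdd v s in auto)
    have "\<not> t m < e * v" "\<not> t (Suc m) < e * v" using v s by (auto simp: s_def)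
    then show ?thesis using core[unfolded eq] by (simp add: g_def h_def delayed_state_def e_def)
  qed
  (* The initial sojourn is still going on at time t m, so that the past is deterministic. *)
  have early: "(\<integral>\<omega>. g v \<omega> \<partial>P) - (\<integral>\<omega>. h v \<omega> \<partial>P) = C0 * (G (e * v - t m) - semigroup F s y)" if v: "t m < e * v" for v
  proof -
    have "A v \<omega> = C0" for \<omega>
      unfolding A_def C0_def
    proof (rule prod.cong[OF refl])
      fix i assume "i \<in> {1..m}"
      from tm[OF this] show "f i (delayed_state y (t i) v \<omega>) = f i y" using v by (simp add: delayed_state_def e_def)
    qed
    moreover have "(\<integral>\<omega>. F (delayed_state y (t (Suc m)) v \<omega>) \<partial>P) = G (e * v - t m)"
      using PC.prob_space by (auto simp: delayed_state_def e_def G_def mean_from_infinity_def s_def algebra_simps)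
    moreover have "delayed_state y (t m) v \<omega> = y" for \<omega> using v by (simp add: delayed_state_def e_def)
    ultimately show ?thesis using PC.prob_space by (simp add: g_def h_def right_diff_distrib)
  qed
  have "(\<integral>v. (\<integral>\<omega>. g v \<omega> \<partial>P) \<partial>EXP) - (\<integral>v. (\<integral>\<omega>. h v \<omega> \<partial>P) \<partial>EXP) = (\<integral>v. (\<integral>\<omega>. g v \<omega> \<partial>P) - (\<integral>\<omega>. h v \<omega> \<partial>P) \<partial>EXP)"
    by (rule Bochner_Integration.integral_diff[OF g(1) h(1), symmetric])
  also have "\<dots> = (\<integral>v. C0 * (indicator {v. t m < e * v} v * (G (e * v - t m) - semigroup F s y)) \<partial>EXP)"
  proof (rule integral_cong_AE)
    show "(\<lambda>v. (\<integral>\<omega>. g v \<omega> \<partial>P) - (\<integral>\<omega>. h v \<omega> \<partial>P)) \<in> borel_measurable EXP" using g(1) h(1) by auto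
    show "AE v in EXP. (\<integral>\<omega>. g v \<omega> \<partial>P) - (\<integral>\<omega>. h v \<omega> \<partial>P) = C0 * (indicator {v. t m < e * v} v * (G (e * v - t m) - semigroup F s y))"
      using EXP_nonneg
    proof eventually_elim
      case (elim v)
      then show ?case using late[of v] early[of v] by (cases "t m < e * v") auto
    qed
  qed measurable
  also have "\<dots> = 0"
  proof (cases y)
    case None
    then show ?thesis using tm0 by (simp add: e_def ext_gamma_def indicator_def)
  next
    case (Some x)
    have "e = \<gamma> x" by (simp add: Some e_def ext_gamma_def)
    moreover have "semigroup F s y = (\<integral>v. G (\<gamma> x * v) \<partial>EXP)" unfolding G_def semigroup_def Some option.case by (rule refl)
    ultimately show ?thesis using EXP_memoryless_diff[of G C "\<gamma> x" "t m"] G_bdd \<gamma>_pos tm0 by simp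
  qed
  finally have "(\<integral>\<omega>. g (snd \<omega> None) \<omega> \<partial>P) = (\<integral>\<omega>. h (snd \<omega> None) \<omega> \<partial>P)" by (simp add: g(2) h(2))
  then show ?thesis by (simp add: g_def h_def A_def F_def s_def)
qed

end

section \<open>The K process on the given probability space\<close>

lemma infsum_ennreal_eq_nn_integral:
  fixes f :: "'s::countable \<Rightarrow> ennreal"
  assumes "infinite (UNIV :: 's set)"
  shows "(\<Sum>\<^sub>\<infinity>z. f z) = (\<integral>\<^sup>+z. f z \<partial>count_space UNIV)"
proof -
  define b where "b = from_nat_into (UNIV :: 's set)"
  have b: "bij_betw b UNIV UNIV"
    unfolding b_def using assms by (intro bij_betw_from_nat_into) auto
  have "(\<Sum>\<^sub>\<infinity>z. f z) = (\<Sum>\<^sub>\<infinity>n. f (b n))" by (rule infsum_reindex_bij_betw[OF b, symmetric])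
  also have "\<dots> = (\<Sum>n. f (b n))"
    by (intro sums_unique has_sum_imp_sums has_sum_infsum nonneg_summable_on_complete) simp_all
  also have "\<dots> = (\<integral>\<^sup>+n. f (b n) \<partial>count_space UNIV)" by (simp add: nn_integral_count_space_nat)
  also have "\<dots> = (\<integral>\<^sup>+z. f z \<partial>count_space UNIV)" by (rule nn_integral_bij_count_space[OF b])
  finally show ?thesis .
qed

context K_params begin

lemma clk_tendsto_at_left: "(clk p w \<longlongrightarrow> clk_pre p w b) (at_left b)"
  by (rule tendsto_at_left_sequentially[of "b - 1"]) (auto intro: clk_left_limit)

lemma continuous_at_infinity:
  assumes f: "continuous_map (Metric_space.mtopology UNIV (K_dist \<gamma>)) euclideanreal f" and e: "0 < e"
  shows "\<exists>d>0. \<forall>x. \<gamma> x < d \<longrightarrow> \<bar>f (Some x) - f None\<bar> < e"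
proof -
  interpret K: Metric_space UNIV "K_dist \<gamma>" by (rule Metric_space_K_dist) (rule \<gamma>_pos)
  have *: "openin K.mtopology {x \<in> topspace K.mtopology. f x \<in> ball (f None) e}"
    by (rule openin_continuous_map_preimage[OF f]) simp
  then obtain d where d: "0 < d" "K.mball None d \<subseteq> {x. f x \<in> ball (f None) e}"
    using K.openin_mtopology[THEN iffD1, OF *, THEN conjunct2, THEN spec[of _ None]] e by auto
  have "\<bar>f (Some x) - f None\<bar> < e" if "\<gamma> x < d" for x
  proof -
    have "Some x \<in> K.mball None d" using that by (simp add: K.in_mball K_dist_def ext_gamma_def)
    then show ?thesis using d(2) by (auto simp: dist_real_def abs_minus_commute)
  qed
  then show ?thesis using d(1) by blast
qed

end

text \<open>The assumptions on marks and clocks in the construction of the K process.\<close>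
locale K_setup = prob_space M + K_params \<gamma> c
  for M :: "'w measure" and \<gamma> :: "'s::countable \<Rightarrow> real" and c :: real +
  fixes rate :: "'s \<Rightarrow> real" and \<sigma> :: "'s \<Rightarrow> nat \<Rightarrow> 'w \<Rightarrow> real" and T0 :: "'w \<Rightarrow> real" and T :: "'s \<Rightarrow> nat \<Rightarrow> 'w \<Rightarrow> real"
  assumes infinite_sites: "infinite (UNIV :: 's set)"
    and rate_pos: "\<And>x. 0 < rate x"
    and summable: "(\<lambda>x. rate x * \<gamma> x) summable_on UNIV"
    and poisson: "\<And>x. poisson_process M (rate x) (\<sigma> x)"
    and marks_indep: "indep_vars (\<lambda>_. \<Pi>\<^sub>M s\<in>{0..}. count_space UNIV) (\<lambda>x \<omega>. \<lambda>s\<in>{0..}. num_marks (\<sigma> x) s \<omega>) UNIV"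
    and clocks_exp: "\<And>j. j \<in> clock_index \<Longrightarrow> distributed M lborel (clock_family T0 T j) (exponential_density 1)"
    and clocks_indep: "indep_vars (\<lambda>_. borel) (clock_family T0 T) clock_index"
    and marks_clocks_indep: "indep_set
           (sets (vimage_algebra (space M) (\<lambda>\<omega> x. \<lambda>s\<in>{0..}. num_marks (\<sigma> x) s \<omega>) (\<Pi>\<^sub>M x\<in>UNIV. \<Pi>\<^sub>M s\<in>{0..}. count_space UNIV)))
           (sets (vimage_algebra (space M) (\<lambda>\<omega>. \<lambda>j\<in>clock_index. clock_family T0 T j \<omega>) (\<Pi>\<^sub>M j\<in>clock_index. borel)))"
begin

definition pos :: "'w \<Rightarrow> 's \<times> nat \<Rightarrow> real" where
  "pos \<omega> m = \<sigma> (fst m) (Suc (snd m)) \<omega>"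

definition clks :: "'w \<Rightarrow> ('s \<times> nat) option \<Rightarrow> real" where
  "clks \<omega> j = clock_family T0 T (map_option (\<lambda>(x, i). (x, Suc i)) j) \<omega>"

definition PN :: "'s marks measure" where "PN = distr M POS pos"

lemma \<sigma>_props:
  shows \<sigma>_meas: "1 \<le> i \<Longrightarrow> \<sigma> x i \<in> borel_measurable M"
    and \<sigma>_path: "\<omega> \<in> space M \<Longrightarrow> 0 < \<sigma> x 1 \<omega> \<and> (\<forall>i\<ge>1. \<sigma> x i \<omega> < \<sigma> x (Suc i) \<omega>) \<and> (\<forall>t. finite {i. 1 \<le> i \<and> \<sigma> x i \<omega> \<le> t})"
    and \<sigma>_law: "0 \<le> s \<Longrightarrow> s < t \<Longrightarrow> distr M (count_space UNIV) (\<lambda>\<omega>. num_marks (\<sigma> x) t \<omega> - num_marks (\<sigma> x) s \<omega>) = measure_pmf (poisson_pmf (rate x * (t - s)))"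
    and \<sigma>_indep: "0 \<le> u 0 \<Longrightarrow> (\<And>k. k < n \<Longrightarrow> u k < u (Suc k)) \<Longrightarrow>
      indep_vars (\<lambda>_. count_space UNIV) (\<lambda>k \<omega>. num_marks (\<sigma> x) (u (Suc k)) \<omega> - num_marks (\<sigma> x) (u k) \<omega>) {..<n}"
  using poisson[of x] unfolding poisson_process_def by blast+

lemma regular_pos_path:
  assumes \<omega>: "\<omega> \<in> space M" shows "regular (pos \<omega>)"
  unfolding regular_def
proof (intro allI conjI)
  fix x
  show "0 < pos \<omega> (x, 0)" using \<sigma>_path[OF \<omega>, of x] by (simp add: pos_def)
  show "pos \<omega> (x, i) < pos \<omega> (x, Suc i)" for i using \<sigma>_path[OF \<omega>, of x] by (simp add: pos_def)
  show "\<exists>i. real k < pos \<omega> (x, i)" for k :: nat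
  proof (rule ccontr)
    assume "\<nexists>i. real k < pos \<omega> (x, i)"
    then have "range Suc \<subseteq> {i. 1 \<le> i \<and> \<sigma> x i \<omega> \<le> real k}" by (auto simp: pos_def not_less)
    then have "finite (range Suc)" using \<sigma>_path[OF \<omega>, of x] finite_subset by blast
    then show False using finite_imageD[of Suc UNIV] by simp
  qed
qed

lemma num_marks_eq_cnt:
  assumes \<omega>: "\<omega> \<in> space M" shows "num_marks (\<sigma> x) t \<omega> = cnt (pos \<omega>) x t"
proof -
  have pos0: "0 < \<sigma> x (Suc i) \<omega>" for i
    using regular_pos[OF regular_pos_path[OF \<omega>], of "(x, i)"] by (simp add: pos_def)
  have "{i. 1 \<le> i \<and> \<sigma> x i \<omega> \<in> {0..t}} = Suc ` {i. pos \<omega> (x, i) \<le> t}"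
  proof (rule set_eqI)
    fix i show "i \<in> {i. 1 \<le> i \<and> \<sigma> x i \<omega> \<in> {0..t}} \<longleftrightarrow> i \<in> Suc ` {i. pos \<omega> (x, i) \<le> t}"
      using pos0 by (cases i) (auto simp: pos_def less_imp_le)
  qed
  then show ?thesis by (simp add: num_marks_def cnt_def card_image)
qed

lemma pos_measurable [measurable]: "pos \<in> measurable M POS"
  unfolding pos_def by (intro measurable_PiM_single') (auto simp: space_PiM \<sigma>_meas)

text \<open>
  Independence over sites and over cells combine to joint independence: the event on
  finitely many cells of one site is an event for the counting process of that site.
\<close>
lemma indep_increments:
  assumes h: "0 < h"
  shows "indep_vars (\<lambda>_. count_space UNIV) (\<lambda>m \<omega>. incr h (pos \<omega>) m) UNIV"
  unfolding indep_vars_def2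
proof (intro conjI ballI indep_setsI)
  fix m show meas: "(\<lambda>\<omega>. incr h (pos \<omega>) m) \<in> measurable M (count_space UNIV)" by measurable
  then show "{(\<lambda>\<omega>. incr h (pos \<omega>) m) -` A \<inter> space M |A. A \<in> sets (count_space UNIV)} \<subseteq> events"
    by (auto intro: measurable_sets)
next
  fix A and J :: "('s \<times> nat) set"
  assume J: "J \<noteq> {}" "finite J" and A: "\<forall>m\<in>J. A m \<in> {(\<lambda>\<omega>. incr h (pos \<omega>) m) -` B \<inter> space M |B. B \<in> sets (count_space UNIV)}"
  then obtain B where B: "\<And>m. m \<in> J \<Longrightarrow> A m = (\<lambda>\<omega>. incr h (pos \<omega>) m) -` B m \<inter> space M" by simp metis
  define X where "X x k \<omega> = num_marks (\<sigma> x) (real (Suc k) * h) \<omega> - num_marks (\<sigma> x) (real k * h) \<omega>" for x k \<omega>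
  have A_X: "A (x, k) = X x k -` B (x, k) \<inter> space M" if "(x, k) \<in> J" for x k
    unfolding B[OF that] X_def by (auto simp: num_marks_eq_cnt incr_def)
  define F where "F = fst ` J"
  define K where "K x = {k. (x, k) \<in> J}" for x
  have F: "finite F" "F \<noteq> {}" using J by (auto simp: F_def)
  have K: "finite (K x)" for x
    using finite_vimageI[OF J(2), of "Pair x"] by (simp add: K_def vimage_def inj_on_def)
  have K0: "K x \<noteq> {}" if "x \<in> F" for x using that by (auto simp: K_def F_def)
  have J_eq: "J = Sigma F K" by (force simp: F_def K_def)
  have prob_K: "prob (\<Inter>k\<in>K x. A (x, k)) = (\<Prod>k\<in>K x. prob (A (x, k)))" if x: "x \<in> F" for x
  proof -
    obtain n where n: "K x \<subseteq> {..<n}" using K[of x] by (meson finite_nat_iff_bounded)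
    have "indep_vars (\<lambda>_. count_space UNIV) (X x) {..<n}"
      unfolding X_def[abs_def] by (rule \<sigma>_indep[of "\<lambda>k. real k * h"]) (use h in auto)
    from indep_varsD[OF this K0[OF x] K n, of "\<lambda>k. B (x, k)"]
    have "prob (\<Inter>k\<in>K x. X x k -` B (x, k) \<inter> space M) = (\<Prod>k\<in>K x. prob (X x k -` B (x, k) \<inter> space M))" by simp
    moreover have "(\<Inter>k\<in>K x. A (x, k)) = (\<Inter>k\<in>K x. X x k -` B (x, k) \<inter> space M)"
      by (intro INF_cong refl A_X) (simp add: K_def)
    moreover have "(\<Prod>k\<in>K x. prob (A (x, k))) = (\<Prod>k\<in>K x. prob (X x k -` B (x, k) \<inter> space M))"
      by (intro prod.cong refl arg_cong[where f = prob] A_X) (simp add: K_def)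
    ultimately show ?thesis by simp
  qed
  define Y where "Y x \<omega> = (\<lambda>s\<in>{0..}. num_marks (\<sigma> x) s \<omega>)" for x \<omega>
  define C where "C x = {y \<in> space (\<Pi>\<^sub>M s\<in>{0..}. count_space UNIV). \<forall>k\<in>K x. y (real (Suc k) * h) - y (real k * h) \<in> B (x, k)}" for x
  have C: "C x \<in> sets (\<Pi>\<^sub>M s\<in>{0::real..}. count_space (UNIV :: nat set))" for x
  proof -
    have [measurable]: "(\<lambda>y. y (real k * h)) \<in> measurable (\<Pi>\<^sub>M s\<in>{0::real..}. count_space (UNIV :: nat set)) (count_space UNIV)" for k
      using h by (intro measurable_component_singleton) simp
    show ?thesis unfolding C_def using K[of x] by measurable
  qed
  have YC: "Y x -` C x \<inter> space M = (\<Inter>k\<in>K x. A (x, k))" if x: "x \<in> F" for x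
  proof -
    have "A (x, k) = {\<omega> \<in> space M. Y x \<omega> (real (Suc k) * h) - Y x \<omega> (real k * h) \<in> B (x, k)}" if "k \<in> K x" for k
      using that h A_X[of x k] by (auto simp: K_def X_def Y_def)
    then show ?thesis using K0[OF x] by (auto simp: C_def Y_def space_PiM)
  qed
  have "(\<Inter>m\<in>J. A m) = (\<Inter>x\<in>F. Y x -` C x \<inter> space M)"
    using YC F by (auto simp: J_eq)
  then have "prob (\<Inter>m\<in>J. A m) = prob (\<Inter>x\<in>F. Y x -` C x \<inter> space M)" by simp
  also have "\<dots> = (\<Prod>x\<in>F. prob (Y x -` C x \<inter> space M))"
    by (rule indep_varsD[OF marks_indep[folded Y_def[abs_def]] F(2,1)]) (simp_all add: C)
  also have "\<dots> = (\<Prod>x\<in>F. \<Prod>k\<in>K x. prob (A (x, k)))"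
    by (intro prod.cong refl) (simp add: YC prob_K)
  also have "\<dots> = (\<Prod>m\<in>J. prob (A m))"
    unfolding J_eq using F K by (simp add: prod.Sigma)
  finally show "prob (\<Inter>m\<in>J. A m) = (\<Prod>m\<in>J. prob (A m))" .
qed

lemma incr_distr:
  assumes h: "0 < h"
  shows "distr M COUNTS (\<lambda>\<omega>. incr h (pos \<omega>)) = PiM UNIV (\<lambda>m. measure_pmf (poisson_pmf (rate (fst m) * h)))"
proof -
  have "distr M (count_space UNIV) (\<lambda>\<omega>. incr h (pos \<omega>) m) = measure_pmf (poisson_pmf (rate (fst m) * h))" for m
  proof -
    have "distr M (count_space UNIV) (\<lambda>\<omega>. incr h (pos \<omega>) m) =
      distr M (count_space UNIV) (\<lambda>\<omega>. num_marks (\<sigma> (fst m)) (real (Suc (snd m)) * h) \<omega> - num_marks (\<sigma> (fst m)) (real (snd m) * h) \<omega>)"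
      by (intro distr_cong) (simp_all add: incr_def num_marks_eq_cnt)
    also have "\<dots> = measure_pmf (poisson_pmf (rate (fst m) * (real (Suc (snd m)) * h - real (snd m) * h)))"
      using h by (intro \<sigma>_law) auto
    finally show ?thesis by (simp add: algebra_simps)
  qed
  moreover have "distr M COUNTS (\<lambda>\<omega>. \<lambda>m\<in>UNIV. incr h (pos \<omega>) m) = PiM UNIV (\<lambda>m. distr M (count_space UNIV) (\<lambda>\<omega>. incr h (pos \<omega>) m))"
    using indep_increments[OF h] by (subst (asm) indep_vars_iff_distr_eq_PiM) auto
  ultimately show ?thesis by (simp add: restrict_def)
qed

sublocale law: K_law \<gamma> c rate PN
proof (intro K_law.intro K_law_axioms.intro K_params_axioms)
  show "prob_space PN" unfolding PN_def by (rule prob_space_distr) measurable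
  show "sets PN = sets POS" by (simp add: PN_def)
  show "AE p in PN. regular p"
    unfolding PN_def by (subst AE_distr_iff) (auto simp: regular_pos_path)
  show "distr PN COUNTS (incr h) = PiM UNIV (\<lambda>m. measure_pmf (poisson_pmf (rate (fst m) * h)))" if "0 < h" for h
    unfolding PN_def by (subst distr_distr) (simp_all add: incr_distr[OF that] comp_def)
qed (rule rate_pos summable)+

lemma clock_family_meas: "j \<in> clock_index \<Longrightarrow> clock_family T0 T j \<in> borel_measurable M"
  using clocks_indep by (auto simp: indep_vars_def2)

lemma clks_index: "map_option (\<lambda>(x, i). (x, Suc i)) j \<in> clock_index"
  by (cases j) (auto simp: clock_index_def)

lemma clks_measurable [measurable]: "clks \<in> measurable M CLOCKS"
  unfolding clks_def measurable_cong_sets[OF refl sets_CLOCKS]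
  by (intro measurable_PiM_single') (auto simp: space_PiM clock_family_meas clks_index)

lemma clks_distr: "distr M CLOCKS clks = CLOCKS"
proof -
  let ?f = "map_option (\<lambda>(x::'s, i). (x, Suc i))"
  let ?X = "\<lambda>\<omega>. \<lambda>j\<in>clock_index. clock_family T0 T j \<omega>"
  let ?I = "clock_index :: ('s \<times> nat) option set"
  have X: "?X \<in> measurable M (PiM ?I (\<lambda>_. EXP))"
    by (intro measurable_restrict) (simp add: clock_family_meas)
  have EXP_j: "distr M borel (clock_family T0 T j) = EXP" if "j \<in> ?I" for j
  proof -
    have "distr M borel (clock_family T0 T j) = distr M lborel (clock_family T0 T j)" by (intro distr_cong) simp_all
    then show ?thesis using distributed_distr_eq_density[OF clocks_exp[OF that]] by simp
  qed
  have "distr M (PiM ?I (\<lambda>_. borel)) ?X = PiM ?I (\<lambda>j. distr M borel (clock_family T0 T j))"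
    using clocks_indep by (subst (asm) indep_vars_iff_distr_eq_PiM') (auto simp: clock_family_meas clock_index_def)
  also have "\<dots> = PiM ?I (\<lambda>_. EXP)" by (intro PiM_cong refl EXP_j)
  finally have law: "distr M (PiM ?I (\<lambda>_. EXP)) ?X = PiM ?I (\<lambda>_. EXP)"
    by (subst distr_cong[OF refl _ refl, of _ "PiM ?I (\<lambda>_. borel)"]) (auto intro!: sets_PiM_cong)
  have "distr M CLOCKS clks = distr M CLOCKS ((\<lambda>w. \<lambda>j\<in>UNIV. w (?f j)) \<circ> ?X)"
    by (intro distr_cong) (auto simp: clks_def clks_index)
  also have "\<dots> = distr (distr M (PiM ?I (\<lambda>_. EXP)) ?X) CLOCKS (\<lambda>w. \<lambda>j\<in>UNIV. w (?f j))"
    by (intro distr_distr[symmetric] X measurable_restrict measurable_component_singleton) (simp add: clks_index)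
  also have "\<dots> = CLOCKS"
    unfolding law
  proof (rule distr_PiM_reindex[of ?I "\<lambda>_. EXP" ?f UNIV])
    show "inj ?f" by (intro option.inj_map) (auto simp: inj_def)
  qed (auto simp: EXP.prob_space_axioms clks_index)
  finally show ?thesis .
qed

text \<open>
  A mark with number \<open>i + 1\<close> comes no later than \<open>t\<close> exactly if more than \<open>i\<close> marks are counted up to
  \<open>t\<close>. Hence the positions are measurable with respect to the counting processes, the
  \<open>\<sigma>\<close>-algebra whose independence of the clocks is assumed.
\<close>
lemma pos_measurable_marks:
  "pos \<in> measurable (vimage_algebra (space M) (\<lambda>\<omega> x. \<lambda>s\<in>{0..}. num_marks (\<sigma> x) s \<omega>) (\<Pi>\<^sub>M x\<in>UNIV. \<Pi>\<^sub>M s\<in>{0..}. count_space UNIV)) POS"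
  (is "_ \<in> measurable ?V _")
proof (rule measurable_PiM_single')
  fix m :: "'s \<times> nat"
  obtain x i where m: "m = (x, i)" by (cases m)
  have Y: "(\<lambda>\<omega> x. \<lambda>s\<in>{0..}. num_marks (\<sigma> x) s \<omega>) \<in> measurable ?V (\<Pi>\<^sub>M x\<in>UNIV. \<Pi>\<^sub>M s\<in>{0..}. count_space UNIV)"
    by (rule measurable_vimage_algebra1) (auto simp: space_PiM split: if_splits)
  have N: "(\<lambda>\<omega>. num_marks (\<sigma> x) t \<omega>) \<in> measurable ?V (count_space UNIV)" if "0 \<le> t" for t
  proof -
    have 1: "(\<lambda>y. y x) \<in> measurable (\<Pi>\<^sub>M x\<in>(UNIV :: 's set). \<Pi>\<^sub>M s\<in>{0::real..}. count_space (UNIV :: nat set)) (\<Pi>\<^sub>M s\<in>{0..}. count_space UNIV)"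
      by (rule measurable_component_singleton) simp
    have 2: "(\<lambda>y. y t) \<in> measurable (\<Pi>\<^sub>M s\<in>{0::real..}. count_space (UNIV :: nat set)) (count_space UNIV)"
      using that by (intro measurable_component_singleton) simp
    show ?thesis using measurable_compose[OF measurable_compose[OF Y 1] 2] that by simp
  qed
  show "(\<lambda>\<omega>. pos \<omega> m) \<in> borel_measurable ?V"
    unfolding borel_measurable_iff_le
  proof
    fix t
    show "{\<omega> \<in> space ?V. pos \<omega> m \<le> t} \<in> sets ?V"
    proof (cases "0 \<le> t")
      case True
      have "{\<omega> \<in> space ?V. pos \<omega> m \<le> t} = (\<lambda>\<omega>. num_marks (\<sigma> x) t \<omega>) -` {i<..} \<inter> space ?V"
        by (auto simp: m num_marks_eq_cnt less_cnt_iff regular_pos_path)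
      then show ?thesis using measurable_sets[OF N[OF True]] by simp
    next
      case False
      then have "{\<omega> \<in> space ?V. pos \<omega> m \<le> t} = {}"
        using regular_pos[OF regular_pos_path, of _ m] by (auto simp: not_le) (metis less_le_trans not_less_iff_gr_or_eq order_less_trans)
      then show ?thesis by (simp only: sets.empty_sets)
    qed
  qed
qed (auto simp: space_PiM)

lemma clks_measurable_clocks:
  "clks \<in> measurable (vimage_algebra (space M) (\<lambda>\<omega>. \<lambda>j\<in>clock_index. clock_family T0 T j \<omega>) (\<Pi>\<^sub>M j\<in>clock_index. borel)) CLOCKS"
  (is "_ \<in> measurable ?V _")
  unfolding measurable_cong_sets[OF refl sets_CLOCKS]
proof (rule measurable_PiM_single')
  fix j :: "('s \<times> nat) option"
  have Y: "(\<lambda>\<omega>. \<lambda>j\<in>clock_index. clock_family T0 T j \<omega>) \<in> measurable ?V (\<Pi>\<^sub>M j\<in>clock_index. borel)"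
    by (rule measurable_vimage_algebra1) (auto simp: space_PiM)
  from measurable_compose[OF Y measurable_component_singleton[OF clks_index[of j]]]
  show "(\<lambda>\<omega>. clks \<omega> j) \<in> borel_measurable ?V" by (simp add: clks_def clks_index)
qed (auto simp: space_PiM)

lemma joint_law: "distr M law.P (\<lambda>\<omega>. (pos \<omega>, clks \<omega>)) = law.P"
proof (rule pair_measure_eqI[symmetric])
  show "sigma_finite_measure PN" "sigma_finite_measure law.CL" by unfold_locales
  have [measurable]: "pos \<in> measurable M PN" by (simp add: PN_def)
  have pair: "(\<lambda>\<omega>. (pos \<omega>, clks \<omega>)) \<in> measurable M law.P" by measurable
  fix A B assume A: "A \<in> sets PN" and B: "B \<in> sets law.CL"
  have "emeasure (distr M law.P (\<lambda>\<omega>. (pos \<omega>, clks \<omega>))) (A \<times> B) = emeasure M ((pos -` A \<inter> space M) \<inter> (clks -` B \<inter> space M))"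
    using A B by (subst emeasure_distr[OF pair]) (auto intro!: arg_cong[where f = "emeasure M"])
  also have "\<dots> = ennreal (prob (pos -` A \<inter> space M) * prob (clks -` B \<inter> space M))"
    unfolding emeasure_eq_measure
  proof (intro arg_cong[where f = ennreal] indep_setD[OF marks_clocks_indep])
    show "pos -` A \<inter> space M \<in> sets (vimage_algebra (space M) (\<lambda>\<omega> x. \<lambda>s\<in>{0..}. num_marks (\<sigma> x) s \<omega>) (\<Pi>\<^sub>M x\<in>UNIV. \<Pi>\<^sub>M s\<in>{0..}. count_space UNIV))"
      using measurable_sets[OF pos_measurable_marks, of A] A by (simp add: PN_def)
    show "clks -` B \<inter> space M \<in> sets (vimage_algebra (space M) (\<lambda>\<omega>. \<lambda>j\<in>clock_index. clock_family T0 T j \<omega>) (\<Pi>\<^sub>M j\<in>clock_index. borel))"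
      using measurable_sets[OF clks_measurable_clocks B] by simp
  qed
  also have "\<dots> = emeasure PN A * emeasure (distr M CLOCKS clks) B"
    using A B by (simp add: PN_def emeasure_distr emeasure_eq_measure ennreal_mult)
  finally show "emeasure PN A * emeasure law.CL B = emeasure (distr M law.P (\<lambda>\<omega>. (pos \<omega>, clks \<omega>))) (A \<times> B)"
    by (simp add: clks_distr)
qed simp

lemma clock_process_eq:
  assumes \<omega>: "\<omega> \<in> space M"
  shows "clock_process \<gamma> c \<sigma> T0 T y s \<omega> = ennreal (ext_gamma \<gamma> y * clks \<omega> None) + clk (pos \<omega>) (clks \<omega>) s"
proof -
  have "(\<Sum>i = 1..num_marks (\<sigma> z) s \<omega>. ennreal (\<gamma> z * T z i \<omega>)) =
    (\<integral>\<^sup>+i. jump (clks \<omega>) (z, i) * indicator {..s} (pos \<omega> (z, i)) \<partial>count_space UNIV)" for z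
  proof -
    let ?n = "cnt (pos \<omega>) z s"
    have "(\<Sum>i = 1..num_marks (\<sigma> z) s \<omega>. ennreal (\<gamma> z * T z i \<omega>)) = (\<Sum>i<?n. jump (clks \<omega>) (z, i))"
      unfolding num_marks_eq_cnt[OF \<omega>]
      by (rule sum.reindex_bij_witness[where i = Suc and j = "\<lambda>i. i - 1"]) (auto simp: jump_def clks_def clock_family_def)
    also have "\<dots> = (\<integral>\<^sup>+i. jump (clks \<omega>) (z, i) * indicator {..<?n} i \<partial>count_space UNIV)"
      by (simp add: nn_integral_count_space_indicator[symmetric] nn_integral_count_space_finite)
    also have "\<dots> = (\<integral>\<^sup>+i. jump (clks \<omega>) (z, i) * indicator {..s} (pos \<omega> (z, i)) \<partial>count_space UNIV)"
      by (intro nn_integral_cong) (auto simp: less_cnt_iff[OF regular_pos_path[OF \<omega>]] split: split_indicator)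
    finally show ?thesis .
  qed
  then have "(\<Sum>\<^sub>\<infinity>z. \<Sum>i = 1..num_marks (\<sigma> z) s \<omega>. ennreal (\<gamma> z * T z i \<omega>)) = mass {..s} (pos \<omega>) (clks \<omega>)"
    by (simp add: infsum_ennreal_eq_nn_integral[OF infinite_sites] mass_def
        nn_integral_fst_count_space[of "\<lambda>m. jump (clks \<omega>) m * indicator {..s} (pos \<omega> m)"])
  then show ?thesis by (simp add: clock_process_def clk_def clks_def clock_family_def add.assoc)
qed

text \<open>
  The truncation at \<open>0\<close> makes this true for all outcomes, including those where the initial clock is
  negative. An identity outside a null set would not give the measurability of the K process, as
  the probability space need not be complete.
\<close>
lemma K_process_eq:
  assumes \<omega>: "\<omega> \<in> space M" and t: "0 \<le> t"
  shows "K_process \<gamma> c \<sigma> T0 T y t \<omega> = delayed_state y t (max 0 (clks \<omega> None)) (pos \<omega>, clks \<omega>)"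
proof -
  define a where "a = ext_gamma \<gamma> y * max 0 (clks \<omega> None)"
  have a: "0 \<le> a" using ext_gamma_nonneg by (simp add: a_def)
  have T0_eq: "T0 \<omega> = clks \<omega> None" by (simp add: clks_def clock_family_def)
  have initial: "ennreal (ext_gamma \<gamma> y * clks \<omega> None) = ennreal a" "t < ext_gamma \<gamma> y * clks \<omega> None \<longleftrightarrow> t < a"
    using t mult_nonneg_nonpos[OF ext_gamma_nonneg[of y], of "clks \<omega> None"]
    by (auto simp: a_def max_def ennreal_neg)
  have cp: "clock_process \<gamma> c \<sigma> T0 T y s \<omega> = ennreal a + clk (pos \<omega>) (clks \<omega>) s" for s
    by (simp add: clock_process_eq[OF \<omega>] initial)
  have Lim: "Lim (at_left b) (\<lambda>s. clock_process \<gamma> c \<sigma> T0 T y s \<omega>) = ennreal a + clk_pre (pos \<omega>) (clks \<omega>) b" for b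
    unfolding cp by (intro tendsto_Lim tendsto_add tendsto_const clk_tendsto_at_left) simp
  show ?thesis
  proof (cases "t < a")
    case True
    then show ?thesis by (simp add: K_process_def delayed_state_def T0_eq initial) (simp add: a_def)
  next
    case False
    have split: "ennreal a + z \<le> ennreal t \<longleftrightarrow> z \<le> ennreal (t - a)" "ennreal t < ennreal a + z \<longleftrightarrow> ennreal (t - a) < z" for z
    proof -
      have "ennreal t = ennreal a + ennreal (t - a)" using a False by (simp flip: ennreal_plus)
      then show "ennreal a + z \<le> ennreal t \<longleftrightarrow> z \<le> ennreal (t - a)" "ennreal t < ennreal a + z \<longleftrightarrow> ennreal (t - a) < z"
        by (simp_all add: ennreal_add_left_cancel_le ennreal_add_left_cancel_less)
    qed
    have "ennreal t \<in> sojourn_set \<gamma> c \<sigma> T0 T y x \<omega> \<longleftrightarrow> (\<exists>i. sojourn (pos \<omega>) (clks \<omega>) (t - a) (x, i))" for x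
    proof -
      have "ennreal t \<in> sojourn_set \<gamma> c \<sigma> T0 T y x \<omega> \<longleftrightarrow>
        (\<exists>i\<in>{1..}. clk_pre (pos \<omega>) (clks \<omega>) (\<sigma> x i \<omega>) \<le> ennreal (t - a) \<and> ennreal (t - a) < clk (pos \<omega>) (clks \<omega>) (\<sigma> x i \<omega>))"
        unfolding sojourn_set_def Lim by (simp add: cp split)
      also have "{1..} = range Suc" by (auto simp: image_iff Suc_le_eq dest: gr0_implies_Suc)
      finally have "ennreal t \<in> sojourn_set \<gamma> c \<sigma> T0 T y x \<omega> \<longleftrightarrow>
        (\<exists>i\<in>range Suc. clk_pre (pos \<omega>) (clks \<omega>) (\<sigma> x i \<omega>) \<le> ennreal (t - a) \<and> ennreal (t - a) < clk (pos \<omega>) (clks \<omega>) (\<sigma> x i \<omega>))" .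
      moreover have "pos \<omega> (x, i) = \<sigma> x (Suc i) \<omega>" for i by (simp add: pos_def)
      ultimately show ?thesis by (simp add: sojourn_def)
    qed
    then show ?thesis using False by (simp add: K_process_def delayed_state_def state_def a_def[symmetric] T0_eq initial)
  qed
qed

lemma integral_transfer:
  assumes "g \<in> borel_measurable law.P"
  shows "(\<integral>\<omega>. (g (pos \<omega>, clks \<omega>) :: real) \<partial>M) = (\<integral>z. g z \<partial>law.P)"
proof -
  have [measurable]: "pos \<in> measurable M PN" by (simp add: PN_def)
  have "(\<integral>z. g z \<partial>distr M law.P (\<lambda>\<omega>. (pos \<omega>, clks \<omega>))) = (\<integral>\<omega>. g (pos \<omega>, clks \<omega>) \<partial>M)"
    by (rule integral_distr) (use assms in measurable)
  then show ?thesis by (simp add: joint_law)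
qed

lemma integral_K_process:
  fixes f :: "nat \<Rightarrow> 's option \<Rightarrow> real" and g :: "'s option \<Rightarrow> real"
  assumes t: "\<And>i. i \<in> I \<Longrightarrow> 0 \<le> t i" and u: "0 \<le> u"
  shows "(\<integral>\<omega>. (\<Prod>i\<in>I. f i (K_process \<gamma> c \<sigma> T0 T y (t i) \<omega>)) * g (K_process \<gamma> c \<sigma> T0 T y u \<omega>) \<partial>M) =
    (\<integral>z. (\<Prod>i\<in>I. f i (delayed_state y (t i) (snd z None) z)) * g (delayed_state y u (snd z None) z) \<partial>law.P)"
proof -
  let ?G = "\<lambda>v z. (\<Prod>i\<in>I. f i (delayed_state y (t i) v z)) * g (delayed_state y u v z)"
  have "(\<integral>\<omega>. (\<Prod>i\<in>I. f i (K_process \<gamma> c \<sigma> T0 T y (t i) \<omega>)) * g (K_process \<gamma> c \<sigma> T0 T y u \<omega>) \<partial>M) =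
    (\<integral>\<omega>. ?G (max 0 (snd (pos \<omega>, clks \<omega>) None)) (pos \<omega>, clks \<omega>) \<partial>M)"
    using t u by (intro Bochner_Integration.integral_cong refl) (simp add: K_process_eq)
  also have "\<dots> = (\<integral>z. ?G (max 0 (snd z None)) z \<partial>law.P)"
    by (rule integral_transfer) measurable
  also have "\<dots> = (\<integral>z. ?G (snd z None) z \<partial>law.P)"
  proof (rule integral_cong_AE)
    have "AE z in law.P. 0 \<le> snd z None"
      by (intro AE_snd law.prob_PN prob_space_CLOCKS AE_CLOCKS_nonneg)
    then show "AE z in law.P. ?G (max 0 (snd z None)) z = ?G (snd z None) z"
      by eventually_elim (simp add: max_def)
  qed measurable
  finally show ?thesis .
qed

lemma K_semigroup_eq:
  assumes "\<And>y. \<bar>f y\<bar> \<le> C" "0 \<le> s"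
  shows "K_semigroup M \<gamma> c \<sigma> T0 T s f y = law.semigroup f s y"
  using integral_K_process[of "{}" undefined s undefined y f] law.semigroup_eq[OF assms] assms(2)
  by (simp add: K_semigroup_def)

end

theorem theorem4p6:
  fixes M :: "'w measure"
    and \<gamma> rate :: "'s :: countable \<Rightarrow> real"
    and c :: real
    and \<sigma> :: "'s \<Rightarrow> nat \<Rightarrow> 'w \<Rightarrow> real"
    and T0 :: "'w \<Rightarrow> real"
    and T :: "'s \<Rightarrow> nat \<Rightarrow> 'w \<Rightarrow> real"
    and y :: "'s option"
    and m :: nat
    and t :: "nat \<Rightarrow> real"
    and f :: "nat \<Rightarrow> 's option \<Rightarrow> real"
  assumes "infinite (UNIV :: 's set)"
    and "\<And>x. 0 < \<gamma> x" and "\<And>x. 0 < rate x" and "0 \<le> c"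
    and "\<not> rate summable_on UNIV"
    and "(\<lambda>x. rate x * \<gamma> x) summable_on UNIV"
    and "prob_space M"
    and "\<And>x. poisson_process M (rate x) (\<sigma> x)"
    and "prob_space.indep_vars M (\<lambda>_. \<Pi>\<^sub>M s\<in>{0..}. count_space UNIV)
           (\<lambda>x \<omega>. \<lambda>s\<in>{0..}. num_marks (\<sigma> x) s \<omega>) UNIV"
    and "\<And>j. j \<in> clock_index \<Longrightarrow>
           distributed M lborel (clock_family T0 T j) (exponential_density 1)"
    and "prob_space.indep_vars M (\<lambda>_. borel) (clock_family T0 T) clock_index"
    and "prob_space.indep_set M
           (sets (vimage_algebra (space M)
              (\<lambda>\<omega> x. \<lambda>s\<in>{0..}. num_marks (\<sigma> x) s \<omega>)
              (\<Pi>\<^sub>M x\<in>UNIV. \<Pi>\<^sub>M s\<in>{0..}. count_space UNIV)))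
           (sets (vimage_algebra (space M)
              (\<lambda>\<omega>. \<lambda>j\<in>clock_index. clock_family T0 T j \<omega>)
              (\<Pi>\<^sub>M j\<in>clock_index. borel)))"
    and "1 \<le> m"
    and "0 \<le> t 1" and "\<And>i. i \<in> {1..m} \<Longrightarrow> t i < t (Suc i)"
    and "\<And>i. i \<in> {1..Suc m} \<Longrightarrow>
           continuous_map (Metric_space.mtopology UNIV (K_dist \<gamma>)) euclideanreal (f i)"
    and "\<And>i. i \<in> {1..Suc m} \<Longrightarrow> bounded (range (f i))"
  defines "X \<equiv> K_process \<gamma> c \<sigma> T0 T y"
    and "\<Psi> \<equiv> K_semigroup M \<gamma> c \<sigma> T0 T"
  shows "(\<integral>\<omega>. (\<Prod>i=1..m. f i (X (t i) \<omega>)) * f (Suc m) (X (t (Suc m)) \<omega>) \<partial>M) =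
         (\<integral>\<omega>. (\<Prod>i=1..m. f i (X (t i) \<omega>)) *
              \<Psi> (t (Suc m) - t m) (f (Suc m)) (X (t m) \<omega>) \<partial>M)"
proof -
  interpret K_setup M \<gamma> c rate \<sigma> T0 T
    by (intro K_setup.intro K_params.intro K_setup_axioms.intro; rule assms)
  have "\<forall>i\<in>{1..Suc m}. \<exists>B. \<forall>y. \<bar>f i y\<bar> \<le> B"
    using assms(17) unfolding bounded_iff by fastforce
  then obtain B where B: "\<And>i y. i \<in> {1..Suc m} \<Longrightarrow> \<bar>f i y\<bar> \<le> B i" by metis
  define C where "C = Max (B ` {1..Suc m})"
  have C: "\<bar>f i y\<bar> \<le> C" if "i \<in> {1..Suc m}" for i y
    using B[OF that, of y] that by (auto simp: C_def intro: order_trans Max_ge)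
  have t_mono: "t 1 \<le> t i" if "i \<in> {1..Suc m}" for i
  proof -
    have "1 \<le> i" "i \<le> Suc m" using that by auto
    then show ?thesis
    proof (induction i rule: dec_induct)
      case (step n)
      then show ?case using assms(15)[of n] by simp
    qed simp
  qed
  have t: "0 \<le> t i" if "i \<in> {1..Suc m}" for i using t_mono[OF that] assms(14) by simp
  have s: "0 \<le> t (Suc m) - t m" using assms(15)[of m] assms(13) by simp
  have \<Psi>: "\<Psi> (t (Suc m) - t m) (f (Suc m)) = law.semigroup (f (Suc m)) (t (Suc m) - t m)"
    unfolding \<Psi>_def by (intro ext K_semigroup_eq[OF C s]) simp
  have t_inner: "0 \<le> t i" if "i \<in> {1..m}" for i using t that by simp
  have t_last: "0 \<le> t m" "0 \<le> t (Suc m)" using t assms(13) by simp_all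
  have transfer: "(\<integral>\<omega>. (\<Prod>i=1..m. f i (X (t i) \<omega>)) * g (X u \<omega>) \<partial>M) =
      (\<integral>z. (\<Prod>i=1..m. f i (delayed_state y (t i) (snd z None) z)) * g (delayed_state y u (snd z None) z) \<partial>law.P)"
    if "0 \<le> u" for g u
    unfolding X_def by (rule integral_K_process[OF t_inner that])
  show ?thesis
    unfolding \<Psi> transfer[OF t_last(2)] transfer[OF t_last(1)]
  proof (rule law.delayed_markov[OF assms(13,14,15) C])
    show "\<exists>d>0. \<forall>x. \<gamma> x < d \<longrightarrow> \<bar>f (Suc m) (Some x) - f (Suc m) None\<bar> < e" if "0 < e" for e
      using continuous_at_infinity[OF assms(16) that] by simp
  qed
qed

end
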